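(* Let $n=3$, let $\Omega\subset\mathbb{R}^3$ be a connected bounded open set with Lipschitz boundary, $a,\tilde a\in L^\infty(\Omega)$ with $0<m\le a,\tilde a\le M$, and $F=\nabla f$, $\tilde F=\nabla\tilde f$ with $f,\tilde f\in C^1(\Omega)\cap C(\overline\Omega)$, $\|F\|_{L^1(\Omega)}\le k_1$. Let $u,u_1,u_2,\tilde u$ be admissible for the data $(a,F,H)$, $(a,F,\tilde H)$, $(\tilde a,F,\tilde H)$, $(\tilde a,\tilde F,\tilde H)$ respectively (with constants $\sigma_0,\sigma_1,m,M$), all vanishing on $\partial\Omega$, with coefficients $\sigma,\sigma^{(1)},\sigma^{(2)},\tilde\sigma$. Suppose $F,\tilde F\in C^2(\overline\Omega)$, $H,\tilde H\in C^1(\overline\Omega)$, $\sigma,\sigma^{(1)},\sigma^{(2)},\tilde\sigma\in C^2(\overline\Omega)$, with $C^2(\Omega)$-norms of $F,\tilde F$ and $C^1(\Omega)$-norms of $H,\tilde H$ at most $k_2$, and $C^2(\Omega)$-norms of the four coefficients at most $\sigma_2$. Suppose that for each $v\in\{u+f,\ u_1+f,\ u_2+f\}$ the level sets of $v$ can be foliated to one-dimensional curves (with constants $c_g,C_g,K$) and are well-structured (with constant $\tilde K$). Then $$\|\nabla u-\nabla\tilde u\|_{L^1(\Omega)}\le C\left(\|H-\tilde H\|_{L^\infty(\Omega)}^{1/4}+\|a-\tilde a\|_{L^\infty(\Omega)}^{1/4}+\|F-\tilde F\|_{L^1(\Omega)}^{1/4}\right)$$ for some constant $C$ (depending only on $\Omega,m,M,k_1,k_2,K,\tilde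 K,\sigma_0,\sigma_1,\sigma_2,c_g,C_g$) independent of $\tilde u$ and $\tilde\sigma$.
   Context: Admissibility: fix $\sigma_0,\sigma_1>0$. For data $(a,F,H)$, $u\in C^1(\overline\Omega)$ is admissible if $u$ minimizes $\int_\Omega(a|Dw+F|+Hw)\,dx$ over $w\in H_0^1(\Omega)$ and there is $\sigma\in C(\Omega)$ with $0<\sigma_0\le\sigma\le\sigma_1$ such that $J=\sigma(\nabla u+F)$ and $m\le|J|\le M$. Here $J$ is the flux field of the problem (a solution of the dual problem of maximizing $\int_\Omega F\cdot b\,dx$ over $b\in L^2(\Omega;\mathbb{R}^n)$ with $|b|\le a$ a.e. and $\int_\Omega(\nabla w\cdot b+Hw)\,dx=0$ for all $w\in H^1_0(\Omega)$); thus $\nabla\cdot J=H$ weakly, $|J|=a$ and the coefficient is $\sigma=a/|\nabla u+F|$. Foliation ($n=3$): the level sets of $v$ can be foliated to one-dimensional curves if for almost every $t$ in the range of $v$ there is a $C^1$ function $g_t$ on the surface $\{v=t\}\cap\Omega$ with $0<c_g\le|\nabla g_t|\le C_g$ (surface gradient; constants independent of $t$), such that for almost every $r\in\mathbb{R}$ every connected component of $\{v=t\}\cap\{g_t=r\}\cap\Omega$ is a $C^1$ curve reaching $\partial\Omega$, and $\sup_{t,r}\int_{\{v=t\}\cap\{g_t=r\}\cap\Omega}dl\le K<\infty$. Well-structured level sets ($n=3$, for the curves of the foliation): with a constant $\tilde K$, for a.e. $x\in\Omega$, every $h\in S^{2}$ and all sufficiently small $t\neq0$: if $\gamma$ is the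 arc-length parametrization of the foliation curve through $x$, with $\gamma(0)\in\partial\Omega$ and $\gamma(s_0)=x$, then the foliation curve through $x+th$ has a $C^1$ parametrization $\gamma_t$ with $\gamma_t(0)\in\partial\Omega$, $\gamma_t(s_0)=x+th$, such that $|\gamma_t'(s)-\gamma'(s)|\le\tilde K|t|$ for $s\in[0,s_0]$, and the limit $B_{x,h}(s)=\lim_{t\to0}\frac{\gamma_t(s)-\gamma(s)}{t}$ exists, with $B_{x,h}$ bounded uniformly in $x,h,s$. *)

theory Defs
  imports "HOL-Analysis.Analysis" "HOL-Probability.Essential_Supremum"
begin

section \<open>Function spaces and norms\<close>

definition partial_deriv :: "'n::finite \<Rightarrow> (real^'n \<Rightarrow> real) \<Rightarrow> real^'n \<Rightarrow> real" where
  "partial_deriv i f x = frechet_derivative f (at x) (axis i 1)"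

definition grad :: "(real^'n::finite \<Rightarrow> real) \<Rightarrow> real^'n \<Rightarrow> real^'n" where
  "grad f x = (\<chi> i. partial_deriv i f x)"

text \<open>\<open>C\<^sup>k(S)\<close> for an open set \<open>S\<close>.\<close>
primrec Ck_on :: "nat \<Rightarrow> (real^'n::finite) set \<Rightarrow> (real^'n \<Rightarrow> real) \<Rightarrow> bool" where
  "Ck_on 0 S f \<longleftrightarrow> continuous_on S f"
| "Ck_on (Suc k) S f \<longleftrightarrow> (\<forall>x\<in>S. f differentiable (at x)) \<and> (\<forall>i. Ck_on k S (partial_deriv i f))"

text \<open>\<open>C\<^sup>k\<close> up to the boundary, for a bounded open set \<open>S\<close>: every derivative of order at most \<open>k\<close> is
  uniformly continuous on \<open>S\<close>, i.e. extends continuously to \<open>closure S\<close>. The values of \<open>f\<close> outside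
  of \<open>S\<close> play no role.\<close>
primrec Ck_closure :: "nat \<Rightarrow> (real^'n::finite) set \<Rightarrow> (real^'n \<Rightarrow> real) \<Rightarrow> bool" where
  "Ck_closure 0 S f \<longleftrightarrow> uniformly_continuous_on S f"
| "Ck_closure (Suc k) S f \<longleftrightarrow> uniformly_continuous_on S f \<and> (\<forall>x\<in>S. f differentiable (at x)) \<and>
     (\<forall>i. Ck_closure k S (partial_deriv i f))"

text \<open>The maximum of the suprema over \<open>S\<close> of all partial derivatives of order at most \<open>k\<close>; only used
  for functions in \<open>Ck_closure k S\<close>, for which these suprema are finite.\<close>
primrec Ck_norm :: "nat \<Rightarrow> (real^'n::finite) set \<Rightarrow> (real^'n \<Rightarrow> real) \<Rightarrow> real" where
  "Ck_norm 0 S f = (SUP x\<in>S. \<bar>f x\<bar>)"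
| "Ck_norm (Suc k) S f = max (SUP x\<in>S. \<bar>f x\<bar>) (MAX i. Ck_norm k S (partial_deriv i f))"

definition Ck_closure_field :: "nat \<Rightarrow> (real^'n::finite) set \<Rightarrow> (real^'n \<Rightarrow> real^'n) \<Rightarrow> bool" where
  "Ck_closure_field k S F \<longleftrightarrow> (\<forall>i. Ck_closure k S (\<lambda>x. F x $ i))"

definition Ck_norm_field :: "nat \<Rightarrow> (real^'n::finite) set \<Rightarrow> (real^'n \<Rightarrow> real^'n) \<Rightarrow> real" where
  "Ck_norm_field k S F = (MAX i. Ck_norm k S (\<lambda>x. F x $ i))"

definition L1_norm :: "(real^'n::finite) set \<Rightarrow> (real^'n \<Rightarrow> 'b::real_normed_vector) \<Rightarrow> real" where
  "L1_norm S f = (LINT x|lebesgue_on S. norm (f x))"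

definition Linf_norm :: "(real^'n::finite) set \<Rightarrow> (real^'n \<Rightarrow> real) \<Rightarrow> real" where
  "Linf_norm S f = real_of_ereal (esssup (lebesgue_on S) (\<lambda>x. ereal \<bar>f x\<bar>))"

definition in_L2 :: "(real^'n::finite) set \<Rightarrow> (real^'n \<Rightarrow> 'b::euclidean_space) \<Rightarrow> bool" where
  "in_L2 S f \<longleftrightarrow> f \<in> borel_measurable (lebesgue_on S) \<and>
     integrable (lebesgue_on S) (\<lambda>x. (norm (f x))\<^sup>2)"

definition test_function :: "(real^'n::finite) set \<Rightarrow> (real^'n \<Rightarrow> real) \<Rightarrow> bool" where
  "test_function S \<phi> \<longleftrightarrow> (\<forall>k. Ck_on k UNIV \<phi>) \<and>
     (\<exists>A. compact A \<and> A \<subseteq> S \<and> (\<forall>x. x \<notin> A \<longrightarrow> \<phi> x = 0))"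

text \<open>\<open>w\<close> belongs to \<open>H\<^sub>0\<^sup>1(S)\<close>, the closure of the test functions in \<open>H\<^sup>1(S)\<close>, and \<open>G\<close> is its weak
  gradient. The \<open>H\<^sup>1\<close> limit determines \<open>G\<close> up to null sets, so that quantifying over the pairs
  \<open>(w, G)\<close> is quantifying over \<open>H\<^sub>0\<^sup>1(S)\<close>.\<close>
definition H10 :: "(real^'n::finite) set \<Rightarrow> (real^'n \<Rightarrow> real) \<Rightarrow> (real^'n \<Rightarrow> real^'n) \<Rightarrow> bool" where
  "H10 S w G \<longleftrightarrow> in_L2 S w \<and> in_L2 S G \<and>
     (\<exists>\<phi> :: nat \<Rightarrow> real^'n \<Rightarrow> real. (\<forall>k. test_function S (\<phi> k)) \<and>
        (\<lambda>k. LINT x|lebesgue_on S. (\<phi> k x - w x)\<^sup>2) \<longlonglongrightarrow> 0 \<and>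
        (\<lambda>k. LINT x|lebesgue_on S. (norm (grad (\<phi> k) x - G x))\<^sup>2) \<longlonglongrightarrow> 0)"

text \<open>Near each of its boundary points, \<open>S\<close> is, in suitable orthonormal coordinates, the region above
  the graph of a Lipschitz function. Here \<open>\<nu>\<close> is the last coordinate axis and \<open>x - (x \<bullet> \<nu>) *\<^sub>R \<nu>\<close>
  represents the remaining coordinates of \<open>x\<close>.\<close>
definition lipschitz_boundary :: "(real^'n::finite) set \<Rightarrow> bool" where
  "lipschitz_boundary S \<longleftrightarrow> (\<forall>p\<in>frontier S. \<exists>\<nu> L \<phi>. \<exists>\<epsilon>>0.
     norm \<nu> = 1 \<and> L-lipschitz_on {y. y \<bullet> \<nu> = 0} \<phi> \<and>
     (\<forall>x\<in>ball p \<epsilon>. x \<in> S \<longleftrightarrow> \<phi> (x - (x \<bullet> \<nu>) *\<^sub>R \<nu>) < x \<bullet> \<nu>))"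

section \<open>Admissible functions\<close>

definition energy :: "(real^'n::finite) set \<Rightarrow> (real^'n \<Rightarrow> real) \<Rightarrow> (real^'n \<Rightarrow> real^'n) \<Rightarrow> (real^'n \<Rightarrow> real) \<Rightarrow>
    (real^'n \<Rightarrow> real) \<Rightarrow> (real^'n \<Rightarrow> real^'n) \<Rightarrow> real" where
  "energy \<Omega> a F H w G = (LINT x|lebesgue_on \<Omega>. a x * norm (G x + F x) + H x * w x)"

definition minimizer :: "(real^'n::finite) set \<Rightarrow> (real^'n \<Rightarrow> real) \<Rightarrow> (real^'n \<Rightarrow> real^'n) \<Rightarrow>
    (real^'n \<Rightarrow> real) \<Rightarrow> (real^'n \<Rightarrow> real) \<Rightarrow> bool" where
  "minimizer \<Omega> a F H u \<longleftrightarrow> H10 \<Omega> u (grad u) \<and>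
     (\<forall>w G. H10 \<Omega> w G \<longrightarrow> energy \<Omega> a F H u (grad u) \<le> energy \<Omega> a F H w G)"

definition dual_feasible :: "(real^'n::finite) set \<Rightarrow> (real^'n \<Rightarrow> real) \<Rightarrow> (real^'n \<Rightarrow> real) \<Rightarrow>
    (real^'n \<Rightarrow> real^'n) \<Rightarrow> bool" where
  "dual_feasible \<Omega> a H b \<longleftrightarrow> in_L2 \<Omega> b \<and> (AE x in lebesgue_on \<Omega>. norm (b x) \<le> a x) \<and>
     (\<forall>w G. H10 \<Omega> w G \<longrightarrow> (LINT x|lebesgue_on \<Omega>. G x \<bullet> b x + H x * w x) = 0)"

definition dual_solution :: "(real^'n::finite) set \<Rightarrow> (real^'n \<Rightarrow> real) \<Rightarrow> (real^'n \<Rightarrow> real^'n) \<Rightarrow>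
    (real^'n \<Rightarrow> real) \<Rightarrow> (real^'n \<Rightarrow> real^'n) \<Rightarrow> bool" where
  "dual_solution \<Omega> a F H J \<longleftrightarrow> dual_feasible \<Omega> a H J \<and>
     (\<forall>b. dual_feasible \<Omega> a H b \<longrightarrow>
        (LINT x|lebesgue_on \<Omega>. F x \<bullet> b x) \<le> (LINT x|lebesgue_on \<Omega>. F x \<bullet> J x))"

definition flux :: "(real^'n::finite \<Rightarrow> real) \<Rightarrow> (real^'n \<Rightarrow> real) \<Rightarrow> (real^'n \<Rightarrow> real^'n) \<Rightarrow> real^'n \<Rightarrow> real^'n" where
  "flux \<sigma> u F x = \<sigma> x *\<^sub>R (grad u x + F x)"

text \<open>\<open>u\<close> is admissible for the data \<open>(a, F, H)\<close> with coefficient \<open>\<sigma>\<close>. The weak equation \<open>div J = H\<close> is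
  part of the feasibility of \<open>J\<close> for the dual problem. The last clause, \<open>|J| = a\<close>, is redundant (it
  follows by duality when \<open>a\<close>, \<open>F\<close> and \<open>H\<close> are bounded and \<open>m > 0\<close>) and says that \<open>\<sigma> = a / |grad u + F|\<close>.\<close>
definition admissible :: "real \<Rightarrow> real \<Rightarrow> real \<Rightarrow> real \<Rightarrow> (real^'n::finite) set \<Rightarrow> (real^'n \<Rightarrow> real) \<Rightarrow>
    (real^'n \<Rightarrow> real^'n) \<Rightarrow> (real^'n \<Rightarrow> real) \<Rightarrow> (real^'n \<Rightarrow> real) \<Rightarrow> (real^'n \<Rightarrow> real) \<Rightarrow> bool" where
  "admissible \<sigma>0 \<sigma>1 m M \<Omega> a F H u \<sigma> \<longleftrightarrow>
     continuous_on (closure \<Omega>) u \<and> Ck_closure 1 \<Omega> u \<and>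
     minimizer \<Omega> a F H u \<and>
     continuous_on \<Omega> \<sigma> \<and> (\<forall>x\<in>\<Omega>. \<sigma>0 \<le> \<sigma> x \<and> \<sigma> x \<le> \<sigma>1) \<and>
     (\<forall>x\<in>\<Omega>. m \<le> norm (flux \<sigma> u F x) \<and> norm (flux \<sigma> u F x) \<le> M) \<and>
     dual_solution \<Omega> a F H (flux \<sigma> u F) \<and>
     (AE x in lebesgue_on \<Omega>. norm (flux \<sigma> u F x) = a x)"

section \<open>Foliated and well-structured level sets\<close>

text \<open>One-dimensional Hausdorff (outer) measure, normalised to agree with arc length on curves.\<close>
definition hausdorff1 :: "'a::metric_space set \<Rightarrow> ennreal" where
  "hausdorff1 A = (SUP \<delta>\<in>{0<..}. INF C\<in>{C :: nat \<Rightarrow> 'a set. A \<subseteq> (\<Union>i. C i) \<and>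
      (\<forall>i. bounded (C i) \<and> diameter (C i) \<le> \<delta>)}. (\<Sum>i. ennreal (diameter (C i))))"

text \<open>\<open>g\<close> is a \<open>C\<^sup>1\<close> function on the surface \<open>{x \<in> \<Omega>. v x = t}\<close> (where \<open>grad v\<close> does not vanish) and \<open>D\<close>
  is its surface gradient: \<open>D x\<close> is tangential and represents the derivative of \<open>g\<close> along the surface.\<close>
definition C1_on_level_set :: "(real^3) set \<Rightarrow> (real^3 \<Rightarrow> real) \<Rightarrow> real \<Rightarrow> (real^3 \<Rightarrow> real) \<Rightarrow>
    (real^3 \<Rightarrow> real^3) \<Rightarrow> bool" where
  "C1_on_level_set \<Omega> v t g D \<longleftrightarrow>
     (\<forall>x\<in>{x\<in>\<Omega>. v x = t}. D x \<bullet> grad v x = 0 \<and>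
        (g has_derivative (\<lambda>h. D x \<bullet> h)) (at x within {x\<in>\<Omega>. v x = t})) \<and>
     continuous_on {x\<in>\<Omega>. v x = t} D"

definition fol_slice :: "(real^3) set \<Rightarrow> (real^3 \<Rightarrow> real) \<Rightarrow> (real \<Rightarrow> real^3 \<Rightarrow> real) \<Rightarrow> real \<Rightarrow> real \<Rightarrow>
    (real^3) set" where
  "fol_slice \<Omega> v g t r = {x\<in>\<Omega>. v x = t \<and> g t x = r}"

text \<open>\<open>\<gamma>\<close> is a regular \<open>C\<^sup>1\<close> parametrization, by the open interval from \<open>0\<close> to \<open>L\<close>, of the curve \<open>\<Gamma>\<close>
  inside \<open>\<Omega>\<close>, starting at a boundary point of \<open>\<Omega>\<close>.\<close>
definition C1_param_from_boundary :: "(real^3) set \<Rightarrow> (real^3) set \<Rightarrow> (real \<Rightarrow> real^3) \<Rightarrow> real \<Rightarrow> bool" where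
  "C1_param_from_boundary \<Omega> \<Gamma> \<gamma> L \<longleftrightarrow> 0 < L \<and>
     continuous_on {0..L} \<gamma> \<and> \<gamma> C1_differentiable_on {0<..<L} \<and>
     (\<forall>s\<in>{0<..<L}. vector_derivative \<gamma> (at s) \<noteq> 0) \<and>
     inj_on \<gamma> {0<..<L} \<and> \<gamma> ` {0<..<L} = \<Gamma> \<and> \<gamma> 0 \<in> frontier \<Omega>"

text \<open>The level sets of \<open>v\<close> are foliated by the curves cut out by the functions \<open>g t\<close>, with constants
  \<open>cg\<close>, \<open>Cg\<close>, \<open>K\<close>.\<close>
definition foliation :: "(real^3) set \<Rightarrow> (real^3 \<Rightarrow> real) \<Rightarrow> (real \<Rightarrow> real^3 \<Rightarrow> real) \<Rightarrow>
    real \<Rightarrow> real \<Rightarrow> real \<Rightarrow> bool" where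
  "foliation \<Omega> v g cg Cg K \<longleftrightarrow>
     (AE t in lebesgue. t \<in> v ` \<Omega> \<longrightarrow>
        (\<exists>D. C1_on_level_set \<Omega> v t (g t) D \<and>
             (\<forall>x\<in>\<Omega>. v x = t \<longrightarrow> cg \<le> norm (D x) \<and> norm (D x) \<le> Cg)) \<and>
        (AE r in lebesgue. \<forall>\<Gamma>\<in>components (fol_slice \<Omega> v g t r).
             \<exists>\<gamma> L. C1_param_from_boundary \<Omega> \<Gamma> \<gamma> L) \<and>
        (\<forall>r. hausdorff1 (fol_slice \<Omega> v g t r) \<le> ennreal K))"

definition leaf :: "(real^3) set \<Rightarrow> (real^3 \<Rightarrow> real) \<Rightarrow> (real \<Rightarrow> real^3 \<Rightarrow> real) \<Rightarrow> real^3 \<Rightarrow> (real^3) set" where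
  "leaf \<Omega> v g x = connected_component_set (fol_slice \<Omega> v g (v x) (g (v x) x)) x"

text \<open>A leaf has two ends on the boundary. The arc-length parametrization \<open>\<gamma>\<close> of the leaf through \<open>x\<close> may
  start at either of them: the starting end cannot be arbitrary, because the condition always fails for
  an end that is too close to \<open>x\<close> (there \<open>\<gamma>\<^sub>t(0) - \<gamma>(0)\<close> would be close to \<open>t h\<close> for every \<open>h\<close>).
  The curve \<open>\<gamma>\<^sub>t\<close> is \<open>\<eta> t\<close> below. The derivatives at \<open>0\<close> are two-sided, which is no restriction: a
  parametrization that is \<open>C\<^sup>1\<close> up to the end \<open>0\<close> extends to negative \<open>s\<close>, where its values play no role.\<close>
definition well_structured :: "(real^3) set \<Rightarrow> (real^3 \<Rightarrow> real) \<Rightarrow> (real \<Rightarrow> real^3 \<Rightarrow> real) \<Rightarrow> real \<Rightarrow> bool" where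
  "well_structured \<Omega> v g Kt \<longleftrightarrow> (\<exists>\<beta>. AE x in lebesgue_on \<Omega>.
     \<exists>\<gamma> L. \<exists>s0\<in>{0<..<L}.
       C1_param_from_boundary \<Omega> (leaf \<Omega> v g x) \<gamma> L \<and>
       (\<forall>s\<in>{0<..<L}. norm (vector_derivative \<gamma> (at s)) = 1) \<and>
       \<gamma> C1_differentiable_on {0..s0} \<and> \<gamma> s0 = x \<and>
       (\<forall>h. norm h = 1 \<longrightarrow> (\<exists>\<eta> B.
          (\<forall>\<^sub>F t in at 0. x + t *\<^sub>R h \<in> \<Omega> \<and>
             (\<exists>L'>s0. C1_param_from_boundary \<Omega> (leaf \<Omega> v g (x + t *\<^sub>R h)) (\<eta> t) L') \<and>
             \<eta> t C1_differentiable_on {0..s0} \<and> \<eta> t s0 = x + t *\<^sub>R h \<and>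
             (\<forall>s\<in>{0..s0}. norm (vector_derivative (\<eta> t) (at s) - vector_derivative \<gamma> (at s)) \<le> Kt * \<bar>t\<bar>)) \<and>
          (\<forall>s\<in>{0..s0}. ((\<lambda>t. (\<eta> t s - \<gamma> s) /\<^sub>R t) \<longlongrightarrow> B s) (at 0) \<and> norm (B s) \<le> \<beta>))))"

end

theory Submission
  imports Defs
begin

text \<open>
  Let \<open>v = u + f\<close>, \<open>w = u - u'\<close>, let \<open>n\<close>, \<open>n'\<close> be the directions of \<open>\<nabla>u + F\<close> and \<open>\<nabla>u' + F'\<close>, and let \<open>\<delta>\<close> be
  the sum of the norms of the data differences. Testing the two flux equations with \<open>w\<close> gives
  \<open>\<parallel>n - n'\<parallel>\<^sup>2 \<le> C \<delta>\<close> in \<open>L\<^sup>2\<close>, by monotonicity. Since \<open>v\<close> is constant on a leaf, the derivative of \<open>w\<close> along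
  the leaf is controlled by \<open>|n - n'|\<close> and \<open>|F - F'|\<close>, and \<open>w\<close> vanishes where the leaf meets the boundary.
  As the leaves have length at most \<open>K\<close>, slicing \<open>\<Omega>\<close> by the level sets of \<open>v\<close> and these by the leaves gives
  \<open>\<parallel>w\<parallel> \<le> C \<delta>\<^bsup>1/2\<^esup>\<close> in \<open>L\<^sup>1\<close>. Finally, divided by their coefficients, the flux equations become Poisson
  equations with bounded right-hand sides; testing their difference with \<open>w\<close> gives
  \<open>\<parallel>\<nabla>w\<parallel>\<^sup>2 \<le> C (\<parallel>w\<parallel> + \<parallel>F - F'\<parallel>) \<le> C \<delta>\<^bsup>1/2\<^esup>\<close>, with the \<open>L\<^sup>2\<close> norm on the left and \<open>L\<^sup>1\<close> norms in the middle.
\<close>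

section \<open>Graph coordinates\<close>

text \<open>The functions \<open>g t\<close> are only C1 on each level set and nothing relates them
  for different \<open>t\<close>, so they are used for one \<open>t\<close> at a time; what is
  integrated over \<open>t\<close> are chart integrals of \<open>|w|\<close> and of a Jacobian
  bound, whose measurability does not involve \<open>g\<close>. On one level set no integral along a
  leaf is formed, since the leaves have no common parametrization. Instead the surface is mapped to
  the plane by \<open>(g, w)\<close>. By the intermediate value theorem the image contains, over
  \<open>g x\<close>, the interval between 0 and \<open>w x\<close>; its area is at most the
  integral of the Jacobian, which sees only the tangential part of \<open>dw\<close>. One half of
  the coarea formula in graph charts and a lower bound for Hausdorff measure by projections then
  bring in \<open>K\<close>. The exponent 1/4 comes from two passages from a squared L2 norm to an
  L1 norm, each costing a square root. The Poisson form needs test functions divided by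
  \<open>\<sigma>\<close>; these need not be smooth, which is why mollification enters.\<close>

lemma nn_integral_substitution_signed:
  fixes h h' :: "real \<Rightarrow> real" and f :: "real \<Rightarrow> ennreal"
  assumes f[measurable]: "f \<in> borel_measurable borel" and "a < b"
    and h: "\<And>s. s \<in> {a..b} \<Longrightarrow> (h has_real_derivative h' s) (at s)"
    and h': "continuous_on {a..b} h'"
    and e: "e = 1 \<or> e = -1" and pos: "\<And>s. s \<in> {a..b} \<Longrightarrow> e * h' s > 0"
  shows "(\<integral>\<^sup>+x. f x * indicator (h ` {a..b}) x \<partial>lborel) =
    (\<integral>\<^sup>+s. f (h s) * ennreal \<bar>h' s\<bar> * indicator {a..b} s \<partial>lborel)"
proof -
  have up: "(\<integral>\<^sup>+x. f x * indicator (h ` {a..b}) x \<partial>lborel) =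
    (\<integral>\<^sup>+s. f (h s) * ennreal (h' s) * indicator {a..b} s \<partial>lborel)"
    if [measurable]: "f \<in> borel_measurable borel"
     and h: "\<And>s. s \<in> {a..b} \<Longrightarrow> (h has_real_derivative h' s) (at s)"
     and h': "continuous_on {a..b} h'" and pos: "\<And>s. s \<in> {a..b} \<Longrightarrow> h' s > 0"
    for h h' :: "real \<Rightarrow> real" and f :: "real \<Rightarrow> ennreal"
  proof -
    have ch: "continuous_on {a..b} h"
      by (meson continuous_at_imp_continuous_on DERIV_isCont h)
    have mono: "h x \<le> h y" if "x \<le> y" "x \<in> {a..b}" "y \<in> {a..b}" for x y
    proof (rule DERIV_nonneg_imp_nondecreasing[OF that(1)])
      fix z assume "x \<le> z" "z \<le> y"
      then have z: "z \<in> {a..b}" using that by auto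
      show "\<exists>d. (h has_real_derivative d) (at z) \<and> 0 \<le> d"
        using h[OF z] pos[OF z] by (intro exI[of _ "h' z"]) auto
    qed
    have "h ` {a..b} = {h a..h b}"
    proof
      show "h ` {a..b} \<subseteq> {h a..h b}" using mono \<open>a < b\<close> by auto
      show "{h a..h b} \<subseteq> h ` {a..b}"
      proof
        fix y assume "y \<in> {h a..h b}"
        then obtain x where "a \<le> x" "x \<le> b" "h x = y" using IVT'[of h a y b] ch \<open>a < b\<close> by auto
        then show "y \<in> h ` {a..b}" by auto
      qed
    qed
    moreover have "0 \<le> h' s" if "s \<in> {a..b}" for s using pos[OF that] by simp
    ultimately show ?thesis
      using nn_integral_substitution_aux[OF \<open>f \<in> _\<close> _ h h' _ \<open>a < b\<close>] by simp
  qed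
  show ?thesis using e
  proof
    assume "e = 1"
    with pos have pos': "h' s > 0" if "s \<in> {a..b}" for s using that by fastforce
    have "(\<integral>\<^sup>+s. f (h s) * ennreal (h' s) * indicator {a..b} s \<partial>lborel)
        = (\<integral>\<^sup>+s. f (h s) * ennreal \<bar>h' s\<bar> * indicator {a..b} s \<partial>lborel)"
      by (intro nn_integral_cong) (auto simp: indicator_def abs_of_pos[OF pos'])
    then show ?thesis using up[OF f h h' pos'] by simp
  next
    \<comment> \<open>The decreasing case is the increasing one for \<open>?k\<close>, after a
      reflection of the target line, which preserves \<open>lborel\<close>.\<close>
    assume e: "e = -1"
    with pos have neg: "h' s < 0" if "s \<in> {a..b}" for s using that by fastforce
    have "continuous_on {a..b} h"
      by (meson continuous_at_imp_continuous_on DERIV_isCont h)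
    then have [measurable]: "h ` {a..b} \<in> sets borel"
      by (intro borel_closed compact_imp_closed compact_continuous_image) auto
    let ?k = "\<lambda>s. - h s"
    have "(\<integral>\<^sup>+x. f x * indicator (h ` {a..b}) x \<partial>lborel)
        = (\<integral>\<^sup>+x. f (-x) * indicator (h ` {a..b}) (-x) \<partial>lborel)"
      by (subst nn_integral_distr[symmetric, where M = lborel and M' = borel and T = "uminus"])
         (auto simp: lborel_distr_uminus)
    also have "\<dots> = (\<integral>\<^sup>+x. f (-x) * indicator (?k ` {a..b}) x \<partial>lborel)"
    proof (rule nn_integral_cong)
      fix x :: real
      have "- x \<in> h ` {a..b} \<longleftrightarrow> x \<in> ?k ` {a..b}" by (auto simp: image_iff) (metis minus_minus atLeastAtMost_iff)+
      then show "f (-x) * indicator (h ` {a..b}) (-x) = f (-x) * indicator (?k ` {a..b}) x"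
        by (simp add: indicator_def)
    qed
    also have "\<dots> = (\<integral>\<^sup>+s. f (- (- h s)) * ennreal (- h' s) * indicator {a..b} s \<partial>lborel)"
      by (intro up) (auto intro!: DERIV_minus h continuous_intros h' neg)
    also have "\<dots> = (\<integral>\<^sup>+s. f (h s) * ennreal \<bar>h' s\<bar> * indicator {a..b} s \<partial>lborel)"
      by (intro nn_integral_cong) (auto simp: indicator_def abs_of_neg[OF neg])
    finally show ?thesis .
  qed
qed

lemma borel_measurable_comp_open:
  fixes \<phi> :: "'b::topological_space \<Rightarrow> ennreal" and f :: "'a::topological_space \<Rightarrow> 'b"
  assumes "open Q" "continuous_on Q f" "\<phi> \<in> borel_measurable borel"
  shows "(\<lambda>x. \<phi> (f x) * indicator Q x) \<in> borel_measurable borel"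
proof -
  have "f \<in> restrict_space borel Q \<rightarrow>\<^sub>M borel"
    using assms(2) by (rule borel_measurable_continuous_on_restrict)
  then have "(\<lambda>x. \<phi> (f x)) \<in> borel_measurable (restrict_space borel Q)"
    using assms(3) by measurable
  then show ?thesis
    using \<open>open Q\<close> by (subst (asm) borel_measurable_restrict_space_iff_ennreal) auto
qed

text \<open>The map \<open>\<Phi>\<close> straightens the level sets of \<open>h\<close> into
  sections with fixed first coordinate. It serves with a planar \<open>z\<close> for level surfaces
  and with a real \<open>z\<close> for level curves. Invariance of domain gives the open image and
  the continuous inverse, so that a derivative in \<open>s\<close> suffices. The integral bounds are
  Tonelli in \<open>z\<close> and substitution in \<open>s\<close>, with Jacobian
  \<open>|h'|\<close> between \<open>c\<close> and \<open>C\<close>.\<close>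

lemma graph_chart:
  fixes h h' :: "real \<times> 'z::euclidean_space \<Rightarrow> real"
  assumes "a < b" "open J" "0 < c"
    and deriv: "\<And>s z. s \<in> {a..b} \<Longrightarrow> z \<in> J \<Longrightarrow> ((\<lambda>s. h (s, z)) has_real_derivative h' (s, z)) (at s)"
    and cont: "continuous_on ({a<..<b} \<times> J) h"
    and cont': "\<And>z. z \<in> J \<Longrightarrow> continuous_on {a..b} (\<lambda>s. h' (s, z))"
    and e: "e = 1 \<or> e = -1"
    and bd: "\<And>s z. s \<in> {a..b} \<Longrightarrow> z \<in> J \<Longrightarrow> c \<le> e * h' (s, z) \<and> e * h' (s, z) \<le> C"
  defines "Q \<equiv> {a<..<b} \<times> J" and "\<Phi> \<equiv> \<lambda>(s, z). (h (s, z), z)"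
  shows graph_chart_inj: "inj_on \<Phi> Q" and graph_chart_open: "open (\<Phi> ` Q)"
    and graph_chart_cont_inv: "continuous_on (\<Phi> ` Q) (the_inv_into Q \<Phi>)"
    and graph_chart_lower: "\<phi> \<in> borel_measurable borel \<Longrightarrow>
      ennreal c * (\<integral>\<^sup>+\<xi>. \<phi> (\<Phi> \<xi>) * indicator Q \<xi> \<partial>lborel) \<le> (\<integral>\<^sup>+\<omega>. \<phi> \<omega> * indicator (\<Phi> ` Q) \<omega> \<partial>lborel)"
    and graph_chart_upper: "\<phi> \<in> borel_measurable borel \<Longrightarrow>
      (\<integral>\<^sup>+\<omega>. \<phi> \<omega> * indicator (\<Phi> ` Q) \<omega> \<partial>lborel) \<le> ennreal C * (\<integral>\<^sup>+\<xi>. \<phi> (\<Phi> \<xi>) * indicator Q \<xi> \<partial>lborel)"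
proof -
  have inj1: "inj_on (\<lambda>s. h (s, z)) {a..b}" if z: "z \<in> J" for z
  proof (rule inj_onI)
    fix x y assume xy: "x \<in> {a..b}" "y \<in> {a..b}" "h (x, z) = h (y, z)"
    have False if xy: "x < y" "x \<in> {a..b}" "y \<in> {a..b}" "h (x, z) = h (y, z)" for x y
    proof -
      obtain w where w: "x < w" "w < y" "h (y, z) - h (x, z) = (y - x) * h' (w, z)"
        using MVT2[OF \<open>x < y\<close>, of "\<lambda>s. h (s, z)" "\<lambda>s. h' (s, z)"]
        by (metis (no_types, lifting) deriv z xy(2,3) atLeastAtMost_iff order_trans)
      with xy have "h' (w, z) = 0" "w \<in> {a..b}" by auto
      with bd[OF _ z, of w] \<open>0 < c\<close> show False by auto
    qed
    with xy show "x = y" by (metis linorder_neqE_linordered_idom)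
  qed
  have inj2: "x = y" if "h (x, z) = h (y, z)" "x \<in> {a..b}" "y \<in> {a..b}" "z \<in> J" for x y z
    using inj1[OF that(4)] that(1-3) by (rule inj_onD)
  show inj: "inj_on \<Phi> Q"
    unfolding \<Phi>_def Q_def by (rule inj_onI) (auto intro: inj2)
  have oQ: "open Q" unfolding Q_def using \<open>open J\<close> by (intro open_Times) auto
  have cQ: "continuous_on Q \<Phi>"
    unfolding \<Phi>_def case_prod_beta prod.collapse
    using cont by (intro continuous_intros) (auto simp: Q_def)
  show oW: "open (\<Phi> ` Q)" by (rule invariance_of_domain[OF cQ oQ inj])
  show "continuous_on (\<Phi> ` Q) (the_inv_into Q \<Phi>)"
    using continuous_on_inverse_open[OF oQ cQ, of "the_inv_into Q \<Phi>"] the_inv_into_f_f[OF inj] by auto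
  have C: "0 \<le> C" if "z \<in> J" for z using bd[of a z] that \<open>a < b\<close> \<open>0 < c\<close> by auto
  {
    assume [measurable]: "\<phi> \<in> borel_measurable borel"
    have [measurable]: "J \<in> sets borel" "\<Phi> ` Q \<in> sets borel" using \<open>open J\<close> oW by auto
    have m1: "(\<lambda>\<xi>. \<phi> (\<Phi> \<xi>) * indicator Q \<xi>) \<in> borel_measurable (lborel \<Otimes>\<^sub>M lborel)"
      using borel_measurable_comp_open[OF oQ cQ, of \<phi>] by (simp add: lborel_prod)
    have m2: "(\<lambda>\<xi>. \<phi> \<xi> * indicator (\<Phi> ` Q) \<xi>) \<in> borel_measurable (lborel \<Otimes>\<^sub>M lborel)"
      by (simp add: lborel_prod)
    let ?A = "\<lambda>z. \<integral>\<^sup>+s. \<phi> (\<Phi> (s, z)) * indicator Q (s, z) \<partial>lborel"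
    let ?B = "\<lambda>z. \<integral>\<^sup>+t. \<phi> (t, z) * indicator (\<Phi> ` Q) (t, z) \<partial>lborel"
    have A: "(\<integral>\<^sup>+\<xi>. \<phi> (\<Phi> \<xi>) * indicator Q \<xi> \<partial>lborel) = (\<integral>\<^sup>+z. ?A z \<partial>lborel)"
      unfolding lborel_prod[symmetric] by (rule lborel_pair.nn_integral_snd[OF m1, symmetric])
    have B: "(\<integral>\<^sup>+\<omega>. \<phi> \<omega> * indicator (\<Phi> ` Q) \<omega> \<partial>lborel) = (\<integral>\<^sup>+z. ?B z \<partial>lborel)"
      unfolding lborel_prod[symmetric] by (rule lborel_pair.nn_integral_snd[OF m2, symmetric])
    have mA: "?A \<in> borel_measurable lborel"
      using lborel.borel_measurable_nn_integral_fst[OF measurable_pair_swap[OF m1]] by simp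
    have key: "ennreal c * ?A z \<le> ?B z \<and> ?B z \<le> ennreal C * ?A z" for z
    proof (cases "z \<in> J")
      case False
      then have "(s, z) \<notin> Q" "(s, z) \<notin> \<Phi> ` Q" for s by (auto simp: Q_def \<Phi>_def)
      then show ?thesis by simp
    next
      case z: True
      let ?h = "\<lambda>s. h (s, z)" and ?N = "\<lambda>t. \<phi> (t, z) * indicator (\<Phi> ` Q) (t, z)"
      have N: "?N \<in> borel_measurable borel" by measurable
      \<comment> \<open>Substitution acts on the closed interval while \<open>Q\<close> is open.
        Injectivity up to the end points makes the indicator of the image remove exactly those two
        points.\<close>
      have iff: "(h (s, z), z) \<in> \<Phi> ` Q \<longleftrightarrow> s \<in> {a<..<b}" if "s \<in> {a..b}" for s
        using that z by (auto simp: \<Phi>_def Q_def dest!: inj2)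
      have "?B z = (\<integral>\<^sup>+t. ?N t * indicator (?h ` {a..b}) t \<partial>lborel)"
        by (intro nn_integral_cong) (auto simp: indicator_def \<Phi>_def Q_def)
      also have "\<dots> = (\<integral>\<^sup>+s. ?N (?h s) * ennreal \<bar>h' (s, z)\<bar> * indicator {a..b} s \<partial>lborel)"
      proof (rule nn_integral_substitution_signed[OF N \<open>a < b\<close> _ cont'[OF z] e])
        show "0 < e * h' (s, z)" if "s \<in> {a..b}" for s
          using bd[OF that z] \<open>0 < c\<close> by linarith
      qed (use deriv z in auto)
      also have "\<dots> = (\<integral>\<^sup>+s. ennreal \<bar>h' (s, z)\<bar> * (\<phi> (\<Phi> (s, z)) * indicator Q (s, z)) \<partial>lborel)"
      proof (rule nn_integral_cong)
        fix s
        have Qs: "(s, z) \<in> Q \<longleftrightarrow> s \<in> {a<..<b}" "\<Phi> (s, z) = (h (s, z), z)"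
          using z by (auto simp: Q_def \<Phi>_def)
        then show "?N (?h s) * ennreal \<bar>h' (s, z)\<bar> * indicator {a..b} s
          = ennreal \<bar>h' (s, z)\<bar> * (\<phi> (\<Phi> (s, z)) * indicator Q (s, z))"
          using iff[of s] by (cases "s \<in> {a..b}") (auto simp: indicator_def mult.commute)
      qed
      finally have Bz: "?B z = \<dots>" .
      have ab: "c \<le> \<bar>h' (s, z)\<bar>" "\<bar>h' (s, z)\<bar> \<le> C" if "s \<in> {a..b}" for s
        using e bd[OF that z] \<open>0 < c\<close> by auto
      have mz: "(\<lambda>s. \<phi> (\<Phi> (s, z)) * indicator Q (s, z)) \<in> borel_measurable lborel"
        using measurable_Pair1[OF m1, of z] by simp
      have "ennreal c * ?A z = (\<integral>\<^sup>+s. ennreal c * (\<phi> (\<Phi> (s, z)) * indicator Q (s, z)) \<partial>lborel)"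
        using mz by (rule nn_integral_cmult[symmetric])
      also have "\<dots> \<le> ?B z" unfolding Bz
        by (intro nn_integral_mono)
           (auto simp: indicator_def Q_def intro!: mult_right_mono ennreal_leI ab)
      finally have 1: "ennreal c * ?A z \<le> ?B z" .
      have "?B z \<le> (\<integral>\<^sup>+s. ennreal C * (\<phi> (\<Phi> (s, z)) * indicator Q (s, z)) \<partial>lborel)" unfolding Bz
        by (intro nn_integral_mono)
           (auto simp: indicator_def Q_def intro!: mult_right_mono ennreal_leI ab)
      also have "\<dots> = ennreal C * ?A z" using mz by (rule nn_integral_cmult)
      finally show ?thesis using 1 by blast
    qed
    show "ennreal c * (\<integral>\<^sup>+\<xi>. \<phi> (\<Phi> \<xi>) * indicator Q \<xi> \<partial>lborel) \<le> (\<integral>\<^sup>+\<omega>. \<phi> \<omega> * indicator (\<Phi> ` Q) \<omega> \<partial>lborel)"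
      unfolding A B by (subst nn_integral_cmult[symmetric, OF mA]) (intro nn_integral_mono, use key in blast)
    show "(\<integral>\<^sup>+\<omega>. \<phi> \<omega> * indicator (\<Phi> ` Q) \<omega> \<partial>lborel) \<le> ennreal C * (\<integral>\<^sup>+\<xi>. \<phi> (\<Phi> \<xi>) * indicator Q \<xi> \<partial>lborel)"
      unfolding A B by (subst nn_integral_cmult[symmetric, OF mA]) (intro nn_integral_mono, use key in blast)
  }
qed

section \<open>Hausdorff measure and projections\<close>

lemma compact_family_separated:
  fixes K :: "'i \<Rightarrow> 'a::heine_borel set"
  assumes "finite I" "\<And>i. i \<in> I \<Longrightarrow> compact (K i)" "disjoint_family_on K I"
  obtains d where "0 < d" "\<And>i j x y. i \<in> I \<Longrightarrow> j \<in> I \<Longrightarrow> i \<noteq> j \<Longrightarrow> x \<in> K i \<Longrightarrow> y \<in> K j \<Longrightarrow> d \<le> dist x y"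
proof -
  have "\<exists>d>0. \<forall>x\<in>K (fst p). \<forall>y\<in>K (snd p). d \<le> dist x y" if "p \<in> I \<times> I - Id" for p
  proof -
    have "K (fst p) \<inter> K (snd p) = {}"
      using assms(3) that by (cases p) (simp add: disjoint_family_on_def)
    then show ?thesis
      using separate_compact_closed[of "K (fst p)" "K (snd p)"] assms(2) that
      by (metis DiffD1 compact_imp_closed mem_Times_iff)
  qed
  then obtain d where d: "\<And>p. p \<in> I \<times> I - Id \<Longrightarrow> d p > 0 \<and> (\<forall>x\<in>K (fst p). \<forall>y\<in>K (snd p). d p \<le> dist x y)"
    by metis
  let ?D = "insert 1 (d ` (I \<times> I - Id))"
  have fin: "finite ?D" using assms(1) by auto
  show ?thesis
  proof
    show "0 < Min ?D" using fin d by (subst Min_gr_iff) auto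
    show "Min ?D \<le> dist x y" if "i \<in> I" "j \<in> I" "i \<noteq> j" "x \<in> K i" "y \<in> K j" for i j x y
    proof -
      have "Min ?D \<le> d (i, j)" using fin that by (intro Min_le) auto
      also have "\<dots> \<le> dist x y" using d[of "(i, j)"] that by auto
      finally show ?thesis .
    qed
  qed
qed

text \<open>Finitely many disjoint compact sets have a positive mutual distance, so a sufficiently
  fine cover consists of sets that meet at most one of them. Each covering set projects into an
  interval no longer than its diameter, because the projections do not increase distances. This
  bounds the projected lengths of the pieces of a leaf by its Hausdorff measure without any
  parametrization of the leaf.\<close>

lemma hausdorff1_ge_sum_projections:
  fixes A :: "'a::heine_borel set" and K :: "'i \<Rightarrow> 'a set" and \<pi> :: "'i \<Rightarrow> 'a \<Rightarrow> real"
  assumes fin: "finite I" and K: "\<And>i. i \<in> I \<Longrightarrow> compact (K i)" "disjoint_family_on K I"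
    and sub: "\<And>i. i \<in> I \<Longrightarrow> K i \<subseteq> A"
    and lip: "\<And>i x y. i \<in> I \<Longrightarrow> \<bar>\<pi> i x - \<pi> i y\<bar> \<le> dist x y"
  shows "(\<Sum>i\<in>I. emeasure lborel (\<pi> i ` K i)) \<le> hausdorff1 A"
proof -
  obtain d where d: "0 < d" "\<And>i j x y. i \<in> I \<Longrightarrow> j \<in> I \<Longrightarrow> i \<noteq> j \<Longrightarrow> x \<in> K i \<Longrightarrow> y \<in> K j \<Longrightarrow> d \<le> dist x y"
    using compact_family_separated[OF fin K] by blast
  have "(\<Sum>i\<in>I. emeasure lborel (\<pi> i ` K i)) \<le> (\<Sum>n. ennreal (diameter (C n)))"
    if C: "A \<subseteq> (\<Union>n. C n)" "\<And>n. bounded (C n) \<and> diameter (C n) \<le> d / 2" for C :: "nat \<Rightarrow> 'a set"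
  proof -
    \<comment> \<open>The interval hull of a projected covering set, emptied if that set misses
      \<open>K i\<close>. As the mesh \<open>d / 2\<close> is below the gap \<open>d\<close>, at
      most one \<open>i\<close> survives for each \<open>n\<close>.\<close>
    define T where "T n i = (if C n \<inter> K i = {} then {} else {Inf (\<pi> i ` C n)..Sup (\<pi> i ` C n)})" for n i
    have [measurable]: "T n i \<in> sets borel" for n i by (simp add: T_def)
    have bd: "bdd_above (\<pi> i ` C n) \<and> bdd_below (\<pi> i ` C n) \<and>
        emeasure lborel (T n i) \<le> ennreal (diameter (C n))" if i: "i \<in> I" for n i
    proof (cases "C n = {}")
      case True then show ?thesis by (simp add: T_def)
    next
      case False
      then obtain x0 where x0: "x0 \<in> C n" by auto
      have close: "\<pi> i x \<le> \<pi> i y + diameter (C n)" if "x \<in> C n" "y \<in> C n" for x y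
        using lip[OF i, of x y] diameter_bounded_bound[of "C n" x y] C(2)[of n] that by auto
      have b: "bdd_above (\<pi> i ` C n)" "bdd_below (\<pi> i ` C n)"
        using close[of _ x0] close[of x0] x0
        by (auto intro!: bdd_aboveI[of _ "\<pi> i x0 + diameter (C n)"] bdd_belowI[of _ "\<pi> i x0 - diameter (C n)"]
            simp: algebra_simps)
      have "Sup (\<pi> i ` C n) - diameter (C n) \<le> \<pi> i y" if "y \<in> C n" for y
      proof -
        have "Sup (\<pi> i ` C n) \<le> \<pi> i y + diameter (C n)"
          using x0 close that by (intro cSup_least) auto
        then show ?thesis by simp
      qed
      then have "Sup (\<pi> i ` C n) - diameter (C n) \<le> Inf (\<pi> i ` C n)"
        using x0 by (intro cInf_greatest) auto
      moreover have "Inf (\<pi> i ` C n) \<le> Sup (\<pi> i ` C n)"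
        using x0 b by (meson cInf_lower cSup_upper image_eqI order_trans)
      ultimately have "emeasure lborel (T n i) \<le> ennreal (diameter (C n))"
        by (auto simp: T_def intro!: ennreal_leI)
      with b show ?thesis by blast
    qed
    have one: "(\<Sum>i\<in>I. emeasure lborel (T n i)) \<le> ennreal (diameter (C n))" for n
    proof (cases "\<exists>i\<in>I. C n \<inter> K i \<noteq> {}")
      case False
      then have "(\<Sum>i\<in>I. emeasure lborel (T n i)) = 0" by (intro sum.neutral) (auto simp: T_def)
      then show ?thesis by simp
    next
      case True
      then obtain i x where i: "i \<in> I" "x \<in> C n" "x \<in> K i" by auto
      have "C n \<inter> K j = {}" if "j \<in> I" "j \<noteq> i" for j
      proof (rule ccontr)
        assume "C n \<inter> K j \<noteq> {}"
        then obtain y where y: "y \<in> C n" "y \<in> K j" by auto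
        have "d \<le> dist x y" using d(2)[OF i(1) that(1)] that i y by auto
        moreover have "dist x y \<le> d / 2"
          using diameter_bounded_bound[of "C n" x y] C(2)[of n] i y by auto
        ultimately show False using \<open>0 < d\<close> by simp
      qed
      then have "(\<Sum>j\<in>I - {i}. emeasure lborel (T n j)) = 0" by (intro sum.neutral) (auto simp: T_def)
      then have "(\<Sum>j\<in>I. emeasure lborel (T n j)) = emeasure lborel (T n i)"
        using fin i by (simp add: sum.remove)
      with bd[OF i(1)] show ?thesis by simp
    qed
    have "(\<Sum>i\<in>I. emeasure lborel (\<pi> i ` K i)) \<le> (\<Sum>i\<in>I. \<Sum>n. emeasure lborel (T n i))"
    proof (rule sum_mono)
      fix i assume i: "i \<in> I"
      have "\<pi> i ` K i \<subseteq> (\<Union>n. T n i)"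
      proof
        fix y assume "y \<in> \<pi> i ` K i"
        then obtain x n where x: "y = \<pi> i x" "x \<in> K i" "x \<in> C n" using sub[OF i] C(1) by blast
        then have "y \<in> T n i" using bd[OF i, of n] by (auto simp: T_def intro!: cInf_lower cSup_upper)
        then show "y \<in> (\<Union>n. T n i)" by auto
      qed
      then have "emeasure lborel (\<pi> i ` K i) \<le> emeasure lborel (\<Union>n. T n i)"
        by (intro emeasure_mono) auto
      also have "\<dots> \<le> (\<Sum>n. emeasure lborel (T n i))"
        by (intro emeasure_subadditive_countably) auto
      finally show "emeasure lborel (\<pi> i ` K i) \<le> (\<Sum>n. emeasure lborel (T n i))" .
    qed
    also have "\<dots> = (\<Sum>n. \<Sum>i\<in>I. emeasure lborel (T n i))"
      by (rule suminf_sum[symmetric]) auto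
    also have "\<dots> \<le> (\<Sum>n. ennreal (diameter (C n)))"
      using one by (intro suminf_le) auto
    finally show ?thesis .
  qed
  then have "(\<Sum>i\<in>I. emeasure lborel (\<pi> i ` K i)) \<le>
    (INF C\<in>{C :: nat \<Rightarrow> 'a set. A \<subseteq> (\<Union>i. C i) \<and>
      (\<forall>i. bounded (C i) \<and> diameter (C i) \<le> d / 2)}. (\<Sum>i. ennreal (diameter (C i))))"
    by (intro INF_greatest) auto
  also have "\<dots> \<le> hausdorff1 A"
    unfolding hausdorff1_def using \<open>0 < d\<close> by (intro SUP_upper) auto
  finally show ?thesis .
qed

section \<open>Level curves in the plane\<close>

text \<open>\<open>P\<close> is the coordinate that parametrizes the level curves of \<open>G\<close> in \<open>Q\<close>. The integral inequality is the half
  of the coarea formula that bounds areas from above; the compact sets lift inner approximations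
  of the coordinate images back to the curves.\<close>
definition level_patch :: "(real \<times> real \<Rightarrow> real) \<Rightarrow> real \<Rightarrow> (real \<times> real) set \<Rightarrow> (real \<times> real \<Rightarrow> real) \<Rightarrow> bool" where
  "level_patch G c Q P \<longleftrightarrow> open Q \<and> continuous_on Q G \<and> (\<forall>A\<in>sets borel. A \<subseteq> Q \<longrightarrow>
     (\<lambda>r. emeasure lborel (P ` {\<zeta>\<in>A. G \<zeta> = r})) \<in> borel_measurable borel \<and>
     (\<forall>r. P ` {\<zeta>\<in>A. G \<zeta> = r} \<in> sets borel \<and>
        (\<forall>C. compact C \<and> C \<subseteq> P ` {\<zeta>\<in>A. G \<zeta> = r} \<longrightarrow> (\<exists>K. compact K \<and> K \<subseteq> {\<zeta>\<in>A. G \<zeta> = r} \<and> P ` K = C))) \<and>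
     (\<forall>N\<in>borel_measurable borel. ennreal c * (\<integral>\<^sup>+\<zeta>. N (G \<zeta>) * indicator A \<zeta> \<partial>lborel)
        \<le> (\<integral>\<^sup>+r. N r * emeasure lborel (P ` {\<zeta>\<in>A. G \<zeta> = r}) \<partial>lborel)))"

lemma nn_integral_lborel_swap:
  fixes f :: "'a::euclidean_space \<times> 'b::euclidean_space \<Rightarrow> ennreal"
  assumes [measurable]: "f \<in> borel_measurable borel"
  shows "(\<integral>\<^sup>+x. f (prod.swap x) \<partial>lborel) = (\<integral>\<^sup>+x. f x \<partial>lborel)"
proof -
  have m: "f \<in> borel_measurable (lborel \<Otimes>\<^sub>M lborel)" by (simp add: lborel_prod)
  have "(\<integral>\<^sup>+x. f x \<partial>lborel) = (\<integral>\<^sup>+x. f x \<partial>distr (lborel \<Otimes>\<^sub>M lborel) (lborel \<Otimes>\<^sub>M lborel) (\<lambda>(x, y). (y, x)))"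
    by (subst lborel_pair.distr_pair_swap[symmetric]) (simp add: lborel_prod)
  also have "\<dots> = (\<integral>\<^sup>+x. f (prod.swap x) \<partial>(lborel \<Otimes>\<^sub>M lborel))"
    by (subst nn_integral_distr) (auto simp: m prod.swap_def case_prod_beta)
  finally show ?thesis by (simp add: lborel_prod)
qed

text \<open>Reduces the case where the second partial derivative is large to the case where the
  first one is.\<close>

lemma level_patch_swap:
  assumes "level_patch (G \<circ> prod.swap) c Q P"
  shows "level_patch G c (prod.swap ` Q) (P \<circ> prod.swap)"
proof -
  note L = assms[unfolded level_patch_def]
  have cs: "continuous_on UNIV (prod.swap :: real \<times> real \<Rightarrow> _)"
    unfolding prod.swap_def by (intro continuous_intros)
  have im: "prod.swap ` X = prod.swap -` X" for X :: "(real \<times> real) set"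
  proof (intro set_eqI iffI)
    fix p assume "p \<in> prod.swap -` X"
    then show "p \<in> prod.swap ` X" by (intro image_eqI[of _ _ "prod.swap p"]) auto
  qed auto
  have oQ: "open (prod.swap ` Q)"
    unfolding im using L[THEN conjunct1] cs by (rule open_vimage)
  have cGQ: "continuous_on Q (G \<circ> prod.swap)" by (rule L[THEN conjunct2, THEN conjunct1])
  have "continuous_on (prod.swap ` Q) (\<lambda>x. (G \<circ> prod.swap) (prod.swap x))"
    by (rule continuous_on_compose2[OF cGQ continuous_on_subset[OF cs subset_UNIV]]) auto
  then have cG: "continuous_on (prod.swap ` Q) G" by (simp only: o_def swap_swap)
  show ?thesis unfolding level_patch_def
  proof (intro conjI ballI impI oQ cG)
    fix A :: "(real \<times> real) set" assume A[measurable]: "A \<in> sets borel" and sub: "A \<subseteq> prod.swap ` Q"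
    define A' where "A' = prod.swap -` A"
    have A': "A' \<in> sets borel" "A' \<subseteq> Q"
      using measurable_sets[OF borel_measurable_continuous_onI[OF cs] A] sub by (auto simp: A'_def)
    have eq: "(P \<circ> prod.swap) ` {\<zeta>\<in>A. G \<zeta> = r} = P ` {\<zeta>\<in>A'. (G \<circ> prod.swap) \<zeta> = r}" for r
      unfolding image_comp[symmetric] im by (simp add: A'_def vimage_def)
    note L' = bspec[OF L[THEN conjunct2, THEN conjunct2] A'(1), THEN mp, OF A'(2)]
    note L1 = L'[THEN conjunct1] and L2 = L'[THEN conjunct2, THEN conjunct1]
      and L3 = L'[THEN conjunct2, THEN conjunct2]
    show "(\<lambda>r. emeasure lborel ((P \<circ> prod.swap) ` {\<zeta>\<in>A. G \<zeta> = r})) \<in> borel_measurable borel"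
      unfolding eq by (rule L1)
    show "\<forall>r. (P \<circ> prod.swap) ` {\<zeta>\<in>A. G \<zeta> = r} \<in> sets borel \<and>
        (\<forall>C. compact C \<and> C \<subseteq> (P \<circ> prod.swap) ` {\<zeta>\<in>A. G \<zeta> = r} \<longrightarrow>
          (\<exists>K. compact K \<and> K \<subseteq> {\<zeta>\<in>A. G \<zeta> = r} \<and> (P \<circ> prod.swap) ` K = C))"
      unfolding eq
    proof (intro allI conjI impI)
      show "P ` {\<zeta>\<in>A'. (G \<circ> prod.swap) \<zeta> = r} \<in> sets borel" for r by (rule spec[OF L2, THEN conjunct1])
      fix r C assume "compact C \<and> C \<subseteq> P ` {\<zeta>\<in>A'. (G \<circ> prod.swap) \<zeta> = r}"
      then obtain K where K: "compact K" "K \<subseteq> {\<zeta>\<in>A'. (G \<circ> prod.swap) \<zeta> = r}" "P ` K = C"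
        using spec[OF L2, THEN conjunct2, of r] by meson
      have "compact (prod.swap ` K)" using K(1) by (intro compact_continuous_image continuous_on_subset[OF cs]) auto
      moreover have "prod.swap ` K \<subseteq> {\<zeta>\<in>A. G \<zeta> = r}" using K(2) by (auto simp: A'_def)
      moreover have "(P \<circ> prod.swap) ` prod.swap ` K = C" using K(3) by (simp add: image_image)
      ultimately show "\<exists>K. compact K \<and> K \<subseteq> {\<zeta>\<in>A. G \<zeta> = r} \<and> (P \<circ> prod.swap) ` K = C" by blast
    qed
    fix N :: "real \<Rightarrow> ennreal" assume N[measurable]: "N \<in> borel_measurable borel"
    have "(\<lambda>\<zeta>. N (G \<zeta>) * indicator (prod.swap ` Q) \<zeta> * indicator A \<zeta>) \<in> borel_measurable borel"
      using borel_measurable_comp_open[OF oQ cG N] by measurable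
    also have "(\<lambda>\<zeta>. N (G \<zeta>) * indicator (prod.swap ` Q) \<zeta> * indicator A \<zeta>) = (\<lambda>\<zeta>. N (G \<zeta>) * indicator A \<zeta>)"
      using sub by (auto simp: indicator_def fun_eq_iff)
    finally have E: "(\<integral>\<^sup>+\<zeta>. N (G \<zeta>) * indicator A \<zeta> \<partial>lborel) = (\<integral>\<^sup>+\<zeta>. N ((G \<circ> prod.swap) \<zeta>) * indicator A' \<zeta> \<partial>lborel)"
      by (subst nn_integral_lborel_swap[symmetric]) (auto simp: A'_def indicator_def intro!: nn_integral_cong)
    show "ennreal c * (\<integral>\<^sup>+\<zeta>. N (G \<zeta>) * indicator A \<zeta> \<partial>lborel)
        \<le> (\<integral>\<^sup>+r. N r * emeasure lborel ((P \<circ> prod.swap) ` {\<zeta>\<in>A. G \<zeta> = r}) \<partial>lborel)"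
      unfolding eq E by (rule bspec[OF L3 N])
  qed
qed

lemma mult_indicator_subset_absorb:
  "A \<subseteq> B \<Longrightarrow> f * indicator A x * indicator B x = (f * indicator A x :: 'a::semiring_1)"
  by (auto simp: indicator_def)

text \<open>In the chart that sends \<open>(s, z)\<close> to \<open>(G (s, z), z)\<close>, the
  \<open>z\<close>-coordinates of the points of \<open>A\<close> on the curve \<open>G = r\<close>
  form the section over \<open>r\<close> of the image of \<open>A\<close>. Measurability and the
  inequality are therefore Tonelli for the indicator of that image, together with the lower bound
  \<open>c\<close> for the Jacobian. Compact sets are lifted by the continuous inverse
  chart.\<close>

lemma level_patch_box:
  fixes G G1 :: "real \<times> real \<Rightarrow> real"
  assumes "a < b" "open J" "compact J'" "J \<subseteq> J'" "0 < c"
    and deriv: "\<And>s z. s \<in> {a..b} \<Longrightarrow> z \<in> J' \<Longrightarrow> ((\<lambda>s. G (s, z)) has_real_derivative G1 (s, z)) (at s)"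
    and cont: "continuous_on ({a<..<b} \<times> J) G" "continuous_on ({a..b} \<times> J') G1"
    and e: "e = 1 \<or> e = -1"
    and bd: "\<And>s z. s \<in> {a..b} \<Longrightarrow> z \<in> J' \<Longrightarrow> c \<le> e * G1 (s, z)"
  shows "level_patch G c ({a<..<b} \<times> J) snd"
proof -
  let ?Q = "{a<..<b} \<times> J" and ?\<Phi> = "\<lambda>(s, z). (G (s, z), z)"
  \<comment> \<open>The chart lemma also wants an upper bound for the derivative. Compactness of the
    closed box supplies one, and it does not enter the conclusion.\<close>
  have "bounded (G1 ` ({a..b} \<times> J'))"
    using cont(2) assms(3) by (intro compact_imp_bounded compact_continuous_image compact_Times) auto
  then obtain C where C: "\<And>s z. s \<in> {a..b} \<Longrightarrow> z \<in> J' \<Longrightarrow> \<bar>G1 (s, z)\<bar> \<le> C"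
    unfolding bounded_iff by fastforce
  have cs: "continuous_on {a..b} (\<lambda>s. G1 (s, z))" if "z \<in> J" for z
    using that assms(4) by (intro continuous_on_compose2[OF cont(2)]) (auto intro!: continuous_intros)
  have "c \<le> e * G1 (s, z) \<and> e * G1 (s, z) \<le> C" if "s \<in> {a..b}" "z \<in> J" for s z
    using bd[of s z] C[of s z] that assms(4) e by auto
  note bdC = this
  have deriv': "((\<lambda>s. G (s, z)) has_real_derivative G1 (s, z)) (at s)" if "s \<in> {a..b}" "z \<in> J" for s z
    using deriv that assms(4) by blast
  note gc = \<open>a < b\<close> \<open>open J\<close> \<open>0 < c\<close> deriv' cont(1) cs e bdC
  have inj: "inj_on ?\<Phi> ?Q" and oW: "open (?\<Phi> ` ?Q)" and
    ci: "continuous_on (?\<Phi> ` ?Q) (the_inv_into ?Q ?\<Phi>)"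
    using graph_chart_inj[OF gc] graph_chart_open[OF gc] graph_chart_cont_inv[OF gc] by blast+
  have lower: "ennreal c * (\<integral>\<^sup>+\<xi>. \<phi> (?\<Phi> \<xi>) * indicator ?Q \<xi> \<partial>lborel) \<le> (\<integral>\<^sup>+\<omega>. \<phi> \<omega> * indicator (?\<Phi> ` ?Q) \<omega> \<partial>lborel)"
    if "\<phi> \<in> borel_measurable borel" for \<phi>
    using graph_chart_lower[OF gc that] by blast
  let ?I = "the_inv_into ?Q ?\<Phi>"
  have oQ: "open ?Q" using \<open>open J\<close> by (intro open_Times) auto
  show ?thesis unfolding level_patch_def
  proof (intro conjI ballI impI oQ cont(1))
    fix A :: "(real \<times> real) set" assume A[measurable]: "A \<in> sets borel" and sub: "A \<subseteq> ?Q"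
    \<comment> \<open>The image of a Borel set is Borel because it is a preimage under the
      continuous inverse.\<close>
    have "?\<Phi> ` A = (?\<Phi> ` ?Q) \<inter> {\<omega>. ?I \<omega> \<in> A}"
      using sub the_inv_into_f_f[OF inj] by (auto simp: image_iff)
    also have "\<dots> = {\<omega> \<in> space (restrict_space borel (?\<Phi> ` ?Q)). ?I \<omega> \<in> A}"
      by (auto simp: space_restrict_space)
    also have "\<dots> \<in> sets (restrict_space borel (?\<Phi> ` ?Q))"
      using borel_measurable_continuous_on_restrict[OF ci] A by measurable
    finally have B: "?\<Phi> ` A \<in> sets borel"
      using oW by (auto simp: sets_restrict_space)
    have sec: "snd ` {\<zeta>\<in>A. G \<zeta> = r} = Pair r -` (?\<Phi> ` A)" for r
      by (force simp: image_iff)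
    have B': "?\<Phi> ` A \<in> sets (lborel \<Otimes>\<^sub>M lborel)" by (subst lborel_prod) (use B in simp)
    show "(\<lambda>r. emeasure lborel (snd ` {\<zeta>\<in>A. G \<zeta> = r})) \<in> borel_measurable borel"
      unfolding sec using lborel.measurable_emeasure_Pair[OF B'] by simp
    show "\<forall>r. snd ` {\<zeta>\<in>A. G \<zeta> = r} \<in> sets borel \<and>
        (\<forall>C. compact C \<and> C \<subseteq> snd ` {\<zeta>\<in>A. G \<zeta> = r} \<longrightarrow>
          (\<exists>K. compact K \<and> K \<subseteq> {\<zeta>\<in>A. G \<zeta> = r} \<and> snd ` K = C))"
    proof (intro allI conjI impI)
      show "snd ` {\<zeta>\<in>A. G \<zeta> = r} \<in> sets borel" for r unfolding sec using sets_Pair1[OF B'] by simp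
      fix r C assume C: "compact C \<and> C \<subseteq> snd ` {\<zeta>\<in>A. G \<zeta> = r}"
      let ?K = "(\<lambda>y. ?I (r, y)) ` C"
      have I: "?I (r, y) \<in> {\<zeta>\<in>A. G \<zeta> = r}" "snd (?I (r, y)) = y" "(r, y) \<in> ?\<Phi> ` ?Q" if "y \<in> C" for y
      proof -
        obtain \<zeta> where z: "\<zeta> \<in> A" "G \<zeta> = r" "snd \<zeta> = y" using C \<open>y \<in> C\<close> by auto
        then have e: "(r, y) = ?\<Phi> \<zeta>" by (cases \<zeta>) auto
        have "?I (r, y) = \<zeta>" unfolding e using z sub by (intro the_inv_into_f_f[OF inj]) auto
        then show "?I (r, y) \<in> {\<zeta>\<in>A. G \<zeta> = r}" "snd (?I (r, y)) = y" using z by simp_all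
        show "(r, y) \<in> ?\<Phi> ` ?Q" unfolding e using z sub by (intro imageI) auto
      qed
      have "compact ?K"
        using C I(3) by (intro compact_continuous_image continuous_on_compose2[OF ci]) (auto intro!: continuous_intros)
      moreover have "snd ` ?K = C" by (simp add: image_image I(2) cong: image_cong)
      moreover have "?K \<subseteq> {\<zeta>\<in>A. G \<zeta> = r}" using I(1) by (intro image_subsetI)
      ultimately show "\<exists>K. compact K \<and> K \<subseteq> {\<zeta>\<in>A. G \<zeta> = r} \<and> snd ` K = C" by (intro exI[of _ ?K] conjI)
    qed
    fix N :: "real \<Rightarrow> ennreal" assume N[measurable]: "N \<in> borel_measurable borel"
    let ?\<phi> = "\<lambda>\<omega>. N (fst \<omega>) * indicator (?\<Phi> ` A) \<omega>"
    have f[measurable]: "fst \<in> borel_measurable (borel :: (real \<times> real) measure)"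
      by (intro borel_measurable_continuous_onI continuous_intros)
    have m: "?\<phi> \<in> borel_measurable borel" using B by measurable
    have "(\<integral>\<^sup>+\<zeta>. N (G \<zeta>) * indicator A \<zeta> \<partial>lborel) = (\<integral>\<^sup>+\<xi>. ?\<phi> (?\<Phi> \<xi>) * indicator ?Q \<xi> \<partial>lborel)"
    proof (rule nn_integral_cong)
      fix \<xi> :: "real \<times> real"
      have "?\<Phi> \<xi> \<in> ?\<Phi> ` A \<longleftrightarrow> \<xi> \<in> A" if "\<xi> \<in> ?Q"
        using inj_on_image_mem_iff[OF inj that sub] .
      then show "N (G \<xi>) * indicator A \<xi> = ?\<phi> (?\<Phi> \<xi>) * indicator ?Q \<xi>"
        using sub by (cases "\<xi> \<in> ?Q") (auto simp: indicator_def case_prod_beta)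
    qed
    then have "ennreal c * (\<integral>\<^sup>+\<zeta>. N (G \<zeta>) * indicator A \<zeta> \<partial>lborel) =
      ennreal c * (\<integral>\<^sup>+\<xi>. ?\<phi> (?\<Phi> \<xi>) * indicator ?Q \<xi> \<partial>lborel)" by (rule arg_cong)
    also have "\<dots> \<le> (\<integral>\<^sup>+\<omega>. ?\<phi> \<omega> * indicator (?\<Phi> ` ?Q) \<omega> \<partial>lborel)"
      by (rule lower[OF m])
    also have "\<dots> = (\<integral>\<^sup>+\<omega>. ?\<phi> \<omega> \<partial>lborel)"
      by (rule nn_integral_cong) (rule mult_indicator_subset_absorb[OF image_mono[OF sub]])
    also have "\<dots> = (\<integral>\<^sup>+r. \<integral>\<^sup>+y. ?\<phi> (r, y) \<partial>lborel \<partial>lborel)"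
      using lborel.nn_integral_fst[of ?\<phi> lborel] m by (simp add: lborel_prod)
    also have "\<dots> = (\<integral>\<^sup>+r. N r * emeasure lborel (snd ` {\<zeta>\<in>A. G \<zeta> = r}) \<partial>lborel)"
    proof (rule nn_integral_cong)
      fix r
      have P: "Pair r -` (?\<Phi> ` A) \<in> sets lborel" by (rule sets_Pair1[OF B'])
      have "(\<integral>\<^sup>+y. ?\<phi> (r, y) \<partial>lborel) = (\<integral>\<^sup>+y. N r * indicator (Pair r -` (?\<Phi> ` A)) y \<partial>lborel)"
        by (intro nn_integral_cong) (auto simp: indicator_def)
      then show "(\<integral>\<^sup>+y. ?\<phi> (r, y) \<partial>lborel) = N r * emeasure lborel (snd ` {\<zeta>\<in>A. G \<zeta> = r})"
        unfolding sec by (subst (asm) nn_integral_cmult_indicator[OF P])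
    qed
    finally show "ennreal c * (\<integral>\<^sup>+\<zeta>. N (G \<zeta>) * indicator A \<zeta> \<partial>lborel)
        \<le> (\<integral>\<^sup>+r. N r * emeasure lborel (snd ` {\<zeta>\<in>A. G \<zeta> = r}) \<partial>lborel)" .
  qed
qed

text \<open>The strict inequality at \<open>x\<close> is an open condition, so it persists, with the
  same sign \<open>e\<close>, on a closed box around \<open>x\<close>.\<close>

lemma level_patch_exists:
  fixes G G1 G2 :: "real \<times> real \<Rightarrow> real"
  assumes "open V" "x \<in> V" "0 < c"
    and deriv: "\<And>\<zeta>. \<zeta> \<in> V \<Longrightarrow> (G has_derivative (\<lambda>k. G1 \<zeta> * fst k + G2 \<zeta> * snd k)) (at \<zeta>)"
    and cont: "continuous_on V G1"
    and big: "c < \<bar>G1 x\<bar>"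
  shows "\<exists>Q. x \<in> Q \<and> Q \<subseteq> V \<and> level_patch G c Q snd"
proof -
  define e where "e = sgn (G1 x)"
  have e: "e = 1 \<or> e = -1" and ex: "c < e * G1 x"
    using big \<open>0 < c\<close> by (auto simp: e_def sgn_if)
  define V' where "V' = {\<zeta>\<in>V. e * G1 \<zeta> \<in> {c<..}}"
  have "open V'"
    unfolding V'_def using \<open>open V\<close>
    by (intro continuous_open_preimage[unfolded vimage_def Int_def Collect_conj_eq[symmetric], simplified] ) (auto intro!: continuous_intros cont)
  moreover have "x \<in> V'" using ex assms by (auto simp: V'_def)
  ultimately obtain S T where ST: "open S" "open T" "x \<in> S \<times> T" "S \<times> T \<subseteq> V'"
    by (rule open_prod_elim)
  obtain d1 where d1: "d1 > 0" "cball (fst x) d1 \<subseteq> S" using ST open_contains_cball[of S] by auto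
  obtain d2 where d2: "d2 > 0" "cball (snd x) d2 \<subseteq> T" using ST open_contains_cball[of T] by auto
  let ?a = "fst x - d1" and ?b = "fst x + d1"
  have sub: "{?a..?b} \<times> cball (snd x) d2 \<subseteq> V'"
    using d1(2) d2(2) ST(4) unfolding cball_eq_atLeastAtMost by blast
  let ?Q = "{?a<..<?b} \<times> ball (snd x) d2"
  have subQ: "?Q \<subseteq> {?a..?b} \<times> cball (snd x) d2" by auto
  have V'V: "V' \<subseteq> V" by (auto simp: V'_def)
  have d: "((\<lambda>s. G (s, z)) has_real_derivative G1 (s, z)) (at s)" if "(s, z) \<in> V" for s z
  proof -
    have "((\<lambda>s. (s, z)) has_derivative (\<lambda>k. (k, 0))) (at s)" by (auto intro!: derivative_eq_intros)
    from has_derivative_compose[OF this deriv[OF that]] show ?thesis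
      by (simp add: has_field_derivative_def)
  qed
  have cG: "continuous_on V G"
    using deriv by (meson continuous_at_imp_continuous_on has_derivative_continuous)
  have "level_patch G c ?Q snd"
  proof (rule level_patch_box[where J' = "cball (snd x) d2" and ?G1.0 = G1 and e = e])
    show "continuous_on ?Q G" "continuous_on ({?a..?b} \<times> cball (snd x) d2) G1"
      using sub subQ V'V by (auto intro: continuous_on_subset[OF cG] continuous_on_subset[OF cont])
    show "((\<lambda>s. G (s, z)) has_real_derivative G1 (s, z)) (at s)"
      if "s \<in> {?a..?b}" "z \<in> cball (snd x) d2" for s z
      using that sub V'V by (intro d) blast
    show "c \<le> e * G1 (s, z)" if "s \<in> {?a..?b}" "z \<in> cball (snd x) d2" for s z
    proof -
      have "(s, z) \<in> V'" using that sub by blast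
      then show ?thesis by (simp add: V'_def)
    qed
  qed (use e d1 \<open>0 < c\<close> in auto)
  moreover have "x \<in> ?Q" "?Q \<subseteq> V" using d1 d2 sub subQ V'V by (auto simp: mem_Times_iff)
  ultimately show ?thesis by (intro exI[of _ ?Q] conjI)
qed

text \<open>Near each point a partial derivative that exceeds \<open>c\<close> decides which
  coordinate parametrizes the curves. Lindelof's theorem makes the cover countable, so that
  contributions can be summed.\<close>

lemma level_patch_cover:
  fixes G G1 G2 :: "real \<times> real \<Rightarrow> real"
  assumes V: "open V" and "0 < c"
    and deriv: "\<And>\<zeta>. \<zeta> \<in> V \<Longrightarrow> (G has_derivative (\<lambda>k. G1 \<zeta> * fst k + G2 \<zeta> * snd k)) (at \<zeta>)"
    and cont: "continuous_on V G1" "continuous_on V G2"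
    and big: "\<And>\<zeta>. \<zeta> \<in> V \<Longrightarrow> c < \<bar>G1 \<zeta>\<bar> \<or> c < \<bar>G2 \<zeta>\<bar>"
  obtains Q :: "nat \<Rightarrow> (real \<times> real) set" and P where
    "(\<Union>l. Q l) = V" "\<And>l. level_patch G c (Q l) (P l)" "\<And>l. P l = fst \<or> P l = snd"
proof -
  have cs: "continuous_on UNIV (prod.swap :: real \<times> real \<Rightarrow> _)"
    unfolding prod.swap_def by (intro continuous_intros)
  have ex: "\<exists>Q. x \<in> Q \<and> Q \<subseteq> V \<and> (level_patch G c Q fst \<or> level_patch G c Q snd)" if x: "x \<in> V" for x
  proof (cases "c < \<bar>G1 x\<bar>")
    case True
    then show ?thesis using level_patch_exists[OF V x \<open>0 < c\<close> deriv cont(1)] by blast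
  next
    case False
    let ?W = "prod.swap -` V"
    have W: "open ?W" using V cs by (rule open_vimage)
    have d: "((G \<circ> prod.swap) has_derivative (\<lambda>k. (G2 \<circ> prod.swap) \<zeta> * fst k + (G1 \<circ> prod.swap) \<zeta> * snd k)) (at \<zeta>)"
      if "\<zeta> \<in> ?W" for \<zeta>
    proof -
      have "(prod.swap has_derivative prod.swap) (at \<zeta>)"
        unfolding prod.swap_def[abs_def]
        by (intro bounded_linear_imp_has_derivative bounded_linear_Pair bounded_linear_fst bounded_linear_snd)
      from has_derivative_compose[OF this deriv] that show ?thesis by (simp add: o_def algebra_simps)
    qed
    have "continuous_on ?W (G2 \<circ> prod.swap)"
      by (intro continuous_on_compose continuous_on_subset[OF cs] continuous_on_subset[OF cont(2)]) auto
    moreover have "prod.swap x \<in> ?W" "c < \<bar>(G2 \<circ> prod.swap) (prod.swap x)\<bar>" using x big[OF x] False by auto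
    ultimately obtain Q where Q: "prod.swap x \<in> Q" "Q \<subseteq> ?W" "level_patch (G \<circ> prod.swap) c Q snd"
      using level_patch_exists[OF W _ \<open>0 < c\<close> d] by blast
    have "snd \<circ> prod.swap = (fst :: real \<times> real \<Rightarrow> real)" by auto
    with level_patch_swap[OF Q(3)] have "level_patch G c (prod.swap ` Q) fst" by simp
    moreover have "x \<in> prod.swap ` Q" "prod.swap ` Q \<subseteq> V"
      using Q by (auto intro: image_eqI[of _ _ "prod.swap x"])
    ultimately show ?thesis by blast
  qed
  let ?F = "{Q. Q \<subseteq> V \<and> (level_patch G c Q fst \<or> level_patch G c Q snd)}"
  have "\<And>S. S \<in> ?F \<Longrightarrow> open S" by (auto simp: level_patch_def)
  from Lindelof[OF this] obtain F where F: "F \<subseteq> ?F" "countable F" "\<Union>F = \<Union>?F" by blast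
  \<comment> \<open>The empty patch keeps the family nonempty when \<open>V\<close> is empty, so
    that it can be enumerated by the natural numbers.\<close>
  have "level_patch G c {} snd" by (auto simp: level_patch_def)
  with F(1) have F': "insert {} F \<subseteq> ?F" "insert {} F \<noteq> {}" "countable (insert {} F)" using F(2) by auto
  define Q where "Q = from_nat_into (insert {} F)"
  have rQ: "range Q = insert {} F" unfolding Q_def using F'(2,3) by (rule range_from_nat_into)
  have Q: "Q l \<in> ?F" for l using subsetD[OF F'(1)] rangeI[of Q l] unfolding rQ .
  define P where "P l = (if level_patch G c (Q l) fst then fst else snd :: real \<times> real \<Rightarrow> real)" for l
  show ?thesis
  proof
    have "(\<Union>l. Q l) = \<Union>?F" using rQ F(3) by simp
    also have "\<dots> = V" using ex by blast
    finally show "(\<Union>l. Q l) = V" .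
    show "level_patch G c (Q l) (P l)" "P l = fst \<or> P l = snd" for l
      using Q[of l] by (cases "level_patch G c (Q l) fst"; simp add: P_def)+
  qed
qed

section \<open>Surfaces sliced by level curves\<close>

text \<open>Determinants of derivatives are taken on \<open>real^2\<close>, product measures on
  \<open>real \<times> real\<close>; this map carries statements between the two.\<close>

definition vec2 :: "real \<times> real \<Rightarrow> real^2" where "vec2 p = vector [fst p, snd p]"

lemma vec2_nth [simp]: "vec2 p $ 1 = fst p" "vec2 p $ 2 = snd p"
  by (simp_all add: vec2_def)

lemma vec2_inverse [simp]: "vec2 (x $ 1, x $ 2) = x" "(vec2 p $ 1, vec2 p $ 2) = p"
  by (auto simp: vec_eq_iff forall_2)

lemma bounded_linear_vec2: "bounded_linear vec2"
  by (rule linear_linear[THEN iffD2, OF linearI] )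
     (auto simp: vec_eq_iff forall_2)

lemma bounded_linear_unvec2: "bounded_linear (\<lambda>x :: real^2. (x $ 1, x $ 2))"
  by (intro bounded_linear_Pair bounded_linear_vec_nth)

lemma borel_measurable_vec2 [measurable]: "vec2 \<in> borel_measurable borel"
  by (intro borel_measurable_continuous_onI linear_continuous_on bounded_linear_vec2)

lemma borel_measurable_unvec2 [measurable]: "(\<lambda>x :: real^2. (x $ 1, x $ 2)) \<in> borel_measurable borel"
  by (intro borel_measurable_continuous_onI linear_continuous_on bounded_linear_unvec2)

lemma lborel_distr_vec2: "(lborel :: (real^2) measure) = distr lborel borel vec2"
proof (rule lborel_eqI)
  fix l u :: "real^2" assume le: "\<And>b. b \<in> Basis \<Longrightarrow> l \<bullet> b \<le> u \<bullet> b"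
  have le': "l $ i \<le> u $ i" for i using le[of "axis i 1"] by (simp add: inner_axis axis_in_Basis_iff)
  have B: "(Basis :: (real^2) set) = {axis 1 1, axis 2 1}"
    by (auto simp: Basis_vec_def UNIV_2)
  have ne: "axis 1 1 \<noteq> (axis 2 1 :: real^2)" by (simp add: axis_eq_axis)
  have "vec2 -` box l u = {l $ 1<..<u $ 1} \<times> {l $ 2<..<u $ 2}"
    by (auto simp: mem_box_cart forall_2)
  then have "emeasure (distr lborel borel vec2) (box l u) = emeasure (lborel \<Otimes>\<^sub>M lborel) ({l $ 1<..<u $ 1} \<times> {l $ 2<..<u $ 2})"
    by (subst emeasure_distr) (auto simp: lborel_prod)
  also have "\<dots> = ennreal (u $ 1 - l $ 1) * ennreal (u $ 2 - l $ 2)"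
    using le' by (subst lborel.emeasure_pair_measure_Times) auto
  also have "\<dots> = ennreal (\<Prod>b\<in>Basis. (u - l) \<bullet> b)"
    unfolding B using ne le' by (simp add: inner_axis ennreal_mult)
  finally show "emeasure (distr lborel borel vec2) (box l u) = (\<Prod>b\<in>Basis. (u - l) \<bullet> b)" .
qed simp

text \<open>The area of a differentiable image is at most the integral of the absolute determinant,
  with multiplicities allowed. The image itself is merely Lebesgue measurable, so a Borel set of the
  same measure around it is returned, whose sections can be used in Tonelli's theorem. If the
  integral is infinite, the whole plane will do.\<close>

lemma area_differentiable_image_le:
  fixes F :: "real \<times> real \<Rightarrow> real \<times> real" and J :: "real \<times> real \<Rightarrow> ennreal"
  assumes "open V" and A: "A \<in> sets borel" "A \<subseteq> V"
    and F: "\<And>\<zeta>. \<zeta> \<in> V \<Longrightarrow> (F has_derivative (\<lambda>k. (f1 \<zeta> * fst k + f2 \<zeta> * snd k, h1 \<zeta> * fst k + h2 \<zeta> * snd k))) (at \<zeta>)"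
    and cont: "continuous_on V f1" "continuous_on V f2" "continuous_on V h1" "continuous_on V h2"
    and J: "\<And>\<zeta>. \<zeta> \<in> A \<Longrightarrow> ennreal \<bar>f1 \<zeta> * h2 \<zeta> - f2 \<zeta> * h1 \<zeta>\<bar> \<le> J \<zeta>"
  obtains B where "B \<in> sets borel" "F ` A \<subseteq> B" "emeasure lborel B \<le> (\<integral>\<^sup>+\<zeta>. J \<zeta> * indicator A \<zeta> \<partial>lborel)"
proof -
  let ?i = "\<lambda>x :: real^2. (x $ 1, x $ 2)"
  define D where "D \<zeta> = \<bar>f1 \<zeta> * h2 \<zeta> - f2 \<zeta> * h1 \<zeta>\<bar>" for \<zeta>
  have cD: "continuous_on V D" unfolding D_def by (intro continuous_intros cont)
  have mD: "(\<lambda>\<zeta>. ennreal (D \<zeta>) * indicator A \<zeta>) \<in> borel_measurable borel"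
  proof -
    have "(\<lambda>\<zeta>. ennreal (D \<zeta>) * indicator V \<zeta> * indicator A \<zeta>) \<in> borel_measurable borel"
      using borel_measurable_comp_open[OF \<open>open V\<close> cD, of ennreal] A(1) by measurable
    also have "(\<lambda>\<zeta>. ennreal (D \<zeta>) * indicator V \<zeta> * indicator A \<zeta>) = (\<lambda>\<zeta>. ennreal (D \<zeta>) * indicator A \<zeta>)"
      using A(2) by (auto simp: fun_eq_iff indicator_def)
    finally show ?thesis .
  qed
  have le: "(\<integral>\<^sup>+\<zeta>. ennreal (D \<zeta>) * indicator A \<zeta> \<partial>lborel) \<le> (\<integral>\<^sup>+\<zeta>. J \<zeta> * indicator A \<zeta> \<partial>lborel)"
    by (intro nn_integral_mono) (auto simp: indicator_def D_def intro: J)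
  show ?thesis
  proof (cases "(\<integral>\<^sup>+\<zeta>. ennreal (D \<zeta>) * indicator A \<zeta> \<partial>lborel) = \<infinity>")
    case True
    with le show ?thesis by (intro that[of UNIV]) (auto simp: top_unique)
  next
    case False
    define S where "S = vec2 ` A"
    define F' where "F' = vec2 \<circ> F \<circ> ?i"
    define dF where "dF x = vec2 \<circ> (\<lambda>k. (f1 (?i x) * fst k + f2 (?i x) * snd k, h1 (?i x) * fst k + h2 (?i x) * snd k)) \<circ> ?i" for x
    have S_eq: "S = ?i -` A" by (force simp: S_def)
    have Sb: "S \<in> sets borel"
      using measurable_sets[OF borel_measurable_unvec2 A(1)] by (simp add: S_eq)
    have der: "(F' has_derivative dF x) (at x within S)" if "x \<in> S" for x
    proof -
      have "?i x \<in> V" using that A(2) by (auto simp: S_eq)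
      have "(F \<circ> ?i has_derivative (\<lambda>k. (f1 (?i x) * fst k + f2 (?i x) * snd k, h1 (?i x) * fst k + h2 (?i x) * snd k)) \<circ> ?i) (at x)"
        using F[OF \<open>?i x \<in> V\<close>] by (intro diff_chain_at bounded_linear_imp_has_derivative bounded_linear_unvec2)
      from diff_chain_at[OF this bounded_linear_imp_has_derivative[OF bounded_linear_vec2]]
      have "(F' has_derivative dF x) (at x)" unfolding F'_def dF_def by (simp add: o_assoc)
      then show ?thesis by (rule has_derivative_at_withinI)
    qed
    have det: "\<bar>det (matrix (dF x))\<bar> = D (?i x)" for x
      by (simp add: det_2 matrix_def dF_def D_def axis_def)
    have mDi: "(\<lambda>\<zeta>. ennreal (D (?i \<zeta>)) * indicator A (?i \<zeta>)) \<in> borel_measurable borel"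
      using measurable_compose[OF borel_measurable_unvec2 mD] .
    have nn: "(\<integral>\<^sup>+\<zeta>. ennreal (D \<zeta>) * indicator A \<zeta> \<partial>lborel) = (\<integral>\<^sup>+x. ennreal (D (?i x)) * indicator A (?i x) \<partial>lborel)"
      unfolding lborel_distr_vec2 using mDi by (subst nn_integral_distr) auto
    have nnS: "(\<integral>\<^sup>+x. ennreal (D (?i x)) * indicator A (?i x) \<partial>lborel) = (\<integral>\<^sup>+x. ennreal (D (?i x) * indicator S x) \<partial>lborel)"
      by (intro nn_integral_cong) (auto simp: indicator_def S_eq)
    have mS: "(\<lambda>x. D (?i x) * indicator S x) \<in> borel_measurable borel"
    proof -
      have "(\<lambda>x. enn2real (ennreal (D (?i x)) * indicator A (?i x))) \<in> borel_measurable borel"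
        using mDi by measurable
      also have "(\<lambda>x. enn2real (ennreal (D (?i x)) * indicator A (?i x))) = (\<lambda>x. D (?i x) * indicator S x)"
        by (auto simp: fun_eq_iff indicator_def S_eq D_def)
      finally show ?thesis .
    qed
    have int: "integrable lborel (\<lambda>x. D (?i x) * indicator S x)"
    proof (rule integrableI_bounded)
      have e: "ennreal (norm (D (?i x) * indicator S x)) = ennreal (D (?i x) * indicator S x)" for x
        by (simp add: D_def abs_mult)
      show "(\<integral>\<^sup>+x. ennreal (norm (D (?i x) * indicator S x)) \<partial>lborel) < \<infinity>"
        using False unfolding nn nnS by (simp only: top.not_eq_extremum infinity_ennreal_def e)
    qed (use mS in simp)
    have hi: "((\<lambda>x. D (?i x)) has_integral (LINT x|lborel. D (?i x) * indicator S x)) S"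
    proof -
      define I where "I = (LINT x|lborel. D (?i x) * indicator S x)"
      have eq: "(\<lambda>x. D (?i x) * indicator S x) = (\<lambda>x. if x \<in> S then D (?i x) else 0)"
        by (auto simp: fun_eq_iff)
      show ?thesis
        using has_integral_integral_lborel[OF int] unfolding I_def[symmetric] unfolding eq has_integral_restrict_UNIV .
    qed
    have io: "(\<lambda>x. \<bar>det (matrix (dF x))\<bar>) integrable_on S"
      unfolding det using hi by blast
    have SL: "S \<in> sets lebesgue" using Sb by simp
    have im: "F' ` S \<in> lmeasurable" "measure lebesgue (F' ` S) \<le> (LINT x|lborel. D (?i x) * indicator S x)"
      using measurable_differentiable_image[OF SL der io] measure_differentiable_image[OF SL der io] hi
      unfolding det by (auto simp: integral_unique)
    have "emeasure lebesgue (F' ` S) = ennreal (measure lebesgue (F' ` S))"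
      using im(1) by (simp add: emeasure_eq_measure2 fmeasurableD2 fmeasurableD)
    also have "\<dots> \<le> ennreal (LINT x|lborel. D (?i x) * indicator S x)" using im(2) by (rule ennreal_leI)
    also have "\<dots> = (\<integral>\<^sup>+\<zeta>. ennreal (D \<zeta>) * indicator A \<zeta> \<partial>lborel)"
      unfolding nn nnS by (rule nn_integral_eq_integral[symmetric, OF int]) (simp add: D_def)
    finally have em: "emeasure lebesgue (F' ` S) \<le> (\<integral>\<^sup>+\<zeta>. J \<zeta> * indicator A \<zeta> \<partial>lborel)" using le by simp
    obtain B' where B': "F' ` S \<subseteq> B'" "B' \<in> sets lborel" "B' - F' ` S \<in> null_sets lebesgue"
        "emeasure lebesgue (F' ` S) = emeasure lborel B'"
      by (rule completion_upper[OF fmeasurableD[OF im(1)]])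
    show ?thesis
    proof (rule that[of "vec2 -` B'"])
      show "vec2 -` B' \<in> sets borel" using measurable_sets[OF borel_measurable_vec2] B'(2) by simp
      show "F ` A \<subseteq> vec2 -` B'"
      proof (rule image_subsetI)
        fix p assume p: "p \<in> A"
        have "vec2 (F p) = F' (vec2 p)" by (simp add: F'_def)
        then show "F p \<in> vec2 -` B'" using B'(1) p by (auto simp: S_def)
      qed
      have "emeasure lborel B' = emeasure lborel (vec2 -` B')"
        using B'(2) by (subst lborel_distr_vec2) (simp add: emeasure_distr)
      then show "emeasure lborel (vec2 -` B') \<le> (\<integral>\<^sup>+\<zeta>. J \<zeta> * indicator A \<zeta> \<partial>lborel)" using em B'(4) by simp
    qed
  qed
qed

text \<open>The image of the surface under \<open>(g, w)\<close> has area at most the sum of the integrals of the Jacobian bounds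
  \<open>J n\<close>, and by \<open>curve\<close> its fibre over \<open>r\<close> has length at least \<open>|w|\<close> at every point of the leaf \<open>g = r\<close>.\<close>
lemma surface_poincare:
  fixes S :: "'a::euclidean_space set" and g w :: "'a \<Rightarrow> real"
    and \<rho> :: "nat \<Rightarrow> real \<times> real \<Rightarrow> 'a" and J :: "nat \<Rightarrow> real \<times> real \<Rightarrow> ennreal"
  assumes V: "\<And>n. open (V n)" and "0 < c"
    and A: "\<And>n. A n \<in> sets borel" "\<And>n. A n \<subseteq> V n" "\<And>n. bounded (A n)"
    and \<rho>: "\<And>n. continuous_on (V n) (\<rho> n)"
    and proj: "\<And>n \<zeta>. \<zeta> \<in> V n \<Longrightarrow> \<rho> n \<zeta> \<bullet> e1 n = fst \<zeta>" "\<And>n \<zeta>. \<zeta> \<in> V n \<Longrightarrow> \<rho> n \<zeta> \<bullet> e2 n = snd \<zeta>"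
      "\<And>n. norm (e1 n) = 1" "\<And>n. norm (e2 n) = 1"
    and disj: "\<And>m n. m \<noteq> n \<Longrightarrow> \<rho> m ` A m \<inter> \<rho> n ` A n = {}"
    and cover: "(\<Union>n. \<rho> n ` A n) = S"
    and G: "\<And>n \<zeta>. \<zeta> \<in> V n \<Longrightarrow> ((\<lambda>\<zeta>. g (\<rho> n \<zeta>)) has_derivative (\<lambda>k. G1 n \<zeta> * fst k + G2 n \<zeta> * snd k)) (at \<zeta>)"
      "\<And>n. continuous_on (V n) (G1 n)" "\<And>n. continuous_on (V n) (G2 n)"
    and W: "\<And>n \<zeta>. \<zeta> \<in> V n \<Longrightarrow> ((\<lambda>\<zeta>. w (\<rho> n \<zeta>)) has_derivative (\<lambda>k. W1 n \<zeta> * fst k + W2 n \<zeta> * snd k)) (at \<zeta>)"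
      "\<And>n. continuous_on (V n) (W1 n)" "\<And>n. continuous_on (V n) (W2 n)"
    and big: "\<And>n \<zeta>. \<zeta> \<in> V n \<Longrightarrow> c < \<bar>G1 n \<zeta>\<bar> \<or> c < \<bar>G2 n \<zeta>\<bar>"
    and J: "\<And>n \<zeta>. \<zeta> \<in> A n \<Longrightarrow> ennreal \<bar>G1 n \<zeta> * W2 n \<zeta> - G2 n \<zeta> * W1 n \<zeta>\<bar> \<le> J n \<zeta>"
    and H: "\<And>r. hausdorff1 {x\<in>S. g x = r} \<le> ennreal K"
    and curve: "AE r in lborel. \<forall>x\<in>S. g x = r \<longrightarrow>
      (\<forall>\<tau>. 0 < \<tau> \<and> \<tau> < w x \<or> w x < \<tau> \<and> \<tau> < 0 \<longrightarrow> \<tau> \<in> w ` {y\<in>S. g y = r})"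
  shows "ennreal c * (\<Sum>n. \<integral>\<^sup>+\<zeta>. ennreal \<bar>w (\<rho> n \<zeta>)\<bar> * indicator (A n) \<zeta> \<partial>lborel)
    \<le> ennreal K * (\<Sum>n. \<integral>\<^sup>+\<zeta>. J n \<zeta> * indicator (A n) \<zeta> \<partial>lborel)"
proof -
  define F where "F n \<zeta> = (g (\<rho> n \<zeta>), w (\<rho> n \<zeta>))" for n \<zeta>
  have "\<exists>B. B \<in> sets borel \<and> F n ` A n \<subseteq> B \<and> emeasure lborel B \<le> (\<integral>\<^sup>+\<zeta>. J n \<zeta> * indicator (A n) \<zeta> \<partial>lborel)" for n
  proof -
    have "(F n has_derivative (\<lambda>k. (G1 n \<zeta> * fst k + G2 n \<zeta> * snd k, W1 n \<zeta> * fst k + W2 n \<zeta> * snd k))) (at \<zeta>)"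
      if "\<zeta> \<in> V n" for \<zeta>
      unfolding F_def using G(1)[OF that] W(1)[OF that] by (rule has_derivative_Pair)
    from area_differentiable_image_le[OF V A(1,2) this G(2,3) W(2,3) J] show ?thesis by metis
  qed
  then obtain B where B: "\<And>n. B n \<in> sets borel" "\<And>n. F n ` A n \<subseteq> B n"
    "\<And>n. emeasure lborel (B n) \<le> (\<integral>\<^sup>+\<zeta>. J n \<zeta> * indicator (A n) \<zeta> \<partial>lborel)" by metis
  \<comment> \<open>A Borel set that contains the image of the surface under \<open>(g, w)\<close>
    and whose area is controlled by the Jacobian bounds.\<close>
  define U where "U = (\<Union>n. B n)"
  have U[measurable]: "U \<in> sets (lborel \<Otimes>\<^sub>M lborel)" unfolding U_def lborel_prod using B(1) by auto
  have "emeasure lborel U \<le> (\<Sum>n. emeasure lborel (B n))"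
    unfolding U_def using B(1) by (intro emeasure_subadditive_countably) auto
  also have "\<dots> \<le> (\<Sum>n. \<integral>\<^sup>+\<zeta>. J n \<zeta> * indicator (A n) \<zeta> \<partial>lborel)"
    using B(3) by (intro suminf_le) auto
  finally have U_le: "emeasure lborel U \<le> \<dots>" .
  obtain Z where Z: "Z \<in> null_sets lborel" "\<And>r x \<tau>. r \<notin> Z \<Longrightarrow> x \<in> S \<Longrightarrow> g x = r \<Longrightarrow>
      0 < \<tau> \<and> \<tau> < w x \<or> w x < \<tau> \<and> \<tau> < 0 \<Longrightarrow> \<tau> \<in> w ` {y\<in>S. g y = r}"
    using curve by (rule AE_E3) (auto, blast)
  \<comment> \<open>The length of the fibre of \<open>U\<close> over \<open>r\<close>, made infinite
    on the null set \<open>Z\<close> where intermediate values may be missing. Then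
    \<open>|w|\<close> is bounded by \<open>N\<close> of \<open>g\<close> at every point, without
    having to show that the part of the surface over \<open>Z\<close> is negligible, and the
    integral of \<open>N\<close> is unchanged.\<close>
  define N where "N r = emeasure lborel (Pair r -` U) + \<infinity> * indicator Z r" for r
  have Zb[measurable]: "Z \<in> sets borel" using Z(1) by auto
  have mU: "(\<lambda>r. emeasure lborel (Pair r -` U)) \<in> borel_measurable borel"
    using lborel.measurable_emeasure_Pair[OF U] by simp
  have mN[measurable]: "N \<in> borel_measurable borel" unfolding N_def using mU by measurable
  have "(\<integral>\<^sup>+r. N r \<partial>lborel) = (\<integral>\<^sup>+r. emeasure lborel (Pair r -` U) \<partial>lborel) + (\<integral>\<^sup>+r. \<infinity> * indicator Z r \<partial>lborel)"
    unfolding N_def using mU by (intro nn_integral_add) auto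
  also have "(\<integral>\<^sup>+r. \<infinity> * indicator Z r \<partial>lborel) = 0"
    using Z(1) by (subst nn_integral_cmult_indicator) auto
  also have "(\<integral>\<^sup>+r. emeasure lborel (Pair r -` U) \<partial>lborel) = emeasure lborel U"
    unfolding lborel_prod[symmetric] by (rule lborel.emeasure_pair_measure_alt[OF U, symmetric])
  finally have N_int: "(\<integral>\<^sup>+r. N r \<partial>lborel) = emeasure lborel U" by simp
  \<comment> \<open>Every value strictly between 0 and \<open>w x\<close> is taken on the same level
    of \<open>g\<close>, so this interval lies in the fibre of \<open>U\<close> over
    \<open>g x\<close>.\<close>
  have wN: "ennreal \<bar>w (\<rho> n \<zeta>)\<bar> \<le> N (g (\<rho> n \<zeta>))" if \<zeta>: "\<zeta> \<in> A n" for n \<zeta>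
  proof (cases "g (\<rho> n \<zeta>) \<in> Z")
    case True then show ?thesis by (simp add: N_def)
  next
    case False
    let ?x = "\<rho> n \<zeta>" let ?I = "if 0 < w ?x then {0<..<w ?x} else {w ?x<..<0}"
    have x: "?x \<in> S" using \<zeta> cover by auto
    have "?I \<subseteq> Pair (g ?x) -` U"
    proof
      fix \<tau> assume "\<tau> \<in> ?I"
      then have "\<tau> \<in> w ` {y\<in>S. g y = g ?x}" using Z(2)[OF False x refl] by (auto split: if_splits)
      then obtain m \<xi> where "\<xi> \<in> A m" "g (\<rho> m \<xi>) = g ?x" "w (\<rho> m \<xi>) = \<tau>" unfolding cover[symmetric] by auto
      then have "(g ?x, \<tau>) \<in> F m ` A m" unfolding F_def by (intro image_eqI[of _ _ \<xi>]) auto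
      then show "\<tau> \<in> Pair (g ?x) -` U" using B(2) unfolding U_def by blast
    qed
    then have "emeasure lborel ?I \<le> emeasure lborel (Pair (g ?x) -` U)"
      using sets_Pair1[OF U] by (intro emeasure_mono) auto
    moreover have "emeasure lborel ?I = ennreal \<bar>w ?x\<bar>" by auto
    ultimately show ?thesis using False by (simp add: N_def)
  qed
  have "\<exists>f. (\<Union>l::nat. fst f l) = V n \<and> (\<forall>l. level_patch (\<lambda>\<zeta>. g (\<rho> n \<zeta>)) c (fst f l) (snd f l)) \<and>
      (\<forall>l. snd f l = fst \<or> snd f l = snd)" for n
  proof -
    obtain Q :: "nat \<Rightarrow> (real \<times> real) set" and P where QP: "(\<Union>l. Q l) = V n" "\<And>l. level_patch (\<lambda>\<zeta>. g (\<rho> n \<zeta>)) c (Q l) (P l)"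
      "\<And>l. P l = fst \<or> P l = snd"
      by (rule level_patch_cover[OF V[of n] \<open>0 < c\<close> G(1)[of _ n] G(2,3)[of n] big], assumption, assumption, rule that)
    show ?thesis by (rule exI[of _ "(Q, P)"]) (simp only: fst_conv snd_conv QP simp_thms)
  qed
  from choice[OF allI[OF this]] obtain f where f: "\<forall>n. (\<Union>l::nat. fst (f n) l) = V n \<and>
      (\<forall>l. level_patch (\<lambda>\<zeta>. g (\<rho> n \<zeta>)) c (fst (f n) l) (snd (f n) l)) \<and>
      (\<forall>l. snd (f n) l = fst \<or> snd (f n) l = snd)" ..
  define Q where "Q n = fst (f n)" for n
  define P where "P n = snd (f n)" for n
  have Q: "(\<Union>l. Q n l) = V n" and Qp: "level_patch (\<lambda>\<zeta>. g (\<rho> n \<zeta>)) c (Q n l) (P n l)"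
    and P: "P n l = fst \<or> P n l = snd" for n l
    using f unfolding Q_def P_def by simp_all
  \<comment> \<open>Disjoint pieces, each inside one patch, so that every point of the surface is
    counted once in the length of its leaf.\<close>
  define A' where "A' n l = A n \<inter> disjointed (Q n) l" for n l
  have oQ: "open (Q n l)" for n l using Qp[of n l] unfolding level_patch_def by (rule conjunct1)
  have "disjointed (Q n) l \<in> sets borel" for n l
    unfolding disjointed_def using oQ by (intro sets.Diff sets.finite_UN) auto
  then have A'b[measurable]: "A' n l \<in> sets borel" for n l unfolding A'_def using A(1) by auto
  have A'Q: "A' n l \<subseteq> Q n l" for n l unfolding A'_def using disjointed_subset[of "Q n" l] by auto
  have A'A: "A' n l \<subseteq> A n" for n l by (auto simp: A'_def)
  have A'U: "(\<Union>l. A' n l) = A n" for n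
    using A(2)[of n] UN_disjointed_eq[of "Q n"] unfolding A'_def Q[symmetric] by (simp add: Int_UN_distrib[symmetric] inf.absorb1)
  have A'd: "disjoint_family (A' n)" for n
    using disjoint_family_disjointed[of "Q n"] unfolding A'_def disjoint_family_on_def by blast
  define L where "L n l r = P n l ` {\<zeta>\<in>A' n l. g (\<rho> n \<zeta>) = r}" for n l r
  note lp = bspec[OF Qp[unfolded level_patch_def, THEN conjunct2, THEN conjunct2] A'b, THEN mp, OF A'Q, folded L_def]
  have mL[measurable]: "(\<lambda>r. emeasure lborel (L n l r)) \<in> borel_measurable borel" for n l
    by (rule lp[THEN conjunct1])
  have sL: "L n l r \<in> sets borel" for n l r
    by (rule spec[OF lp[THEN conjunct2, THEN conjunct1], THEN conjunct1])
  have cL: "\<exists>C'. compact C' \<and> C' \<subseteq> {\<zeta>\<in>A' n l. g (\<rho> n \<zeta>) = r} \<and> P n l ` C' = C" if "compact C" "C \<subseteq> L n l r" for n l r C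
    using spec[OF lp[THEN conjunct2, THEN conjunct1], THEN conjunct2, of n l r] that by meson
  have iL: "ennreal c * (\<integral>\<^sup>+\<zeta>. N (g (\<rho> n \<zeta>)) * indicator (A' n l) \<zeta> \<partial>lborel) \<le> (\<integral>\<^sup>+r. N r * emeasure lborel (L n l r) \<partial>lborel)" for n l
    by (rule bspec[OF lp[THEN conjunct2, THEN conjunct2] mN])
  have fin_le: "(\<Sum>p\<in>I. emeasure lborel (L (fst p) (snd p) r)) \<le> ennreal K" if I: "finite I" for I r
  proof (rule ennreal_le_epsilon)
    fix e :: real assume "0 < e"
    \<comment> \<open>Error allowed for the inner compact approximation of each of the
      \<open>card I\<close> coordinate images. The added 1 covers an empty \<open>I\<close>.\<close>
    define d where "d = e / (real (card I) + 1)"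
    have "0 < d" using \<open>0 < e\<close> by (simp add: d_def)
    have ex: "\<exists>C'. compact C' \<and> C' \<subseteq> {\<zeta>\<in>A' n l. g (\<rho> n \<zeta>) = r} \<and>
       emeasure lborel (L n l r) \<le> emeasure lborel (P n l ` C') + ennreal d" for n l
    proof -
      have SL: "L n l r \<in> sets lebesgue" using sL by simp
      obtain T where T: "closed T" "T \<subseteq> L n l r" "emeasure lebesgue (L n l r - T) < ennreal d"
        using sets_lebesgue_inner_closed[OF SL \<open>0 < d\<close>] by metis
      have "bounded (P n l ` A n)" using P[of n l] A(3)[of n] by (auto intro: bounded_fst bounded_snd)
      moreover have "L n l r \<subseteq> P n l ` A n" unfolding L_def using A'A by (intro image_mono) auto
      ultimately have "compact T" using T by (meson bounded_subset compact_eq_bounded_closed)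
      then obtain C' where C': "compact C'" "C' \<subseteq> {\<zeta>\<in>A' n l. g (\<rho> n \<zeta>) = r}" "P n l ` C' = T" using cL T(2) by meson
      have "emeasure lborel (L n l r) = emeasure lborel T + emeasure lborel (L n l r - T)"
        using T sL by (subst plus_emeasure) (auto simp: Un_absorb1)
      also have "\<dots> \<le> emeasure lborel T + ennreal d"
        using T sL by (intro add_left_mono) (simp add: less_imp_le)
      finally show ?thesis using C' by (intro exI[of _ C'] conjI) simp_all
    qed
    have "\<forall>p. \<exists>C'. compact C' \<and> C' \<subseteq> {\<zeta>\<in>A' (fst p) (snd p). g (\<rho> (fst p) \<zeta>) = r} \<and>
       emeasure lborel (L (fst p) (snd p) r) \<le> emeasure lborel (P (fst p) (snd p) ` C') + ennreal d"
      by (intro allI ex)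
    from choice[OF this] obtain C0 where C0: "\<forall>p. compact (C0 p) \<and> C0 p \<subseteq> {\<zeta>\<in>A' (fst p) (snd p). g (\<rho> (fst p) \<zeta>) = r} \<and>
       emeasure lborel (L (fst p) (snd p) r) \<le> emeasure lborel (P (fst p) (snd p) ` C0 p) + ennreal d" ..
    define C' where "C' n l = C0 (n, l)" for n l
    have C': "compact (C' n l)" "C' n l \<subseteq> {\<zeta>\<in>A' n l. g (\<rho> n \<zeta>) = r}"
      "emeasure lborel (L n l r) \<le> emeasure lborel (P n l ` C' n l) + ennreal d" for n l
      using spec[OF C0, of "(n, l)"] unfolding C'_def fst_conv snd_conv by simp_all
    define Kp where "Kp p = \<rho> (fst p) ` C' (fst p) (snd p)" for p
    \<comment> \<open>The linear projection in space that undoes the chart in the coordinate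
      \<open>P\<close>. It is 1-Lipschitz because the vectors \<open>e1\<close> and
      \<open>e2\<close> have unit length, so the projected lengths can be compared with Hausdorff
      measure.\<close>
    define \<pi> where "\<pi> p x = (if P (fst p) (snd p) = fst then x \<bullet> e1 (fst p) else x \<bullet> e2 (fst p))" for p x
    have C'V: "C' n l \<subseteq> V n" for n l using C'(2)[of n l] A'A[of n l] A(2)[of n] by auto
    have \<pi>P: "\<pi> p ` Kp p = P (fst p) (snd p) ` C' (fst p) (snd p)" for p
      unfolding Kp_def image_image
    proof (rule image_cong[OF refl])
      fix \<zeta> assume "\<zeta> \<in> C' (fst p) (snd p)"
      then have "\<zeta> \<in> V (fst p)" using C'V by auto
      then show "\<pi> p (\<rho> (fst p) \<zeta>) = P (fst p) (snd p) \<zeta>"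
        using P[of "fst p" "snd p"] proj(1,2) by (auto simp: \<pi>_def)
    qed
    have Kp_sub: "Kp p \<subseteq> {x\<in>S. g x = r}" for p
    proof
      fix x assume "x \<in> Kp p"
      then obtain \<zeta> where z: "\<zeta> \<in> C' (fst p) (snd p)" "x = \<rho> (fst p) \<zeta>" unfolding Kp_def by auto
      then have "\<zeta> \<in> A (fst p)" "g x = r" using C'(2)[of "fst p" "snd p"] A'A[of "fst p" "snd p"] by auto
      then show "x \<in> {x\<in>S. g x = r}" unfolding cover[symmetric] using z(2) by blast
    qed
    have "(\<Sum>p\<in>I. emeasure lborel (\<pi> p ` Kp p)) \<le> hausdorff1 {x\<in>S. g x = r}"
    proof (rule hausdorff1_ge_sum_projections[OF I])
      show "compact (Kp p)" for p
        unfolding Kp_def using C'(1) C'V by (intro compact_continuous_image continuous_on_subset[OF \<rho>])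
      show "Kp p \<subseteq> {x\<in>S. g x = r}" for p
        by (rule Kp_sub)
      show "\<bar>\<pi> p x - \<pi> p y\<bar> \<le> dist x y" for p x y
        using Cauchy_Schwarz_ineq2[of "x - y" "e1 (fst p)"] Cauchy_Schwarz_ineq2[of "x - y" "e2 (fst p)"] proj(3,4)
        by (simp add: \<pi>_def dist_norm inner_diff_left)
      show "disjoint_family_on Kp I"
        unfolding disjoint_family_on_def
      proof (intro ballI impI)
        fix p q :: "nat \<times> nat" assume "p \<noteq> q"
        have sub: "Kp p \<subseteq> \<rho> (fst p) ` A' (fst p) (snd p)" for p
          unfolding Kp_def using C'(2) by (intro image_mono) auto
        have "\<rho> (fst p) ` A' (fst p) (snd p) \<inter> \<rho> (fst q) ` A' (fst q) (snd q) = {}"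
        proof (cases "fst p = fst q")
          case False
          have "\<rho> (fst p) ` A' (fst p) (snd p) \<subseteq> \<rho> (fst p) ` A (fst p)" for p
            using A'A by (intro image_mono)
          from Int_mono[OF this[of p] this[of q]] show ?thesis unfolding disj[OF False] by (simp only: subset_empty)
        next
          case True
          then have "snd p \<noteq> snd q" using \<open>p \<noteq> q\<close> by (simp add: prod_eq_iff)
          then have dj: "A' (fst q) (snd p) \<inter> A' (fst q) (snd q) = {}"
            using A'd[of "fst q"] by (simp add: disjoint_family_on_def)
          have inj: "\<zeta> = \<xi>" if "\<rho> (fst q) \<zeta> = \<rho> (fst q) \<xi>" "\<zeta> \<in> A' (fst q) l" "\<xi> \<in> A' (fst q) l'" for \<zeta> \<xi> l l'
          proof -
            have "\<zeta> \<in> V (fst q)" "\<xi> \<in> V (fst q)" using that A'A A(2) by blast+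
            then show ?thesis using proj(1,2)[of \<zeta> "fst q"] proj(1,2)[of \<xi> "fst q"] that(1) by (simp add: prod_eq_iff)
          qed
          show ?thesis unfolding True
          proof (rule equals0I, elim IntE imageE)
            fix x \<zeta> \<xi> assume *: "x = \<rho> (fst q) \<zeta>" "\<zeta> \<in> A' (fst q) (snd p)" "x = \<rho> (fst q) \<xi>" "\<xi> \<in> A' (fst q) (snd q)"
            then have "\<zeta> = \<xi>" by (intro inj) simp_all
            with * dj show False by auto
          qed
        qed
        with Int_mono[OF sub[of p] sub[of q]] show "Kp p \<inter> Kp q = {}" by (simp only: subset_empty)
      qed
    qed
    also have "\<dots> \<le> ennreal K" by (rule H)
    finally have 1: "(\<Sum>p\<in>I. emeasure lborel (P (fst p) (snd p) ` C' (fst p) (snd p))) \<le> ennreal K"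
      unfolding \<pi>P .
    have "(\<Sum>p\<in>I. emeasure lborel (L (fst p) (snd p) r))
      \<le> (\<Sum>p\<in>I. emeasure lborel (P (fst p) (snd p) ` C' (fst p) (snd p)) + ennreal d)"
      by (intro sum_mono C'(3))
    also have "\<dots> = (\<Sum>p\<in>I. emeasure lborel (P (fst p) (snd p) ` C' (fst p) (snd p))) + of_nat (card I) * ennreal d"
      by (simp add: sum.distrib)
    also have "\<dots> \<le> ennreal K + ennreal e"
    proof (rule add_mono[OF 1])
      have "real (card I) * d \<le> e" using \<open>0 < e\<close> by (simp add: d_def divide_simps)
      then show "of_nat (card I) * ennreal d \<le> ennreal e"
        using \<open>0 < d\<close> by (simp add: ennreal_of_nat_eq_real_of_nat ennreal_mult[symmetric] ennreal_leI)
    qed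
    finally show "(\<Sum>p\<in>I. emeasure lborel (L (fst p) (snd p) r)) \<le> ennreal K + ennreal e" .
  qed
  have sum_le: "(\<Sum>n l. emeasure lborel (L n l r)) \<le> ennreal K" for r
  proof -
    \<comment> \<open>Enumerating pairs turns the double series into a single one, whose partial
      sums are sums over finite index sets and hence covered by \<open>fin_le\<close>.\<close>
    have "(\<Sum>k. case prod_decode k of (n, l) \<Rightarrow> emeasure lborel (L n l r)) = (\<Sum>n l. emeasure lborel (L n l r))"
      by (rule suminf_ennreal_2dimen) simp
    moreover have "(\<Sum>k. case prod_decode k of (n, l) \<Rightarrow> emeasure lborel (L n l r)) \<le> ennreal K"
    proof (rule suminf_le_const)
      fix n
      have "(\<Sum>k<n. case prod_decode k of (n, l) \<Rightarrow> emeasure lborel (L n l r))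
        = (\<Sum>p\<in>prod_decode ` {..<n}. emeasure lborel (L (fst p) (snd p) r))"
        by (subst sum.reindex) (auto intro: inj_prod_decode simp: case_prod_beta)
      also have "\<dots> \<le> ennreal K" by (rule fin_le) simp
      finally show "(\<Sum>k<n. case prod_decode k of (n, l) \<Rightarrow> emeasure lborel (L n l r)) \<le> ennreal K" .
    qed simp
    ultimately show ?thesis by simp
  qed
  have cg: "continuous_on (V n) (\<lambda>\<zeta>. g (\<rho> n \<zeta>))" for n
    using G(1) by (meson continuous_at_imp_continuous_on has_derivative_continuous)
  have split: "(\<integral>\<^sup>+\<zeta>. ennreal \<bar>w (\<rho> n \<zeta>)\<bar> * indicator (A n) \<zeta> \<partial>lborel)
      \<le> (\<Sum>l. \<integral>\<^sup>+\<zeta>. N (g (\<rho> n \<zeta>)) * indicator (A' n l) \<zeta> \<partial>lborel)" for n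
  proof -
    have "(\<integral>\<^sup>+\<zeta>. ennreal \<bar>w (\<rho> n \<zeta>)\<bar> * indicator (A n) \<zeta> \<partial>lborel)
      \<le> (\<integral>\<^sup>+\<zeta>. (N (g (\<rho> n \<zeta>)) * indicator (V n) \<zeta>) * indicator (\<Union>l. A' n l) \<zeta> \<partial>lborel)"
      unfolding A'U
    proof (rule nn_integral_mono)
      fix \<zeta> show "ennreal \<bar>w (\<rho> n \<zeta>)\<bar> * indicator (A n) \<zeta> \<le> (N (g (\<rho> n \<zeta>)) * indicator (V n) \<zeta>) * indicator (A n) \<zeta>"
        using wN[of \<zeta> n] subsetD[OF A(2), of \<zeta> n] by (cases "\<zeta> \<in> A n") simp_all
    qed
    also have "\<dots> = (\<Sum>l. \<integral>\<^sup>+\<zeta>. (N (g (\<rho> n \<zeta>)) * indicator (V n) \<zeta>) * indicator (A' n l) \<zeta> \<partial>lborel)"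
      using borel_measurable_comp_open[OF V cg mN] A'd by (intro nn_integral_disjoint_family) auto
    also have "\<dots> = (\<Sum>l. \<integral>\<^sup>+\<zeta>. N (g (\<rho> n \<zeta>)) * indicator (A' n l) \<zeta> \<partial>lborel)"
    proof (intro suminf_cong nn_integral_cong)
      fix l \<zeta> show "(N (g (\<rho> n \<zeta>)) * indicator (V n) \<zeta>) * indicator (A' n l) \<zeta> = N (g (\<rho> n \<zeta>)) * indicator (A' n l) \<zeta>"
        using subsetD[OF order_trans[OF A'A A(2)], of \<zeta> n l] by (cases "\<zeta> \<in> A' n l") auto
    qed
    finally show ?thesis .
  qed
  \<comment> \<open>On each piece the coarea inequality replaces the surface integral of
    \<open>N\<close> of \<open>g\<close> by the integral of \<open>N r\<close> times a length. After
    the sums are moved inside, the lengths over one \<open>r\<close> add up to at most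
    \<open>K\<close>, and the integral of \<open>N\<close> is the area of \<open>U\<close>.\<close>
  have "ennreal c * (\<Sum>n. \<integral>\<^sup>+\<zeta>. ennreal \<bar>w (\<rho> n \<zeta>)\<bar> * indicator (A n) \<zeta> \<partial>lborel)
    \<le> ennreal c * (\<Sum>n l. \<integral>\<^sup>+\<zeta>. N (g (\<rho> n \<zeta>)) * indicator (A' n l) \<zeta> \<partial>lborel)"
    by (intro mult_left_mono suminf_le split) auto
  also have "\<dots> = (\<Sum>n l. ennreal c * (\<integral>\<^sup>+\<zeta>. N (g (\<rho> n \<zeta>)) * indicator (A' n l) \<zeta> \<partial>lborel))"
    by (simp only: ennreal_suminf_cmult)
  also have "\<dots> \<le> (\<Sum>n l. \<integral>\<^sup>+r. N r * emeasure lborel (L n l r) \<partial>lborel)"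
    by (intro suminf_le iL) auto
  also have "\<dots> = (\<Sum>n. \<integral>\<^sup>+r. (\<Sum>l. N r * emeasure lborel (L n l r)) \<partial>lborel)"
    by (intro suminf_cong nn_integral_suminf[symmetric]) measurable
  also have "\<dots> = (\<integral>\<^sup>+r. (\<Sum>n l. N r * emeasure lborel (L n l r)) \<partial>lborel)"
    by (intro nn_integral_suminf[symmetric]) measurable
  also have "\<dots> = (\<integral>\<^sup>+r. N r * (\<Sum>n l. emeasure lborel (L n l r)) \<partial>lborel)"
    by (simp only: ennreal_suminf_cmult)
  also have "\<dots> \<le> (\<integral>\<^sup>+r. N r * ennreal K \<partial>lborel)"
    by (intro nn_integral_mono mult_left_mono sum_le) auto
  also have "\<dots> = (\<integral>\<^sup>+r. N r \<partial>lborel) * ennreal K" by (rule nn_integral_multc) simp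
  also have "\<dots> \<le> ennreal K * (\<Sum>n. \<integral>\<^sup>+\<zeta>. J n \<zeta> * indicator (A n) \<zeta> \<partial>lborel)"
    unfolding N_int using U_le by (subst mult.commute) (rule mult_left_mono, auto)
  finally show ?thesis .
qed

section \<open>Foliated level sets\<close>

text \<open>A cyclic permutation of coordinates: the first entry is the coordinate for which the
  equation \<open>v = t\<close> is solved, the remaining pair parametrizes the level set. Indices of
  type \<open>3\<close> wrap around, so one argument covers all three directions.\<close>

definition coord :: "3 \<Rightarrow> real \<times> real \<times> real \<Rightarrow> real^3" where
  "coord i p = fst p *\<^sub>R axis i 1 + fst (snd p) *\<^sub>R axis (i + 1) 1 + snd (snd p) *\<^sub>R axis (i + 2) 1"

lemma cyclic_3_neq [simp]:
  "i + 1 \<noteq> (i::3)" "i + 2 \<noteq> i" "i \<noteq> i + 1" "i \<noteq> i + 2" "i + 1 \<noteq> i + 2" "i + 2 \<noteq> i + 1"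
  by auto

lemma UNIV_3_cyclic: "(UNIV :: 3 set) = {i, i + 1, i + 2}"
  by (rule card_eq_UNIV_imp_eq_UNIV[symmetric]) simp_all

lemma coord_nth [simp]: "coord i p $ i = fst p" "coord i p $ (i + 1) = fst (snd p)" "coord i p $ (i + 2) = snd (snd p)"
  by (simp_all add: coord_def axis_def)

lemma forall_3_cyclic: "(\<forall>j::3. P j) \<longleftrightarrow> P i \<and> P (i + 1) \<and> P (i + 2)"
proof -
  have "(\<forall>j::3. P j) \<longleftrightarrow> (\<forall>j\<in>UNIV. P j)" by simp
  also have "\<dots> \<longleftrightarrow> (\<forall>j\<in>{i, i + 1, i + 2}. P j)" by (subst UNIV_3_cyclic[of i]) (rule refl)
  also have "\<dots> \<longleftrightarrow> P i \<and> P (i + 1) \<and> P (i + 2)" by simp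
  finally show ?thesis .
qed

lemma coord_inverse [simp]: "coord i (x $ i, x $ (i + 1), x $ (i + 2)) = x"
  unfolding vec_eq_iff forall_3_cyclic[of _ i] by simp

lemma bounded_linear_coord: "bounded_linear (coord i)"
  unfolding coord_def[abs_def]
  by (intro bounded_linear_add bounded_linear_compose[OF bounded_linear_scaleR_left]
      bounded_linear_fst bounded_linear_compose[OF bounded_linear_fst bounded_linear_snd]
      bounded_linear_compose[OF bounded_linear_snd bounded_linear_snd])

lemma continuous_on_coord: "continuous_on X (coord i)"
  by (rule linear_continuous_on[OF bounded_linear_coord])

lemma borel_measurable_coord [measurable]: "coord i \<in> borel_measurable borel"
  by (intro borel_measurable_continuous_onI continuous_on_coord)

lemma coord_vimage: "coord i ` X = (\<lambda>x. (x $ i, x $ (i + 1), x $ (i + 2))) -` X"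
proof (intro set_eqI iffI)
  fix x assume "x \<in> (\<lambda>x. (x $ i, x $ (i + 1), x $ (i + 2))) -` X"
  then show "x \<in> coord i ` X" by (intro image_eqI[of _ _ "(x $ i, x $ (i + 1), x $ (i + 2))"]) auto
qed auto

lemma open_coord_image: "open X \<Longrightarrow> open (coord i ` X)"
  unfolding coord_vimage by (intro open_vimage) (auto intro!: continuous_intros)

lemma inner_coord: "x \<bullet> coord i p = x $ i * fst p + x $ (i + 1) * fst (snd p) + x $ (i + 2) * snd (snd p)"
  by (simp add: coord_def inner_add_right inner_axis mult.commute)

lemma emeasure_lborel_Times:
  assumes "A \<in> sets borel" "B \<in> sets borel"
  shows "emeasure (lborel :: ('a::euclidean_space \<times> 'b::euclidean_space) measure) (A \<times> B) = emeasure lborel A * emeasure lborel B"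
  using assms by (subst lborel_prod[symmetric], subst lborel.emeasure_pair_measure_Times) simp_all

lemma lborel_distr_coord: "(lborel :: (real^3) measure) = distr lborel borel (coord i)"
proof (rule lborel_eqI)
  fix l u :: "real^3" assume le: "\<And>b. b \<in> Basis \<Longrightarrow> l \<bullet> b \<le> u \<bullet> b"
  have le': "l $ i \<le> u $ i" for i using le[of "axis i 1"] by (simp add: inner_axis axis_in_Basis_iff)
  have B: "(Basis :: (real^3) set) = {axis i 1, axis (i + 1) 1, axis (i + 2) 1}"
    unfolding Basis_vec_def by (subst UNIV_3_cyclic[of i]) auto
  have "coord i -` box l u = {l $ i<..<u $ i} \<times> {l $ (i+1)<..<u $ (i+1)} \<times> {l $ (i+2)<..<u $ (i+2)}"
    unfolding vimage_def mem_box_cart forall_3_cyclic[of _ i] by auto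
  then have "emeasure (distr lborel borel (coord i)) (box l u) =
      emeasure lborel ({l $ i<..<u $ i} \<times> {l $ (i+1)<..<u $ (i+1)} \<times> {l $ (i+2)<..<u $ (i+2)})"
    by (subst emeasure_distr) auto
  also have "\<dots> = ennreal (u $ i - l $ i) * (ennreal (u $ (i+1) - l $ (i+1)) * ennreal (u $ (i+2) - l $ (i+2)))"
    using le' by (simp add: emeasure_lborel_Times borel_Times)
  also have "\<dots> = ennreal (\<Prod>b\<in>Basis. (u - l) \<bullet> b)"
    unfolding B using le' by (simp add: inner_axis ennreal_mult axis_eq_axis)
  finally show "emeasure (distr lborel borel (coord i)) (box l u) = (\<Prod>b\<in>Basis. (u - l) \<bullet> b)" .
qed simp

lemma nn_integral_coord:
  assumes "f \<in> borel_measurable borel"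
  shows "(\<integral>\<^sup>+x. f x \<partial>lborel) = (\<integral>\<^sup>+\<xi>. f (coord i \<xi>) \<partial>lborel)"
  by (subst lborel_distr_coord[of i]) (use assms in \<open>simp add: nn_integral_distr\<close>)

text \<open>If all three components were at most \<open>c / 2\<close>, the squared norm would be at
  most three quarters of the square of \<open>c\<close>. Strictness leaves room for a
  neighbourhood.\<close>

lemma exists_large_component:
  fixes p :: "real^3"
  assumes "0 < c" "c \<le> norm p"
  obtains i where "c / 2 < \<bar>p $ i\<bar>"
proof -
  have "\<exists>i. c / 2 < \<bar>p $ i\<bar>"
  proof (rule ccontr)
    assume "\<nexists>i. c / 2 < \<bar>p $ i\<bar>"
    then have "(p $ i)\<^sup>2 \<le> (c / 2)\<^sup>2" for i
      using \<open>0 < c\<close> by (intro abs_le_square_iff[THEN iffD1]) (auto simp: not_less)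
    then have "(norm p)\<^sup>2 \<le> 3 * (c / 2)\<^sup>2"
      unfolding power2_norm_eq_inner inner_vec_def sum_3
      by (simp add: power2_eq_square) (smt (verit))
    moreover have "c\<^sup>2 \<le> (norm p)\<^sup>2" using assms by (intro power_mono) auto
    moreover have "0 < c * c" using \<open>0 < c\<close> by simp
    ultimately show False by (simp add: power2_eq_square)
  qed
  then show ?thesis using that by blast
qed

text \<open>Implicit differentiation: on a level set with gradient \<open>n\<close>, unit speed in
  coordinate \<open>j\<close> forces coordinate \<open>i\<close> to change at the rate
  \<open>- n $ j / n $ i\<close>. These are the partial derivatives of the graph
  parametrization.\<close>

definition tangent_vec :: "3 \<Rightarrow> 3 \<Rightarrow> real^3 \<Rightarrow> real^3" where
  "tangent_vec i j n = axis j 1 - (n $ j / n $ i) *\<^sub>R axis i 1"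

text \<open>\<open>\<rho> t\<close> parametrizes the part of the level set \<open>v = t\<close> in \<open>U\<close> by the coordinates other than the \<open>i\<close>-th, and
  \<open>p\<close> is the gradient of \<open>v\<close>. Indices are taken modulo 3.\<close>
definition level_charts :: "(real^3 \<Rightarrow> real) \<Rightarrow> (real^3 \<Rightarrow> real^3) \<Rightarrow> real \<Rightarrow> real \<Rightarrow> 3 \<Rightarrow> (real^3) set \<Rightarrow>
    (real \<Rightarrow> real \<times> real \<Rightarrow> real^3) \<Rightarrow> (real \<Rightarrow> (real \<times> real) set) \<Rightarrow> bool" where
  "level_charts v p c C i U \<rho> V \<longleftrightarrow> open U \<and> (\<forall>t. open (V t)) \<and>
     (\<forall>t. \<forall>\<zeta>\<in>V t. \<rho> t \<zeta> \<in> U \<and> v (\<rho> t \<zeta>) = t \<and> \<rho> t \<zeta> $ (i + 1) = fst \<zeta> \<and> \<rho> t \<zeta> $ (i + 2) = snd \<zeta>) \<and>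
     (\<forall>x\<in>U. c \<le> \<bar>p x $ i\<bar> \<and> (x $ (i + 1), x $ (i + 2)) \<in> V (v x) \<and> \<rho> (v x) (x $ (i + 1), x $ (i + 2)) = x) \<and>
     (\<forall>t. continuous_on (V t) (\<rho> t)) \<and>
     (\<forall>t. \<forall>\<zeta>\<in>V t. (\<rho> t has_derivative (\<lambda>k. fst k *\<^sub>R tangent_vec i (i + 1) (p (\<rho> t \<zeta>))
        + snd k *\<^sub>R tangent_vec i (i + 2) (p (\<rho> t \<zeta>)))) (at \<zeta>)) \<and>
     (\<forall>B\<in>sets borel. \<forall>t. {\<zeta>\<in>V t. \<rho> t \<zeta> \<in> B} \<in> sets borel) \<and>
     (\<forall>B\<in>sets borel. B \<subseteq> U \<longrightarrow> (\<forall>\<phi>\<in>borel_measurable borel.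
        (\<lambda>t. \<integral>\<^sup>+\<zeta>. \<phi> (\<rho> t \<zeta>) * indicator {\<zeta>\<in>V t. \<rho> t \<zeta> \<in> B} \<zeta> \<partial>lborel) \<in> borel_measurable lborel \<and>
        ennreal c * (\<integral>\<^sup>+x. \<phi> x * indicator B x \<partial>lborel)
          \<le> (\<integral>\<^sup>+t. \<integral>\<^sup>+\<zeta>. \<phi> (\<rho> t \<zeta>) * indicator {\<zeta>\<in>V t. \<rho> t \<zeta> \<in> B} \<zeta> \<partial>lborel \<partial>lborel) \<and>
        (\<integral>\<^sup>+t. \<integral>\<^sup>+\<zeta>. \<phi> (\<rho> t \<zeta>) * indicator {\<zeta>\<in>V t. \<rho> t \<zeta> \<in> B} \<zeta> \<partial>lborel \<partial>lborel)
          \<le> ennreal C * (\<integral>\<^sup>+x. \<phi> x * indicator B x \<partial>lborel)))"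

text \<open>One chart of the space serves all levels at once: inverting the map from
  \<open>(s, z)\<close> to \<open>(v, z)\<close> and freezing the first argument at \<open>t\<close>
  gives the parametrization of \<open>v = t\<close>. Integrals over a level set are taken with
  respect to the parameters rather than surface area, so the Jacobian in the slicing formula is
  \<open>|p x $ i|\<close>, which lies between \<open>c\<close> and \<open>C\<close>.\<close>

lemma level_charts_exist:
  fixes v :: "real^3 \<Rightarrow> real"
  assumes "a < b" "open J" "0 < c" and e: "e = 1 \<or> e = -1"
    and dom: "\<And>s z. s \<in> {a..b} \<Longrightarrow> z \<in> J \<Longrightarrow> coord i (s, z) \<in> \<Omega> \<and> c \<le> e * p (coord i (s, z)) $ i"
    and v: "\<And>x. x \<in> \<Omega> \<Longrightarrow> (v has_derivative (\<lambda>k. p x \<bullet> k)) (at x)"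
    and p: "continuous_on \<Omega> p" "\<And>x. x \<in> \<Omega> \<Longrightarrow> norm (p x) \<le> C"
  shows "\<exists>\<rho> V. level_charts v p c C i (coord i ` ({a<..<b} \<times> J)) \<rho> V"
proof -
  let ?Q = "{a<..<b} \<times> J" and ?U = "coord i ` ({a<..<b} \<times> J)"
  let ?h = "\<lambda>\<xi>. v (coord i \<xi>)" and ?h' = "\<lambda>\<xi>. p (coord i \<xi>) $ i"
  define \<Phi> where "\<Phi> = (\<lambda>(s, z). (v (coord i (s, z)), z))"
  have oQ: "open ?Q" using \<open>open J\<close> by (intro open_Times) auto
  have UO: "coord i \<xi> \<in> \<Omega>" if "\<xi> \<in> ?Q" for \<xi>
    using dom[of "fst \<xi>" "snd \<xi>"] that by (auto simp: mem_Times_iff)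
  have hd: "((\<lambda>\<xi>. v (coord i \<xi>)) has_derivative (\<lambda>k. p (coord i \<xi>) \<bullet> coord i k)) (at \<xi>)"
    if "coord i \<xi> \<in> \<Omega>" for \<xi>
    using has_derivative_compose[OF bounded_linear_imp_has_derivative[OF bounded_linear_coord] v[OF that]] .
  have d1: "((\<lambda>s. v (coord i (s, z))) has_real_derivative p (coord i (s, z)) $ i) (at s)"
    if "s \<in> {a..b}" "z \<in> J" for s z
  proof -
    have "((\<lambda>s. (s, z)) has_derivative (\<lambda>k. (k, 0))) (at s)" by (auto intro!: derivative_eq_intros)
    from has_derivative_compose[OF this hd] dom[OF that]
    show ?thesis by (simp add: has_field_derivative_def inner_coord)
  qed
  have ch: "continuous_on ?Q ?h"
    using hd UO by (meson continuous_at_imp_continuous_on has_derivative_continuous)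
  have ch': "continuous_on {a..b} (\<lambda>s. p (coord i (s, z)) $ i)" if "z \<in> J" for z
  proof -
    have "continuous_on {a..b} (\<lambda>s. p (coord i (s, z)))"
      using dom[OF _ that] by (intro continuous_on_compose2[OF p(1)] continuous_on_compose2[OF continuous_on_coord]) (auto intro!: continuous_intros)
    then show ?thesis by (intro continuous_intros)
  qed
  have bd: "c \<le> e * p (coord i (s, z)) $ i \<and> e * p (coord i (s, z)) $ i \<le> C" if "s \<in> {a..b}" "z \<in> J" for s z
    using dom[OF that] p(2)[of "coord i (s, z)"] component_le_norm_cart[of "p (coord i (s, z))" i] e by auto
  note gc = \<open>a < b\<close> \<open>open J\<close> \<open>0 < c\<close> d1 ch ch' e bd
  have inj: "inj_on \<Phi> ?Q" unfolding \<Phi>_def by (rule graph_chart_inj[OF gc])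
  have oW: "open (\<Phi> ` ?Q)" unfolding \<Phi>_def by (rule graph_chart_open[OF gc])
  define \<Psi> where "\<Psi> = the_inv_into ?Q \<Phi>"
  have cW: "continuous_on (\<Phi> ` ?Q) \<Psi>" unfolding \<Psi>_def \<Phi>_def by (rule graph_chart_cont_inv[OF gc])
  have lower: "ennreal c * (\<integral>\<^sup>+\<xi>. \<phi> (\<Phi> \<xi>) * indicator ?Q \<xi> \<partial>lborel) \<le> (\<integral>\<^sup>+\<omega>. \<phi> \<omega> * indicator (\<Phi> ` ?Q) \<omega> \<partial>lborel)"
    if "\<phi> \<in> borel_measurable borel" for \<phi> unfolding \<Phi>_def by (rule graph_chart_lower[OF gc that])
  have upper: "(\<integral>\<^sup>+\<omega>. \<phi> \<omega> * indicator (\<Phi> ` ?Q) \<omega> \<partial>lborel) \<le> ennreal C * (\<integral>\<^sup>+\<xi>. \<phi> (\<Phi> \<xi>) * indicator ?Q \<xi> \<partial>lborel)"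
    if "\<phi> \<in> borel_measurable borel" for \<phi> unfolding \<Phi>_def by (rule graph_chart_upper[OF gc that])
  define W where "W = \<Phi> ` ?Q"
  note oW = oW[folded W_def] and cW = cW[folded W_def]
  have \<Psi>: "\<Psi> (\<Phi> \<xi>) = \<xi>" if "\<xi> \<in> ?Q" for \<xi> unfolding \<Psi>_def using inj that by (rule the_inv_into_f_f)
  have \<Psi>Q: "\<Psi> \<omega> \<in> ?Q" "\<Phi> (\<Psi> \<omega>) = \<omega>" if "\<omega> \<in> W" for \<omega>
    using that \<Psi> unfolding W_def by auto
  define \<rho> where "\<rho> t \<zeta> = coord i (\<Psi> (t, \<zeta>))" for t \<zeta>
  define V where "V t = Pair t -` W" for t
  have \<Psi>_snd: "snd (\<Psi> (t, \<zeta>)) = \<zeta>" "v (\<rho> t \<zeta>) = t" "\<rho> t \<zeta> \<in> ?U" "\<rho> t \<zeta> \<in> \<Omega>" if "\<zeta> \<in> V t" for t \<zeta>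
    using \<Psi>Q[of "(t, \<zeta>)"] UO that unfolding V_def \<rho>_def \<Phi>_def by (auto simp: case_prod_beta)
  have U: "(x $ (i + 1), x $ (i + 2)) \<in> V (v x) \<and> \<rho> (v x) (x $ (i + 1), x $ (i + 2)) = x" if "x \<in> ?U" for x
  proof -
    from that obtain \<xi> where \<xi>: "x = coord i \<xi>" "\<xi> \<in> ?Q" by (rule imageE)
    then have "\<Phi> \<xi> = (v x, (x $ (i + 1), x $ (i + 2)))" by (simp add: \<Phi>_def case_prod_beta)
    moreover have "\<Phi> \<xi> \<in> W" "\<Psi> (\<Phi> \<xi>) = \<xi>" using \<xi> \<Psi> unfolding W_def by auto
    ultimately show ?thesis by (simp add: V_def \<rho>_def \<xi>(1))
  qed
  have oV: "open (V t)" for t unfolding V_def using oW by (intro open_vimage) (auto intro!: continuous_intros)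
  have c\<rho>: "continuous_on (V t) (\<rho> t)" for t
    unfolding \<rho>_def by (intro continuous_on_compose2[OF continuous_on_coord] continuous_on_compose2[OF cW])
      (auto intro!: continuous_intros simp: V_def)
  have pU: "c \<le> \<bar>p x $ i\<bar>" if "x \<in> ?U" for x
  proof -
    from that obtain \<xi> where "x = coord i \<xi>" "\<xi> \<in> ?Q" by (rule imageE)
    then show ?thesis using dom[of "fst \<xi>" "snd \<xi>"] e by (auto simp: mem_Times_iff)
  qed
  have der: "(\<rho> t has_derivative (\<lambda>k. fst k *\<^sub>R tangent_vec i (i + 1) (p (\<rho> t \<zeta>))
        + snd k *\<^sub>R tangent_vec i (i + 2) (p (\<rho> t \<zeta>)))) (at \<zeta>)" if z: "\<zeta> \<in> V t" for t \<zeta>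
  proof -
    let ?w = "(t, \<zeta>)" let ?p = "p (\<rho> t \<zeta>)"
    have w: "?w \<in> W" using z by (simp add: V_def)
    have p0: "?p $ i \<noteq> 0" using pU[OF \<Psi>_snd(3)[OF z]] \<open>0 < c\<close> by auto
    let ?f' = "\<lambda>k. (?p \<bullet> coord i k, snd k)"
    \<comment> \<open>The inverse of \<open>?f'\<close>, found by solving the first component for
      the coordinate with index \<open>i\<close>; this divides by \<open>?p $ i\<close>.\<close>
    let ?g' = "\<lambda>k. ((fst k - ?p $ (i + 1) * fst (snd k) - ?p $ (i + 2) * snd (snd k)) / ?p $ i, snd k)"
    have f': "(\<Phi> has_derivative ?f') (at (\<Psi> ?w))"
      unfolding \<Phi>_def case_prod_beta prod.collapse
      using hd[of "\<Psi> ?w"] \<Psi>_snd(4)[OF z]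
      by (intro has_derivative_Pair) (auto simp: \<rho>_def intro!: derivative_eq_intros)
    have "(\<Psi> has_derivative ?g') (at ?w)"
    proof (rule has_derivative_inverse_basic[where g = \<Psi> and y = "(t, \<zeta>)" and T = W, OF f' _ _ _ oW w])
      show "bounded_linear ?g'"
        by (intro bounded_linear_Pair bounded_linear_snd bounded_linear_compose[OF bounded_linear_divide]
            bounded_linear_sub bounded_linear_compose[OF bounded_linear_mult_right]
            bounded_linear_compose[OF bounded_linear_fst bounded_linear_snd]
            bounded_linear_compose[OF bounded_linear_snd bounded_linear_snd] bounded_linear_fst)
      show "?g' \<circ> ?f' = id" using p0 by (auto simp: fun_eq_iff inner_coord)
      show "continuous (at ?w) \<Psi>" using cW oW w by (simp add: continuous_on_eq_continuous_at)
      show "\<Phi> (\<Psi> z) = z" if "z \<in> W" for z using \<Psi>Q(2)[OF that] .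
    qed
    moreover have "((\<lambda>\<zeta>. (t, \<zeta>)) has_derivative (\<lambda>k. (0, k))) (at \<zeta>)" by (auto intro!: derivative_eq_intros)
    ultimately have "((\<lambda>\<zeta>. \<Psi> (t, \<zeta>)) has_derivative (\<lambda>k. ?g' (0, k))) (at \<zeta>)"
      by (rule has_derivative_compose[rotated])
    from has_derivative_compose[OF this bounded_linear_imp_has_derivative[OF bounded_linear_coord[of i]]]
    have "(\<rho> t has_derivative (\<lambda>k. coord i (?g' (0, k)))) (at \<zeta>)" unfolding \<rho>_def .
    moreover have "coord i (?g' (0, k)) = fst k *\<^sub>R tangent_vec i (i + 1) ?p + snd k *\<^sub>R tangent_vec i (i + 2) ?p" for k
      using p0 unfolding vec_eq_iff forall_3_cyclic[of _ i]
      by (simp add: tangent_vec_def axis_def divide_simps)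
    ultimately show ?thesis by simp
  qed
  have mW: "{\<omega>\<in>W. coord i (\<Psi> \<omega>) \<in> B} \<in> sets borel" if B: "B \<in> sets borel" for B
  proof -
    have "(\<lambda>\<omega>. coord i (\<Psi> \<omega>)) \<in> borel_measurable (restrict_space borel W)"
      by (intro borel_measurable_continuous_on_restrict continuous_on_compose2[OF continuous_on_coord cW]) auto
    from measurable_sets[OF this B] have "(\<lambda>\<omega>. coord i (\<Psi> \<omega>)) -` B \<inter> W \<in> sets (restrict_space borel W)"
      by (simp add: space_restrict_space)
    then have "(\<lambda>\<omega>. coord i (\<Psi> \<omega>)) -` B \<inter> W \<in> sets borel"
      using oW by (subst (asm) sets_restrict_space_iff) auto
    moreover have "(\<lambda>\<omega>. coord i (\<Psi> \<omega>)) -` B \<inter> W = {\<omega>\<in>W. coord i (\<Psi> \<omega>) \<in> B}" by auto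
    ultimately show ?thesis by simp
  qed
  have sec: "{\<zeta>\<in>V t. \<rho> t \<zeta> \<in> B} = Pair t -` {\<omega>\<in>W. coord i (\<Psi> \<omega>) \<in> B}" for t B
    by (auto simp: V_def \<rho>_def)
  have mV: "{\<zeta>\<in>V t. \<rho> t \<zeta> \<in> B} \<in> sets borel" if "B \<in> sets borel" for B t
  proof -
    have "{\<omega>\<in>W. coord i (\<Psi> \<omega>) \<in> B} \<in> sets (lborel \<Otimes>\<^sub>M lborel)"
      using mW[OF that] by (subst lborel_prod) simp
    from sets_Pair1[OF this] show ?thesis unfolding sec by simp
  qed
  have int: "(\<lambda>t. \<integral>\<^sup>+\<zeta>. \<phi> (\<rho> t \<zeta>) * indicator {\<zeta>\<in>V t. \<rho> t \<zeta> \<in> B} \<zeta> \<partial>lborel) \<in> borel_measurable lborel \<and>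
        ennreal c * (\<integral>\<^sup>+x. \<phi> x * indicator B x \<partial>lborel)
          \<le> (\<integral>\<^sup>+t. \<integral>\<^sup>+\<zeta>. \<phi> (\<rho> t \<zeta>) * indicator {\<zeta>\<in>V t. \<rho> t \<zeta> \<in> B} \<zeta> \<partial>lborel \<partial>lborel) \<and>
        (\<integral>\<^sup>+t. \<integral>\<^sup>+\<zeta>. \<phi> (\<rho> t \<zeta>) * indicator {\<zeta>\<in>V t. \<rho> t \<zeta> \<in> B} \<zeta> \<partial>lborel \<partial>lborel)
          \<le> ennreal C * (\<integral>\<^sup>+x. \<phi> x * indicator B x \<partial>lborel)"
    if B[measurable]: "B \<in> sets borel" and sub: "B \<subseteq> ?U" and \<phi>[measurable]: "\<phi> \<in> borel_measurable borel" for B \<phi>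
  proof -
    \<comment> \<open>The restriction of \<open>\<phi>\<close> to \<open>B\<close>, transported to
      the straightened domain: its sections are the integrands on the levels, and its pullback by
      \<open>\<Phi>\<close> is the integrand in space.\<close>
    define \<psi> where "\<psi> \<omega> = \<phi> (coord i (\<Psi> \<omega>)) * indicator W \<omega> * indicator {\<omega>\<in>W. coord i (\<Psi> \<omega>) \<in> B} \<omega>" for \<omega>
    have m\<psi>: "\<psi> \<in> borel_measurable borel"
      unfolding \<psi>_def using mW[OF B]
        borel_measurable_comp_open[OF oW continuous_on_compose2[OF continuous_on_coord cW subset_UNIV] \<phi>]
      by measurable
    have m2: "\<psi> \<in> borel_measurable (lborel \<Otimes>\<^sub>M lborel)" using m\<psi> by (simp add: lborel_prod)
    have \<psi>_eq: "\<psi> (t, \<zeta>) = \<phi> (\<rho> t \<zeta>) * indicator {\<zeta>\<in>V t. \<rho> t \<zeta> \<in> B} \<zeta>" for t \<zeta>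
      by (auto simp: \<psi>_def V_def \<rho>_def indicator_def)
    have 1: "(\<integral>\<^sup>+\<omega>. \<psi> \<omega> * indicator (\<Phi> ` ?Q) \<omega> \<partial>lborel) =
        (\<integral>\<^sup>+t. \<integral>\<^sup>+\<zeta>. \<phi> (\<rho> t \<zeta>) * indicator {\<zeta>\<in>V t. \<rho> t \<zeta> \<in> B} \<zeta> \<partial>lborel \<partial>lborel)"
    proof -
      have "(\<integral>\<^sup>+\<omega>. \<psi> \<omega> * indicator (\<Phi> ` ?Q) \<omega> \<partial>lborel) = (\<integral>\<^sup>+\<omega>. \<psi> \<omega> \<partial>lborel)"
        unfolding W_def[symmetric] by (intro nn_integral_cong) (simp add: \<psi>_def indicator_def)
      also have "\<dots> = (\<integral>\<^sup>+t. \<integral>\<^sup>+\<zeta>. \<psi> (t, \<zeta>) \<partial>lborel \<partial>lborel)"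
        using lborel.nn_integral_fst[OF m2] by (simp add: lborel_prod)
      finally show ?thesis unfolding \<psi>_eq .
    qed
    have 2: "(\<integral>\<^sup>+\<xi>. \<psi> (\<Phi> \<xi>) * indicator ?Q \<xi> \<partial>lborel) = (\<integral>\<^sup>+x. \<phi> x * indicator B x \<partial>lborel)"
    proof -
      have "(\<integral>\<^sup>+x. \<phi> x * indicator B x \<partial>lborel) = (\<integral>\<^sup>+\<xi>. \<phi> (coord i \<xi>) * indicator B (coord i \<xi>) \<partial>lborel)"
        by (rule nn_integral_coord) measurable
      also have "\<dots> = (\<integral>\<^sup>+\<xi>. \<psi> (\<Phi> \<xi>) * indicator ?Q \<xi> \<partial>lborel)"
      proof (rule nn_integral_cong)
        fix \<xi>
        show "\<phi> (coord i \<xi>) * indicator B (coord i \<xi>) = \<psi> (\<Phi> \<xi>) * indicator ?Q \<xi>"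
        proof (cases "\<xi> \<in> ?Q")
          case True
          then have "\<Phi> \<xi> \<in> W" "\<Psi> (\<Phi> \<xi>) = \<xi>" using \<Psi> unfolding W_def by auto
          then show ?thesis using True by (simp add: \<psi>_def indicator_def)
        next
          case False
          have "coord i \<xi> \<notin> B"
          proof
            assume "coord i \<xi> \<in> B"
            then obtain \<xi>' where "coord i \<xi> = coord i \<xi>'" "\<xi>' \<in> ?Q" using sub by (meson imageE subsetD)
            then have "\<xi> = \<xi>'" by (metis coord_nth prod.collapse)
            with \<open>\<xi>' \<in> ?Q\<close> False show False by simp
          qed
          then show ?thesis using False by simp
        qed
      qed
      finally show ?thesis by simp
    qed
    have 3: "(\<lambda>t. \<integral>\<^sup>+\<zeta>. \<phi> (\<rho> t \<zeta>) * indicator {\<zeta>\<in>V t. \<rho> t \<zeta> \<in> B} \<zeta> \<partial>lborel) \<in> borel_measurable lborel"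
      using lborel.borel_measurable_nn_integral_fst[OF m2] unfolding \<psi>_eq .
    show ?thesis using lower[OF m\<psi>] upper[OF m\<psi>] 3 unfolding 1 2 by (intro conjI)
  qed
  have "level_charts v p c C i ?U \<rho> V"
    unfolding level_charts_def
    using open_coord_image[OF oQ] oV \<Psi>_snd(2,3) U c\<rho> der mV int pU
  proof (intro conjI allI ballI impI)
    fix t \<zeta> assume z: "\<zeta> \<in> V t"
    show "\<rho> t \<zeta> $ (i + 1) = fst \<zeta>" "\<rho> t \<zeta> $ (i + 2) = snd \<zeta>" unfolding \<rho>_def coord_nth \<Psi>_snd(1)[OF z] by simp_all
  qed simp_all
  then show ?thesis by (intro exI)
qed

section \<open>Mollification\<close>

lemma grad_inner:
  assumes "f differentiable (at x)"
  shows "(f has_derivative (\<lambda>k. grad f x \<bullet> k)) (at x)"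
proof -
  interpret bounded_linear "frechet_derivative f (at x)"
    using assms by (intro has_derivative_bounded_linear) (simp add: frechet_derivative_works)
  have "frechet_derivative f (at x) = (\<lambda>k. grad f x \<bullet> k)"
  proof
    fix k :: "real^'a"
    have "frechet_derivative f (at x) k = frechet_derivative f (at x) (\<Sum>i\<in>UNIV. k $ i *\<^sub>R axis i 1)"
      by (simp only: scalar_mult_eq_scaleR[symmetric] basis_expansion)
    also have "\<dots> = (\<Sum>i\<in>UNIV. k $ i * frechet_derivative f (at x) (axis i 1))"
      by (simp add: sum scaleR)
    also have "\<dots> = grad f x \<bullet> k"
      by (simp add: inner_vec_def grad_def partial_deriv_def mult.commute)
    finally show "frechet_derivative f (at x) k = grad f x \<bullet> k" .
  qed
  with assms show ?thesis by (simp add: frechet_derivative_works)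
qed

lemma grad_eqI:
  assumes "(f has_derivative (\<lambda>k. p \<bullet> k)) (at x)"
  shows "grad f x = p"
  unfolding grad_def partial_deriv_def frechet_derivative_at[OF assms, symmetric]
  by (simp add: vec_eq_iff inner_axis)

lemma partial_deriv_eqI:
  assumes "(f has_derivative f') (at x)"
  shows "partial_deriv i f x = f' (axis i 1)"
  unfolding partial_deriv_def frechet_derivative_at[OF assms, symmetric] ..

section \<open>Algebra of smooth functions\<close>

lemma Ck_on_Suc_imp: "Ck_on (Suc k) S f \<Longrightarrow> Ck_on k S f"
proof (induction k arbitrary: f)
  case 0
  then show ?case by (auto intro!: continuous_at_imp_continuous_on differentiable_imp_continuous_within)
next
  case (Suc k)
  then show ?case by simp
qed

lemma Ck_on_const: "Ck_on k UNIV (\<lambda>x. c)"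
proof (induction k arbitrary: c)
  case (Suc k)
  have "partial_deriv i (\<lambda>x. c) = (\<lambda>x. 0)" for i :: 'a
    by (intro ext partial_deriv_eqI[THEN trans]) (auto intro!: derivative_eq_intros)
  with Suc show ?case by simp
qed simp

lemma Ck_on_add: "Ck_on k UNIV f \<Longrightarrow> Ck_on k UNIV g \<Longrightarrow> Ck_on k UNIV (\<lambda>x. f x + g x)"
proof (induction k arbitrary: f g)
  case 0 then show ?case by (auto intro: continuous_intros)
next
  case (Suc k)
  have "partial_deriv i (\<lambda>x. f x + g x) = (\<lambda>x. partial_deriv i f x + partial_deriv i g x)" for i
  proof
    fix x
    have "((\<lambda>x. f x + g x) has_derivative (\<lambda>k. frechet_derivative f (at x) k + frechet_derivative g (at x) k)) (at x)"
      using Suc.prems by (intro has_derivative_add) (auto simp: frechet_derivative_works[symmetric])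
    from partial_deriv_eqI[OF this] show "partial_deriv i (\<lambda>x. f x + g x) x = partial_deriv i f x + partial_deriv i g x"
      by (simp add: partial_deriv_def)
  qed
  with Suc show ?case by auto
qed

lemma Ck_on_mult: "Ck_on k UNIV f \<Longrightarrow> Ck_on k UNIV g \<Longrightarrow> Ck_on k UNIV (\<lambda>x. f x * g x)"
proof (induction k arbitrary: f g)
  case 0 then show ?case by (auto intro: continuous_intros)
next
  case (Suc k)
  have "partial_deriv i (\<lambda>x. f x * g x) = (\<lambda>x. f x * partial_deriv i g x + partial_deriv i f x * g x)" for i
  proof
    fix x
    have "((\<lambda>x. f x * g x) has_derivative (\<lambda>k. f x * frechet_derivative g (at x) k + frechet_derivative f (at x) k * g x)) (at x)"
      using Suc.prems by (intro has_derivative_mult) (auto simp: frechet_derivative_works[symmetric])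
    from partial_deriv_eqI[OF this]
    show "partial_deriv i (\<lambda>x. f x * g x) x = f x * partial_deriv i g x + partial_deriv i f x * g x"
      by (simp add: partial_deriv_def)
  qed
  moreover have "Ck_on k UNIV (\<lambda>x. f x * partial_deriv i g x + partial_deriv i f x * g x)" for i
    using Suc.prems Ck_on_Suc_imp[OF Suc.prems(1)] Ck_on_Suc_imp[OF Suc.prems(2)]
    by (intro Ck_on_add Suc.IH) auto
  ultimately show ?case using Suc.prems by auto
qed

lemma Ck_on_all_partial_deriv: "\<forall>k. Ck_on k UNIV f \<Longrightarrow> \<forall>k. Ck_on k UNIV (partial_deriv i f)"
  by (metis Ck_on.simps(2))

lemma Ck_on_all_differentiable: "\<forall>k. Ck_on k UNIV f \<Longrightarrow> f differentiable (at x)"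
  by (metis Ck_on.simps(2) UNIV_I)

lemma Ck_on_all_continuous: "\<forall>k. Ck_on k UNIV f \<Longrightarrow> continuous_on UNIV f"
  by (metis Ck_on.simps(1))

lemma continuous_on_grad: "(\<And>i. continuous_on S (partial_deriv i f)) \<Longrightarrow> continuous_on S (grad f)"
  unfolding grad_def[abs_def] by (intro continuous_on_vec_lambda) auto

lemma Ck_on_all_continuous_grad: "\<forall>k. Ck_on k UNIV f \<Longrightarrow> continuous_on UNIV (grad f)"
  by (intro continuous_on_grad Ck_on_all_continuous Ck_on_all_partial_deriv)

section \<open>Differentiation under the integral sign and convolution\<close>

lemma lborel_integral_cbox:
  fixes f :: "'a::euclidean_space \<Rightarrow> 'b::euclidean_space"
  assumes "continuous_on (cbox a b) f" "\<And>x. x \<notin> cbox a b \<Longrightarrow> f x = 0"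
  shows "integrable lborel f" "(LINT x|lborel. f x) = integral (cbox a b) f"
proof -
  have eq: "(\<lambda>x. indicator (cbox a b) x *\<^sub>R f x) = f" using assms(2) by (auto simp: fun_eq_iff indicator_def)
  show i: "integrable lborel f"
    using borel_integrable_compact[OF compact_cbox assms(1)] unfolding eq .
  have "integral UNIV f = integral UNIV (\<lambda>x. if x \<in> cbox a b then f x else 0)"
    using assms(2) by (intro integral_cong) auto
  then show "(LINT x|lborel. f x) = integral (cbox a b) f"
    using integral_lborel[OF i] by (simp add: integral_restrict_UNIV)
qed

lemma has_derivative_parametric_integral:
  fixes F :: "'a::euclidean_space \<Rightarrow> 'b::euclidean_space \<Rightarrow> real" and dF :: "'a \<Rightarrow> 'b \<Rightarrow> 'a"
  assumes "\<And>x t. ((\<lambda>x. F x t) has_derivative (\<lambda>k. dF x t \<bullet> k)) (at x)"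
    and F: "\<And>x. continuous_on (cbox a b) (F x)"
    and dF: "continuous_on (UNIV \<times> cbox a b) (\<lambda>(x, t). dF x t)"
  shows "((\<lambda>x. integral (cbox a b) (F x)) has_derivative (\<lambda>k. integral (cbox a b) (dF x) \<bullet> k)) (at x)"
proof -
  have cdF: "continuous_on (cbox a b) (dF x)" for x
  proof -
    have "continuous_on (cbox a b) (\<lambda>t. (\<lambda>(x, t). dF x t) (x, t))"
      by (rule continuous_on_compose2[OF dF]) (auto intro!: continuous_intros)
    then show ?thesis by simp
  qed
  have "((\<lambda>x. integral (cbox a b) (F x)) has_derivative integral (cbox a b) (\<lambda>t. blinfun_inner_right (dF x t))) (at x within UNIV)"
  proof (rule leibniz_rule)
    show "((\<lambda>x. F x t) has_derivative blinfun_apply (blinfun_inner_right (dF x t))) (at x within UNIV)" for x t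
      using assms(1) by simp
    show "F x integrable_on cbox a b" for x using F by (rule integrable_continuous)
    show "continuous_on (UNIV \<times> cbox a b) (\<lambda>(x, t). blinfun_inner_right (dF x t))"
      using bounded_linear.continuous_on[OF bounded_linear_blinfun_inner_right dF] by (simp add: case_prod_beta)
  qed auto
  moreover have "blinfun_apply (integral (cbox a b) (\<lambda>t. blinfun_inner_right (dF x t))) k = integral (cbox a b) (dF x) \<bullet> k" for k
  proof -
    have "(\<lambda>t. blinfun_inner_right (dF x t)) integrable_on cbox a b"
      using bounded_linear.continuous_on[OF bounded_linear_blinfun_inner_right cdF] by (rule integrable_continuous)
    then have "blinfun_apply (integral (cbox a b) (\<lambda>t. blinfun_inner_right (dF x t))) k = integral (cbox a b) (\<lambda>t. dF x t \<bullet> k)"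
      by (simp add: blinfun_apply_integral)
    also have "\<dots> = integral (cbox a b) (dF x) \<bullet> k"
      using integral_linear[OF integrable_continuous[OF cdF] bounded_linear_inner_left] by (simp add: o_def)
    finally show ?thesis .
  qed
  then have "blinfun_apply (integral (cbox a b) (\<lambda>t. blinfun_inner_right (dF x t))) = (\<lambda>k. integral (cbox a b) (dF x) \<bullet> k)"
    by (rule ext)
  ultimately show ?thesis by simp
qed

lemma has_derivative_convolution:
  fixes h \<psi> :: "real^'n::finite \<Rightarrow> real"
  assumes h: "\<forall>k. Ck_on k UNIV h" and \<psi>: "continuous_on UNIV \<psi>"
  shows "((\<lambda>x. integral (cbox a b) (\<lambda>z. h (c *\<^sub>R (x - z)) * \<psi> z)) has_derivative
    (\<lambda>k. integral (cbox a b) (\<lambda>z. (c * \<psi> z) *\<^sub>R grad h (c *\<^sub>R (x - z))) \<bullet> k)) (at x)"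
proof (rule has_derivative_parametric_integral)
  fix x t :: "real^'n"
  have "((\<lambda>x. c *\<^sub>R (x - t)) has_derivative (\<lambda>k. c *\<^sub>R k)) (at x)"
    by (auto intro!: derivative_eq_intros)
  from has_derivative_mult_left[OF has_derivative_compose[OF this grad_inner[OF Ck_on_all_differentiable[OF h]]], of "\<psi> t"]
  show "((\<lambda>x. h (c *\<^sub>R (x - t)) * \<psi> t) has_derivative (\<lambda>k. ((c * \<psi> t) *\<^sub>R grad h (c *\<^sub>R (x - t))) \<bullet> k)) (at x)"
    by (simp add: mult_ac)
next
  show "continuous_on (cbox a b) (\<lambda>z. h (c *\<^sub>R (x - z)) * \<psi> z)" for x
    by (intro continuous_intros continuous_on_compose2[OF Ck_on_all_continuous[OF h]] continuous_on_subset[OF \<psi>]) auto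
  show "continuous_on (UNIV \<times> cbox a b) (\<lambda>(x, z). (c * \<psi> z) *\<^sub>R grad h (c *\<^sub>R (x - z)))"
    unfolding case_prod_beta
    by (intro continuous_intros continuous_on_compose2[OF Ck_on_all_continuous_grad[OF h]] continuous_on_compose2[OF \<psi>]) auto
qed

text \<open>Every derivative falls on the kernel \<open>h\<close>, so a continuous
  \<open>\<psi>\<close> is enough. Each differentiation produces a factor \<open>c\<close>, which is
  absorbed into \<open>\<psi>\<close>; hence the induction varies both functions.\<close>

lemma Ck_on_convolution:
  fixes h \<psi> :: "real^'n::finite \<Rightarrow> real"
  assumes "\<forall>k. Ck_on k UNIV h" "continuous_on UNIV \<psi>"
  shows "Ck_on k UNIV (\<lambda>x. integral (cbox a b) (\<lambda>z. h (c *\<^sub>R (x - z)) * \<psi> z))"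
  using assms
proof (induction k arbitrary: h \<psi>)
  case (0 h \<psi>)
  show ?case
    using has_derivative_convolution[OF 0] by (auto intro!: continuous_at_imp_continuous_on has_derivative_continuous)
next
  case (Suc k h \<psi>)
  have "partial_deriv i (\<lambda>x. integral (cbox a b) (\<lambda>z. h (c *\<^sub>R (x - z)) * \<psi> z)) =
      (\<lambda>x. integral (cbox a b) (\<lambda>z. partial_deriv i h (c *\<^sub>R (x - z)) * (c * \<psi> z)))" for i
  proof
    fix x
    have "continuous_on (cbox a b) (\<lambda>z. (c * \<psi> z) *\<^sub>R grad h (c *\<^sub>R (x - z)))"
      by (intro continuous_intros continuous_on_compose2[OF Ck_on_all_continuous_grad[OF Suc.prems(1)]]
          continuous_on_subset[OF Suc.prems(2)]) auto
    from integral_linear[OF integrable_continuous[OF this] bounded_linear_vec_nth[of i]]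
    show "partial_deriv i (\<lambda>x. integral (cbox a b) (\<lambda>z. h (c *\<^sub>R (x - z)) * \<psi> z)) x =
        integral (cbox a b) (\<lambda>z. partial_deriv i h (c *\<^sub>R (x - z)) * (c * \<psi> z))"
      unfolding partial_deriv_eqI[OF has_derivative_convolution[OF Suc.prems]]
      by (simp add: inner_axis o_def grad_def mult.commute)
  qed
  moreover have "Ck_on k UNIV (\<lambda>x. integral (cbox a b) (\<lambda>z. partial_deriv i h (c *\<^sub>R (x - z)) * (c * \<psi> z)))" for i
    by (intro Suc.IH Ck_on_all_partial_deriv Suc.prems continuous_intros)
  ultimately show ?case
    using differentiableI[OF has_derivative_convolution[OF Suc.prems]] by simp
qed

lemma lborel_integral_reflect_scale:
  fixes f :: "real^'n::finite \<Rightarrow> real"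
  assumes "f \<in> borel_measurable borel" "0 < e"
  shows "(LINT z|lborel. f z) = e ^ CARD('n) * (LINT y|lborel. f (x - e *\<^sub>R y))"
proof -
  have "(LINT z|lborel. f z) = (LINT z|density (distr lborel borel (\<lambda>y. x + (- e) *\<^sub>R y)) (\<lambda>_. ennreal (\<bar>- e\<bar> ^ DIM(real^'n))). f z)"
    using assms(2) by (subst lborel_affine[of "- e" x]) (simp_all add: ennreal_power)
  also have "\<dots> = (LINT z|distr lborel borel (\<lambda>y. x + (- e) *\<^sub>R y). (\<bar>- e\<bar> ^ DIM(real^'n)) * f z)"
    using assms by (subst integral_density) auto
  also have "\<dots> = (LINT y|lborel. (\<bar>- e\<bar> ^ DIM(real^'n)) * f (x + (- e) *\<^sub>R y))"
    using assms by (subst integral_distr) auto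
  finally show ?thesis using assms(2) by simp
qed

text \<open>The kernel \<open>\<eta>\<close> is a hypothesis: it is later obtained as a normalized square of a test function, so
  that no bump function has to be constructed.\<close>
lemma C1_compact_support_approx:
  fixes \<psi> \<eta> :: "real^'n::finite \<Rightarrow> real" and d\<psi> :: "real^'n \<Rightarrow> real^'n"
  assumes \<Omega>: "open \<Omega>" "bounded \<Omega>"
    and \<eta>: "\<forall>k. Ck_on k UNIV \<eta>" "compact A'" "\<And>x. x \<notin> A' \<Longrightarrow> \<eta> x = 0" "(LINT x|lborel. \<eta> x) = 1"
    and \<psi>: "\<And>x. (\<psi> has_derivative (\<lambda>k. d\<psi> x \<bullet> k)) (at x)" "continuous_on UNIV d\<psi>"
    and A: "compact A" "A \<subseteq> \<Omega>" "\<And>x. x \<notin> A \<Longrightarrow> \<psi> x = 0"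
    and "0 < \<delta>"
  obtains m where "test_function \<Omega> m" "\<And>x. x \<in> \<Omega> \<Longrightarrow> \<bar>m x - \<psi> x\<bar> \<le> \<delta>" "\<And>x. x \<in> \<Omega> \<Longrightarrow> norm (grad m x - d\<psi> x) \<le> \<delta>"
proof -
  obtain R0 where R0: "\<And>x. x \<in> \<Omega> \<Longrightarrow> norm x \<le> R0" using \<Omega>(2) unfolding bounded_iff by auto
  obtain R1 where R1: "R1 > 0" "\<And>x. x \<in> A' \<Longrightarrow> norm x \<le> R1" using compact_imp_bounded[OF \<eta>(2)] unfolding bounded_pos by auto
  obtain a1 b1 :: "real^'n" where B1: "A' \<subseteq> cbox a1 b1"
    using bounded_subset_cbox_symmetric[OF compact_imp_bounded[OF \<eta>(2)]] by blast
  obtain a2 b2 :: "real^'n" where B2: "A \<subseteq> cbox a2 b2"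
    using bounded_subset_cbox_symmetric[OF compact_imp_bounded[OF A(1)]] by blast
  have c\<eta>: "continuous_on UNIV \<eta>" using \<eta>(1) by (rule Ck_on_all_continuous)
  have c\<psi>: "continuous_on UNIV \<psi>" using \<psi>(1) by (meson continuous_at_imp_continuous_on has_derivative_continuous)
  have "bounded (\<eta> ` cbox a1 b1)"
    by (intro compact_imp_bounded compact_continuous_image continuous_on_subset[OF c\<eta>]) auto
  then obtain E where E: "E > 0" "\<And>y. y \<in> cbox a1 b1 \<Longrightarrow> \<bar>\<eta> y\<bar> \<le> E" unfolding bounded_pos by auto
  \<comment> \<open>The oscillation allowed to \<open>\<psi>\<close> and \<open>d\<psi>\<close>. No
    sign of the kernel is assumed, so the error is bounded by its supremum \<open>E\<close> times
    the volume of the box; the added 1 avoids division by zero.\<close>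
  define \<kappa> where "\<kappa> = \<delta> / (E * (measure lborel (cbox a1 b1) + 1))"
  have \<kappa>0: "0 < \<kappa>" using \<open>0 < \<delta>\<close> E(1) by (simp add: \<kappa>_def add_nonneg_pos)
  have \<kappa>: "E * \<kappa> * measure lborel (cbox a1 b1) \<le> \<delta>"
  proof -
    have "E * \<kappa> * measure lborel (cbox a1 b1) = \<delta> * (measure lborel (cbox a1 b1) / (measure lborel (cbox a1 b1) + 1))"
      using E(1) by (simp add: \<kappa>_def)
    also have "\<dots> \<le> \<delta> * 1"
      using \<open>0 < \<delta>\<close> by (intro mult_left_mono) (auto simp: divide_le_eq_1 add_nonneg_pos)
    finally show ?thesis by simp
  qed
  \<comment> \<open>A compact ball that contains \<open>\<Omega>\<close> and all its points shifted
    by \<open>e *\<^sub>R y\<close> with \<open>e\<close> at most 1 and \<open>y\<close> in the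
    support of the kernel, so that uniform continuity applies.\<close>
  let ?Kc = "cball (0 :: real^'n) (R0 + R1)"
  have "uniformly_continuous_on ?Kc \<psi>" "uniformly_continuous_on ?Kc d\<psi>"
    by (intro compact_uniformly_continuous continuous_on_subset[OF c\<psi>] continuous_on_subset[OF \<psi>(2)]; simp)+
  then obtain d1 d2 where d1: "d1 > 0" "\<And>x y. x \<in> ?Kc \<Longrightarrow> y \<in> ?Kc \<Longrightarrow> dist y x < d1 \<Longrightarrow> dist (\<psi> y) (\<psi> x) < \<kappa>"
    and d2: "d2 > 0" "\<And>x y. x \<in> ?Kc \<Longrightarrow> y \<in> ?Kc \<Longrightarrow> dist y x < d2 \<Longrightarrow> dist (d\<psi> y) (d\<psi> x) < \<kappa>"
    unfolding uniformly_continuous_on_def using \<kappa>0 by metis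
  have "\<exists>d>0. \<forall>x\<in>A. \<forall>y\<in>- \<Omega>. d \<le> dist x y"
    using A(1,2) \<Omega>(1) by (intro separate_compact_closed) auto
  then obtain d3 where d3: "d3 > 0" "\<And>x y. x \<in> A \<Longrightarrow> y \<notin> \<Omega> \<Longrightarrow> d3 \<le> dist x y"
    by auto
  \<comment> \<open>The mollification radius: the bound 1 keeps shifted points in
    \<open>?Kc\<close>, \<open>d1\<close> and \<open>d2\<close> control the oscillation of
    \<open>\<psi>\<close> and \<open>d\<psi>\<close>, and \<open>d3\<close> keeps the enlarged
    support inside \<open>\<Omega>\<close>. The factor 2 makes the three inequalities
    strict.\<close>
  define e where "e = min 1 (min d1 (min d2 d3) / (2 * R1))"
  have e: "0 < e" "e \<le> 1" using d1(1) d2(1) d3(1) R1(1) by (auto simp: e_def)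
  have "e * R1 \<le> (min d1 (min d2 d3) / (2 * R1)) * R1" using R1(1) by (intro mult_right_mono) (auto simp: e_def)
  then have eR: "e * R1 < d1" "e * R1 < d2" "e * R1 < d3" using R1(1) d1(1) d2(1) d3(1) by auto
  have small: "norm (e *\<^sub>R y) \<le> e * R1" if "y \<in> A'" for y using R1(2)[OF that] e by simp
  define m where "m x = integral (cbox a1 b1) (\<lambda>y. \<eta> y * \<psi> (x - e *\<^sub>R y))" for x
  have c1: "continuous_on X (\<lambda>y. \<eta> y * \<psi> (x - e *\<^sub>R y))" for x X
    by (intro continuous_intros continuous_on_subset[OF c\<eta>] continuous_on_compose2[OF c\<psi>]) auto
  have der: "(m has_derivative (\<lambda>k. integral (cbox a1 b1) (\<lambda>y. \<eta> y *\<^sub>R d\<psi> (x - e *\<^sub>R y)) \<bullet> k)) (at x)" for x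
    unfolding m_def
  proof (rule has_derivative_parametric_integral)
    fix x t :: "real^'n"
    have "((\<lambda>x. x - e *\<^sub>R t) has_derivative (\<lambda>k. k)) (at x)" by (auto intro!: derivative_eq_intros)
    from has_derivative_mult_right[OF has_derivative_compose[OF this \<psi>(1)], of "\<eta> t"]
    show "((\<lambda>x. \<eta> t * \<psi> (x - e *\<^sub>R t)) has_derivative (\<lambda>k. (\<eta> t *\<^sub>R d\<psi> (x - e *\<^sub>R t)) \<bullet> k)) (at x)" by simp
  next
    show "continuous_on (cbox a1 b1) (\<lambda>y. \<eta> y * \<psi> (x - e *\<^sub>R y))" for x by (rule c1)
    show "continuous_on (UNIV \<times> cbox a1 b1) (\<lambda>(x, y). \<eta> y *\<^sub>R d\<psi> (x - e *\<^sub>R y))"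
      unfolding case_prod_beta
      by (intro continuous_intros continuous_on_compose2[OF c\<eta>] continuous_on_compose2[OF \<psi>(2)]) auto
  qed
  have m_lb: "m x = (LINT y|lborel. \<eta> y * \<psi> (x - e *\<^sub>R y))" for x
    unfolding m_def using \<eta>(3) B1 by (intro lborel_integral_cbox(2)[symmetric] c1) auto
  \<comment> \<open>The substitution \<open>z = x - e *\<^sub>R y\<close> gives a second form of
    \<open>m\<close>. In the first form the gradient falls on \<open>\<psi>\<close>, which yields
    convergence of gradients; in this one it falls on the kernel, which yields smoothness.\<close>
  have m_conv: "m x = integral (cbox a2 b2) (\<lambda>z. \<eta> ((1 / e) *\<^sub>R (x - z)) * (\<psi> z / e ^ CARD('n)))" for x
  proof -
    let ?f = "\<lambda>z. \<eta> ((1 / e) *\<^sub>R (x - z)) * (\<psi> z / e ^ CARD('n))"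
    have c: "continuous_on X ?f" for X
      using e(1) by (intro continuous_intros continuous_on_compose2[OF c\<eta>] continuous_on_subset[OF c\<psi>]) auto
    have "(LINT z|lborel. ?f z) = e ^ CARD('n) * (LINT y|lborel. ?f (x - e *\<^sub>R y))"
      using c e(1) by (intro lborel_integral_reflect_scale borel_measurable_continuous_onI)
    also have "\<dots> = e ^ CARD('n) * (LINT y|lborel. \<eta> y * \<psi> (x - e *\<^sub>R y) / e ^ CARD('n))"
      using e(1) by simp
    also have "\<dots> = m x" using e(1) unfolding m_lb by simp
    finally show ?thesis using A(3) B2 by (subst lborel_integral_cbox(2)[symmetric, OF c]) auto
  qed
  have Ck: "Ck_on k UNIV m" for k
    unfolding m_conv[abs_def] using e(1) by (intro Ck_on_convolution \<eta>(1) continuous_intros c\<psi>) auto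
  define K where "K = (\<lambda>p. fst p + e *\<^sub>R snd p) ` (A \<times> A')"
  have "compact K" unfolding K_def
    using A(1) \<eta>(2) by (intro compact_continuous_image compact_Times continuous_intros)
  moreover have "K \<subseteq> \<Omega>"
  proof
    fix x assume "x \<in> K"
    then obtain z y where zy: "z \<in> A" "y \<in> A'" "x = z + e *\<^sub>R y" by (auto simp: K_def)
    then have "dist z x < d3" using small[OF zy(2)] eR(3) by (simp add: dist_norm)
    with d3(2)[OF zy(1), of x] show "x \<in> \<Omega>" by fastforce
  qed
  moreover have "m x = 0" if "x \<notin> K" for x
  proof -
    have z: "\<eta> y * \<psi> (x - e *\<^sub>R y) = 0" for y
    proof (rule ccontr)
      assume "\<not> ?thesis"
      then have "y \<in> A'" "x - e *\<^sub>R y \<in> A" using \<eta>(3) A(3) by auto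
      then have "x \<in> K" unfolding K_def by (intro image_eqI[of _ _ "(x - e *\<^sub>R y, y)"]) auto
      with that show False by simp
    qed
    show ?thesis unfolding m_def z by simp
  qed
  ultimately have tf: "test_function \<Omega> m" unfolding test_function_def using Ck by blast
  have int\<eta>: "integral (cbox a1 b1) \<eta> = 1"
    using lborel_integral_cbox(2)[OF continuous_on_subset[OF c\<eta>], of a1 b1] \<eta>(3,4) B1 by auto
  have io\<eta>: "\<eta> integrable_on cbox a1 b1" using continuous_on_subset[OF c\<eta>] by (intro integrable_continuous) auto
  have approx: "norm (integral (cbox a1 b1) (\<lambda>y. \<eta> y *\<^sub>R f (x - e *\<^sub>R y)) - f x) \<le> \<delta>"
    if cf: "continuous_on UNIV f" and f: "\<And>y. y \<in> A' \<Longrightarrow> norm (f (x - e *\<^sub>R y) - f x) \<le> \<kappa>" for f :: "real^'n \<Rightarrow> 'b::euclidean_space" and x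
  proof -
    have "continuous_on (cbox a1 b1) (\<lambda>y. \<eta> y *\<^sub>R f (x - e *\<^sub>R y))"
      by (intro continuous_intros continuous_on_subset[OF c\<eta>] continuous_on_compose2[OF cf]) auto
    then have i1: "(\<lambda>y. \<eta> y *\<^sub>R f (x - e *\<^sub>R y)) integrable_on cbox a1 b1" by (rule integrable_continuous)
    have "((\<lambda>y. \<eta> y *\<^sub>R f x) has_integral 1 *\<^sub>R f x) (cbox a1 b1)"
      using has_integral_linear[OF integrable_integral[OF io\<eta>] bounded_linear_scaleR_left[of "f x"]] by (simp add: int\<eta> o_def)
    from has_integral_diff[OF integrable_integral[OF i1] this]
    have hi: "((\<lambda>y. \<eta> y *\<^sub>R f (x - e *\<^sub>R y) - \<eta> y *\<^sub>R f x) has_integral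
        integral (cbox a1 b1) (\<lambda>y. \<eta> y *\<^sub>R f (x - e *\<^sub>R y)) - f x) (cbox a1 b1)" by simp
    have "norm (integral (cbox a1 b1) (\<lambda>y. \<eta> y *\<^sub>R f (x - e *\<^sub>R y)) - f x) \<le> E * \<kappa> * measure lborel (cbox a1 b1)"
    proof (rule has_integral_bound[OF _ hi])
      show "0 \<le> E * \<kappa>" using E(1) \<kappa>0 by simp
      fix y assume y: "y \<in> cbox a1 b1"
      show "norm (\<eta> y *\<^sub>R f (x - e *\<^sub>R y) - \<eta> y *\<^sub>R f x) \<le> E * \<kappa>"
      proof (cases "y \<in> A'")
        case True
        have "norm (\<eta> y *\<^sub>R f (x - e *\<^sub>R y) - \<eta> y *\<^sub>R f x) = \<bar>\<eta> y\<bar> * norm (f (x - e *\<^sub>R y) - f x)"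
          by (simp add: scaleR_diff_right[symmetric])
        also have "\<dots> \<le> E * \<kappa>" using E y f[OF True] by (intro mult_mono) auto
        finally show ?thesis .
      next
        case False then show ?thesis using \<eta>(3) E(1) \<kappa>0 by simp
      qed
    qed
    with \<kappa> show ?thesis by linarith
  qed
  have Kc: "x \<in> ?Kc" "x - e *\<^sub>R y \<in> ?Kc" "dist (x - e *\<^sub>R y) x \<le> e * R1" if "x \<in> \<Omega>" "y \<in> A'" for x y
  proof -
    have "e * R1 \<le> R1" using e R1(1) by simp
    then have "norm x \<le> R0 + R1" "norm (x - e *\<^sub>R y) \<le> R0 + R1"
      using R0[OF that(1)] small[OF that(2)] R1(1) norm_triangle_ineq4[of x "e *\<^sub>R y"] by linarith+
    then show "x \<in> ?Kc" "x - e *\<^sub>R y \<in> ?Kc" by simp_all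
    show "dist (x - e *\<^sub>R y) x \<le> e * R1" using small[OF that(2)] by (simp add: dist_norm)
  qed
  show ?thesis
  proof (rule that[OF tf])
    fix x assume x: "x \<in> \<Omega>"
    have "norm (\<psi> (x - e *\<^sub>R y) - \<psi> x) \<le> \<kappa>" if "y \<in> A'" for y
      using d1(2)[OF Kc(1,2)[OF x that]] Kc(3)[OF x that] eR(1) by (simp add: dist_norm)
    from approx[OF c\<psi> this] show "\<bar>m x - \<psi> x\<bar> \<le> \<delta>" by (simp add: m_def)
    have "norm (d\<psi> (x - e *\<^sub>R y) - d\<psi> x) \<le> \<kappa>" if "y \<in> A'" for y
      using d2(2)[OF Kc(1,2)[OF x that]] Kc(3)[OF x that] eR(2) by (simp add: dist_norm)
    from approx[OF \<psi>(2) this] show "norm (grad m x - d\<psi> x) \<le> \<delta>" unfolding grad_eqI[OF der] by simp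
  qed
qed

section \<open>The inequality along the leaves\<close>

lemma tangent_vec_orthogonal: "n $ i \<noteq> 0 \<Longrightarrow> n \<bullet> tangent_vec i j n = 0"
  by (simp add: tangent_vec_def inner_diff_right inner_axis)

lemma norm_tangent_vec_le:
  assumes "0 < c" "c \<le> \<bar>n $ i\<bar>" "norm n \<le> C"
  shows "norm (tangent_vec i j n) \<le> 1 + C / c"
proof -
  have "norm (tangent_vec i j n) \<le> norm (axis j 1 :: real^3) + norm ((n $ j / n $ i) *\<^sub>R (axis i 1 :: real^3))"
    unfolding tangent_vec_def by (rule norm_triangle_ineq4)
  also have "\<dots> = 1 + \<bar>n $ j\<bar> / \<bar>n $ i\<bar>" by (simp add: norm_axis_1)
  also have "\<bar>n $ j\<bar> / \<bar>n $ i\<bar> \<le> C / c"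
    using assms component_le_norm_cart[of n j] by (intro frac_le) auto
  finally show ?thesis by simp
qed

text \<open>Being orthogonal to \<open>n\<close>, the vector \<open>d\<close> is the combination of
  the two tangent vectors with its own coordinates as coefficients. If both inner products were at
  most \<open>c / 3\<close>, the square of its norm would be at most two thirds of \<open>c\<close>
  times its norm. Applied to the surface gradient of \<open>g\<close>, this makes a chart derivative
  of \<open>g\<close> large.\<close>

lemma tangent_components_large:
  fixes d n :: "real^3"
  assumes "n $ i \<noteq> 0" "d \<bullet> n = 0" "0 < c" "c \<le> norm d"
  shows "c / 3 < \<bar>d \<bullet> tangent_vec i (i + 1) n\<bar> \<or> c / 3 < \<bar>d \<bullet> tangent_vec i (i + 2) n\<bar>"
proof (rule ccontr)
  let ?b1 = "tangent_vec i (i + 1) n" and ?b2 = "tangent_vec i (i + 2) n"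
  assume "\<not> ?thesis"
  then have le: "\<bar>d \<bullet> ?b1\<bar> \<le> c / 3" "\<bar>d \<bullet> ?b2\<bar> \<le> c / 3" by auto
  have "d \<bullet> n = d $ i * n $ i + d $ (i + 1) * n $ (i + 1) + d $ (i + 2) * n $ (i + 2)"
    using inner_coord[of d i "(n $ i, n $ (i + 1), n $ (i + 2))"] by simp
  with assms have "d $ i = - (d $ (i + 1) * n $ (i + 1) + d $ (i + 2) * n $ (i + 2)) / n $ i"
    by (simp add: field_simps)
  then have "d = d $ (i + 1) *\<^sub>R ?b1 + d $ (i + 2) *\<^sub>R ?b2"
    unfolding vec_eq_iff forall_3_cyclic[of _ i] using assms(1) by (simp add: tangent_vec_def axis_def field_simps)
  then have "d \<bullet> d = d $ (i + 1) * (d \<bullet> ?b1) + d $ (i + 2) * (d \<bullet> ?b2)"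
    by (metis inner_add_right inner_scaleR_right)
  also have "\<dots> \<le> \<bar>d $ (i + 1)\<bar> * \<bar>d \<bullet> ?b1\<bar> + \<bar>d $ (i + 2)\<bar> * \<bar>d \<bullet> ?b2\<bar>"
    by (intro add_mono) (simp_all only: abs_mult[symmetric] abs_ge_self)
  also have "\<dots> \<le> norm d * (c / 3) + norm d * (c / 3)"
    using le component_le_norm_cart[of d] by (intro add_mono mult_mono) auto
  also have "\<dots> < norm d * c"
  proof -
    have "0 < norm d" using assms by linarith
    then show ?thesis using assms(3) by simp
  qed
  also have "\<dots> \<le> norm d * norm d" using assms by (intro mult_left_mono) auto
  finally show False by (simp add: dot_square_norm power2_eq_square)
qed

text \<open>The intermediate value theorem along the leaf from its boundary end, where
  \<open>w\<close> vanishes, to \<open>x\<close>. This is the hypothesis \<open>curve\<close> of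
  \<open>surface_poincare\<close>.\<close>

lemma leaf_values_from_boundary:
  assumes fol: "\<forall>\<Gamma>\<in>components (fol_slice \<Omega> v g t r). \<exists>\<gamma> L. C1_param_from_boundary \<Omega> \<Gamma> \<gamma> L"
    and w: "continuous_on (closure \<Omega>) w" "\<And>x. x \<in> frontier \<Omega> \<Longrightarrow> w x = (0::real)"
    and x: "x \<in> \<Omega>" "v x = t" "g t x = r"
    and \<tau>: "0 < \<tau> \<and> \<tau> < w x \<or> w x < \<tau> \<and> \<tau> < 0"
  shows "\<tau> \<in> w ` {y\<in>{x\<in>\<Omega>. v x = t}. g t y = r}"
proof -
  let ?\<Gamma> = "connected_component_set (fol_slice \<Omega> v g t r) x"
  have xs: "x \<in> fol_slice \<Omega> v g t r" using x by (simp add: fol_slice_def)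
  then have "?\<Gamma> \<in> components (fol_slice \<Omega> v g t r)" by (auto simp: components_def)
  then obtain \<gamma> L where "C1_param_from_boundary \<Omega> ?\<Gamma> \<gamma> L" using fol by blast
  then have \<gamma>: "continuous_on {0..L} \<gamma>" "\<gamma> ` {0<..<L} = ?\<Gamma>" "\<gamma> 0 \<in> frontier \<Omega>" "0 < L"
    by (auto simp: C1_param_from_boundary_def)
  have "x \<in> ?\<Gamma>" using xs by simp
  then obtain s where s: "0 < s" "s < L" "\<gamma> s = x" using \<gamma>(2) by (metis greaterThanLessThan_iff imageE)
  have sl: "?\<Gamma> \<subseteq> fol_slice \<Omega> v g t r" by (rule connected_component_subset)
  have in_cl: "\<gamma> ` {0..s} \<subseteq> closure \<Omega>"
  proof (rule image_subsetI)
    fix s' assume "s' \<in> {0..s}"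
    show "\<gamma> s' \<in> closure \<Omega>"
    proof (cases "s' = 0")
      case True then show ?thesis using \<gamma>(3) by (simp add: frontier_def)
    next
      case False
      then have "\<gamma> s' \<in> ?\<Gamma>" using \<gamma>(2) s \<open>s' \<in> {0..s}\<close> by auto
      then show ?thesis using sl closure_subset by (auto simp: fol_slice_def)
    qed
  qed
  have "continuous_on {0..s} (\<lambda>s. w (\<gamma> s))"
    using s by (intro continuous_on_compose2[OF w(1) continuous_on_subset[OF \<gamma>(1)] in_cl]) auto
  moreover have "w (\<gamma> 0) = 0" using w(2)[OF \<gamma>(3)] .
  ultimately have "\<exists>s'\<ge>0. s' \<le> s \<and> w (\<gamma> s') = \<tau>"
    using IVT'[of "\<lambda>s. w (\<gamma> s)" 0 \<tau> s] IVT2'[of "\<lambda>s. w (\<gamma> s)" s \<tau> 0] s \<tau> by auto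
  then obtain s' where s': "0 \<le> s'" "s' \<le> s" "w (\<gamma> s') = \<tau>" by auto
  \<comment> \<open>A nonzero value is not attained at the boundary end, so the point found lies on
    the leaf itself.\<close>
  then have "s' \<noteq> 0" using \<tau> \<open>w (\<gamma> 0) = 0\<close> by auto
  then have "\<gamma> s' \<in> ?\<Gamma>" using s' s \<gamma>(2) by (metis greaterThanLessThan_iff imageI le_less_trans less_eq_real_def)
  then have "\<gamma> s' \<in> fol_slice \<Omega> v g t r" using sl by blast
  then show ?thesis using s'(3) by (auto simp: fol_slice_def)
qed

lemma local_level_charts:
  fixes v :: "real^3 \<Rightarrow> real"
  assumes "open \<Omega>" "0 < c"
    and v: "\<And>x. x \<in> \<Omega> \<Longrightarrow> (v has_derivative (\<lambda>k. p x \<bullet> k)) (at x)"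
    and p: "continuous_on \<Omega> p" "\<And>x. x \<in> \<Omega> \<Longrightarrow> c \<le> norm (p x)" "\<And>x. x \<in> \<Omega> \<Longrightarrow> norm (p x) \<le> C"
    and x: "x \<in> \<Omega>"
  shows "\<exists>U i \<rho> V. x \<in> U \<and> U \<subseteq> \<Omega> \<and> level_charts v p (c / 2) C i U \<rho> V"
proof -
  obtain i where i: "c / 2 < \<bar>p x $ i\<bar>" using exists_large_component[OF \<open>0 < c\<close> p(2)[OF x]] by blast
  define e where "e = sgn (p x $ i)"
  have e: "e = 1 \<or> e = -1" and ex: "c / 2 < e * p x $ i"
    using i \<open>0 < c\<close> by (auto simp: e_def sgn_if)
  define V' where "V' = {y\<in>\<Omega>. e * p y $ i \<in> {c / 2<..}}"
  have "open V'"
    unfolding V'_def using \<open>open \<Omega>\<close>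
    by (intro continuous_open_preimage[unfolded vimage_def Int_def Collect_conj_eq[symmetric], simplified])
       (auto intro!: continuous_intros p(1))
  then have "open (coord i -` V')" by (intro open_vimage continuous_on_coord)
  moreover let ?\<xi> = "(x $ i, x $ (i + 1), x $ (i + 2))"
  have "?\<xi> \<in> coord i -` V'" using ex x by (simp add: V'_def)
  ultimately obtain S T where ST: "open S" "open T" "?\<xi> \<in> S \<times> T" "S \<times> T \<subseteq> coord i -` V'"
    by (rule open_prod_elim)
  obtain d where d: "d > 0" "cball (x $ i) d \<subseteq> S" using ST open_contains_cball[of S] by auto
  let ?a = "x $ i - d" and ?b = "x $ i + d"
  have dom: "coord i (s, z) \<in> \<Omega> \<and> c / 2 \<le> e * p (coord i (s, z)) $ i" if "s \<in> {?a..?b}" "z \<in> T" for s z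
  proof -
    have "s \<in> S" using that(1) d(2) by (auto simp: cball_eq_atLeastAtMost)
    then have "coord i (s, z) \<in> V'" using ST(4) that(2) by blast
    then show ?thesis by (simp add: V'_def)
  qed
  have "0 < c / 2" "?a < ?b" using \<open>0 < c\<close> d(1) by auto
  from level_charts_exist[OF this(2) ST(2) this(1) e dom v p(1,3)]
  obtain \<rho> V where LC: "level_charts v p (c / 2) C i (coord i ` ({?a<..<?b} \<times> T)) \<rho> V" by blast
  moreover have "x \<in> coord i ` ({?a<..<?b} \<times> T)"
    using ST(3) d(1) by (intro image_eqI[of _ _ ?\<xi>]) auto
  moreover have "coord i ` ({?a<..<?b} \<times> T) \<subseteq> \<Omega>"
    by (rule image_subsetI) (use dom[of "fst _" "snd _"] in \<open>auto simp: mem_Times_iff\<close>)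
  ultimately show ?thesis by (intro exI conjI)
qed

text \<open>For almost every \<open>t\<close> the inequality on one surface is applied to the level
  set, and both sides are then integrated over \<open>t\<close>: the lower slicing bound recovers
  the integral of \<open>|w|\<close>, the upper one that of \<open>q\<close>. The component of
  \<open>dw\<close> along \<open>p\<close> is normal to the level set and drops out of the Jacobian,
  so only the remainder bounded by \<open>q\<close> counts. The constant \<open>\<beta>\<close>
  bounds the tangent vectors, whose denominators are at least \<open>c / 2\<close>.\<close>

lemma foliated_poincare:
  fixes v w q :: "real^3 \<Rightarrow> real" and p dw :: "real^3 \<Rightarrow> real^3"
  assumes \<Omega>: "open \<Omega>" "bounded \<Omega>" and "0 < c" "0 < cg"
    and v: "\<And>x. x \<in> \<Omega> \<Longrightarrow> (v has_derivative (\<lambda>k. p x \<bullet> k)) (at x)"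
    and p: "continuous_on \<Omega> p" "\<And>x. x \<in> \<Omega> \<Longrightarrow> c \<le> norm (p x)" "\<And>x. x \<in> \<Omega> \<Longrightarrow> norm (p x) \<le> C"
    and w: "\<And>x. x \<in> \<Omega> \<Longrightarrow> (w has_derivative (\<lambda>k. dw x \<bullet> k)) (at x)" "continuous_on \<Omega> dw"
    and w0: "continuous_on (closure \<Omega>) w" "\<And>x. x \<in> frontier \<Omega> \<Longrightarrow> w x = 0"
    and q: "continuous_on \<Omega> q" "\<And>x. x \<in> \<Omega> \<Longrightarrow> \<exists>\<mu> e. dw x = \<mu> *\<^sub>R p x + e \<and> norm e \<le> q x"
    and fol: "foliation \<Omega> v g cg Cg K"
  defines "\<beta> \<equiv> 1 + C / (c / 2)"
  shows "ennreal (cg / 3) * (ennreal (c / 2) * (\<integral>\<^sup>+x. ennreal \<bar>w x\<bar> * indicator \<Omega> x \<partial>lborel))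
    \<le> ennreal K * (ennreal (2 * Cg * \<beta>\<^sup>2) * (ennreal C * (\<integral>\<^sup>+x. ennreal (q x) * indicator \<Omega> x \<partial>lborel)))"
proof (cases "\<Omega> = {}")
  case True then show ?thesis by simp
next
  case ne: False
  let ?F = "{U. U \<subseteq> \<Omega> \<and> (\<exists>f. level_charts v p (c / 2) C (fst f) U (fst (snd f)) (snd (snd f)))}"
  have oF: "open U" if "U \<in> ?F" for U using that unfolding level_charts_def by blast
  obtain F where F: "F \<subseteq> ?F" "countable F" "\<Union>F = \<Union>?F" by (rule Lindelof[of ?F, OF oF])
  have "\<Union>?F = \<Omega>"
  proof
    show "\<Union>?F \<subseteq> \<Omega>" by (rule Union_least) simp
    show "\<Omega> \<subseteq> \<Union>?F"
    proof
      fix x assume "x \<in> \<Omega>"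
      then have "\<exists>U i \<rho> V. x \<in> U \<and> U \<subseteq> \<Omega> \<and> level_charts v p (c / 2) C i U \<rho> V"
        by (rule local_level_charts[OF \<Omega>(1) \<open>0 < c\<close> v p, rotated 3])
      then obtain U i \<rho> V where U: "x \<in> U" "U \<subseteq> \<Omega>" "level_charts v p (c / 2) C i U \<rho> V" by (elim exE conjE)
      have "U \<in> ?F" using U(2,3) by (intro CollectI conjI exI[of _ "(i, \<rho>, V)"]) simp_all
      with U(1) show "x \<in> \<Union>?F" by (rule UnionI[rotated])
    qed
  qed
  with F(3) have UF: "\<Union>F = \<Omega>" by simp
  with ne have Fne: "F \<noteq> {}" by auto
  define U where "U = from_nat_into F"
  have rU: "range U = F" unfolding U_def using Fne F(2) by (rule range_from_nat_into)
  have UF': "U n \<in> ?F" for n using subsetD[OF F(1)] rangeI[of U n] unfolding rU .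
  then have "\<forall>n. \<exists>f. level_charts v p (c / 2) C (fst f) (U n) (fst (snd f)) (snd (snd f))" by simp
  from choice[OF this] obtain f where f: "\<forall>n. level_charts v p (c / 2) C (fst (f n)) (U n) (fst (snd (f n))) (snd (snd (f n)))" ..
  define i where "i n = fst (f n)" for n
  define \<rho> where "\<rho> n = fst (snd (f n))" for n
  define V where "V n = snd (snd (f n))" for n
  have LC: "level_charts v p (c / 2) C (i n) (U n) (\<rho> n) (V n)" for n
    unfolding i_def \<rho>_def V_def using f ..
  note L = LC[unfolded level_charts_def]
  have U: "open (U n)" for n using L[of n] by (rule conjunct1)
  have Ub: "(\<Union>n. U n) = \<Omega>" using rU UF by simp
  have U\<Omega>: "U n \<subseteq> \<Omega>" for n using UF'[of n] by simp
  have V: "open (V n t)" for n t using L[of n, THEN conjunct2, THEN conjunct1] by (rule spec)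
  have \<rho>: "\<rho> n t \<zeta> \<in> U n" "v (\<rho> n t \<zeta>) = t" "\<rho> n t \<zeta> $ (i n + 1) = fst \<zeta>" "\<rho> n t \<zeta> $ (i n + 2) = snd \<zeta>"
    if "\<zeta> \<in> V n t" for n t \<zeta>
    using bspec[OF spec[OF L[of n, THEN conjunct2, THEN conjunct2, THEN conjunct1]] that] by simp_all
  have Ux: "c / 2 \<le> \<bar>p x $ i n\<bar>" "(x $ (i n + 1), x $ (i n + 2)) \<in> V n (v x)" "\<rho> n (v x) (x $ (i n + 1), x $ (i n + 2)) = x"
    if "x \<in> U n" for n x
    using bspec[OF L[of n, THEN conjunct2, THEN conjunct2, THEN conjunct2, THEN conjunct1] that] by simp_all
  note L5 = L[THEN conjunct2, THEN conjunct2, THEN conjunct2, THEN conjunct2]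
  have c\<rho>: "continuous_on (V n t) (\<rho> n t)" for n t using L5[of n, THEN conjunct1] by (rule spec)
  have d\<rho>: "(\<rho> n t has_derivative (\<lambda>k. fst k *\<^sub>R tangent_vec (i n) (i n + 1) (p (\<rho> n t \<zeta>))
        + snd k *\<^sub>R tangent_vec (i n) (i n + 2) (p (\<rho> n t \<zeta>)))) (at \<zeta>)" if "\<zeta> \<in> V n t" for n t \<zeta>
    by (rule bspec[OF spec[OF L5[of n, THEN conjunct2, THEN conjunct1]] that])
  note L7 = L5[THEN conjunct2, THEN conjunct2]
  \<comment> \<open>Charts overlap; disjoint Borel pieces make the integrals over the charts add up
    to the integral over \<open>\<Omega>\<close>.\<close>
  define B where "B = disjointed U"
  have BU: "B n \<subseteq> U n" for n unfolding B_def by (rule disjointed_subset)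
  have Bb[measurable]: "B n \<in> sets borel" for n
    unfolding B_def disjointed_def using U by (intro sets.Diff sets.finite_UN) auto
  have Bun: "(\<Union>n. B n) = \<Omega>" unfolding B_def UN_disjointed_eq Ub ..
  have Bd: "disjoint_family B" unfolding B_def by (rule disjoint_family_disjointed)
  define A where "A n t = {\<zeta>\<in>V n t. \<rho> n t \<zeta> \<in> B n}" for n t
  have Ab: "A n t \<in> sets borel" for n t
    unfolding A_def by (rule spec[OF bspec[OF L7[of n, THEN conjunct1] Bb]])
  have int: "(\<lambda>t. \<integral>\<^sup>+\<zeta>. \<phi> (\<rho> n t \<zeta>) * indicator (A n t) \<zeta> \<partial>lborel) \<in> borel_measurable lborel"
      "ennreal (c / 2) * (\<integral>\<^sup>+x. \<phi> x * indicator (B n) x \<partial>lborel)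
          \<le> (\<integral>\<^sup>+t. \<integral>\<^sup>+\<zeta>. \<phi> (\<rho> n t \<zeta>) * indicator (A n t) \<zeta> \<partial>lborel \<partial>lborel)"
      "(\<integral>\<^sup>+t. \<integral>\<^sup>+\<zeta>. \<phi> (\<rho> n t \<zeta>) * indicator (A n t) \<zeta> \<partial>lborel \<partial>lborel)
          \<le> ennreal C * (\<integral>\<^sup>+x. \<phi> x * indicator (B n) x \<partial>lborel)"
    if "\<phi> \<in> borel_measurable borel" for \<phi> n
    using bspec[OF bspec[OF L7[of n, THEN conjunct2] Bb, THEN mp, OF BU] that] unfolding A_def by simp_all
  \<comment> \<open>Extension by zero makes the integrands Borel on the whole space, as the slicing
    formula requires.\<close>
  define w\<Omega> where "w\<Omega> x = ennreal \<bar>w x\<bar> * indicator \<Omega> x" for x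
  define q\<Omega> where "q\<Omega> x = ennreal (q x) * indicator \<Omega> x" for x
  have cw: "continuous_on \<Omega> w" using w0(1) closure_subset by (rule continuous_on_subset)
  have mw: "w\<Omega> \<in> borel_measurable borel"
    unfolding w\<Omega>_def by (rule borel_measurable_comp_open[OF \<Omega>(1) cw]) simp
  have mq: "q\<Omega> \<in> borel_measurable borel"
    unfolding q\<Omega>_def by (rule borel_measurable_comp_open[OF \<Omega>(1) q(1)]) simp
  define a where "a n t = (\<integral>\<^sup>+\<zeta>. w\<Omega> (\<rho> n t \<zeta>) * indicator (A n t) \<zeta> \<partial>lborel)" for n t
  define b where "b n t = (\<integral>\<^sup>+\<zeta>. q\<Omega> (\<rho> n t \<zeta>) * indicator (A n t) \<zeta> \<partial>lborel)" for n t
  have ma[measurable]: "a n \<in> borel_measurable lborel" and mb[measurable]: "b n \<in> borel_measurable lborel" for n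
    unfolding a_def b_def by (rule int(1)[OF mw], rule int(1)[OF mq])
  \<comment> \<open>The Jacobian is a difference of two products, each at most
    \<open>Cg * \<beta>\<close> (derivative of \<open>g\<close>) times \<open>\<beta>\<close> times
    \<open>q\<close> (derivative of \<open>w\<close>).\<close>
  let ?Cq = "2 * Cg * \<beta>\<^sup>2"
  have \<rho>\<Omega>: "\<rho> n t \<zeta> \<in> \<Omega>" if "\<zeta> \<in> V n t" for n t \<zeta> using \<rho>(1)[OF that] U\<Omega> by blast
  have good: "ennreal (cg / 3) * (\<Sum>n. a n t) \<le> ennreal K * (ennreal ?Cq * (\<Sum>n. b n t))"
    if t: "t \<in> v ` \<Omega>"
      and D: "C1_on_level_set \<Omega> v t (g t) D" "\<forall>x\<in>\<Omega>. v x = t \<longrightarrow> cg \<le> norm (D x) \<and> norm (D x) \<le> Cg"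
      and leaves: "AE r in lebesgue. \<forall>\<Gamma>\<in>components (fol_slice \<Omega> v g t r). \<exists>\<gamma> L. C1_param_from_boundary \<Omega> \<Gamma> \<gamma> L"
      and H: "\<forall>r. hausdorff1 (fol_slice \<Omega> v g t r) \<le> ennreal K" for t D
  proof -
    let ?S = "{x\<in>\<Omega>. v x = t}"
    let ?b1 = "\<lambda>n \<zeta>. tangent_vec (i n) (i n + 1) (p (\<rho> n t \<zeta>))"
    let ?b2 = "\<lambda>n \<zeta>. tangent_vec (i n) (i n + 2) (p (\<rho> n t \<zeta>))"
    have \<rho>S: "\<rho> n t \<zeta> \<in> ?S" if "\<zeta> \<in> V n t" for n \<zeta> using \<rho>(2)[OF that] \<rho>\<Omega>[OF that] by simp
    have p0: "c / 2 \<le> \<bar>p (\<rho> n t \<zeta>) $ i n\<bar>" if "\<zeta> \<in> V n t" for n \<zeta> using Ux(1)[OF \<rho>(1)[OF that]] .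
    have p0': "p (\<rho> n t \<zeta>) $ i n \<noteq> 0" if "\<zeta> \<in> V n t" for n \<zeta> using p0[OF that] \<open>0 < c\<close> by auto
    have Dx: "D x \<bullet> p x = 0" "(g t has_derivative (\<lambda>h. D x \<bullet> h)) (at x within ?S)" if "x \<in> ?S" for x
      using D(1) that grad_eqI[OF v, of x] by (auto simp: C1_on_level_set_def)
    have cD: "continuous_on ?S D" using D(1) by (simp add: C1_on_level_set_def)
    have cp: "continuous_on (V n t) (\<lambda>\<zeta>. p (\<rho> n t \<zeta>))" for n
      using \<rho>\<Omega> by (intro continuous_on_compose2[OF p(1) c\<rho>]) auto
    have cb: "continuous_on (V n t) (\<lambda>\<zeta>. tangent_vec (i n) j (p (\<rho> n t \<zeta>)))" for n j
      unfolding tangent_vec_def using p0' by (intro continuous_intros cp) auto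
    have cD': "continuous_on (V n t) (\<lambda>\<zeta>. D (\<rho> n t \<zeta>))" for n
      using \<rho>S by (intro continuous_on_compose2[OF cD c\<rho>]) auto
    have cdw: "continuous_on (V n t) (\<lambda>\<zeta>. dw (\<rho> n t \<zeta>))" for n
      using \<rho>\<Omega> by (intro continuous_on_compose2[OF w(2) c\<rho>]) auto
    have main: "ennreal (cg / 3) * (\<Sum>n. \<integral>\<^sup>+\<zeta>. ennreal \<bar>w (\<rho> n t \<zeta>)\<bar> * indicator (A n t) \<zeta> \<partial>lborel)
      \<le> ennreal K * (\<Sum>n. \<integral>\<^sup>+\<zeta>. ennreal ?Cq * q\<Omega> (\<rho> n t \<zeta>) * indicator (A n t) \<zeta> \<partial>lborel)"
    proof (rule surface_poincare[where V = "\<lambda>n. V n t" and S = ?S and g = "g t" and \<rho> = "\<lambda>n. \<rho> n t"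
          and ?e1.0 = "\<lambda>n. axis (i n + 1) 1" and ?e2.0 = "\<lambda>n. axis (i n + 2) 1"
          and ?G1.0 = "\<lambda>n \<zeta>. D (\<rho> n t \<zeta>) \<bullet> ?b1 n \<zeta>" and ?G2.0 = "\<lambda>n \<zeta>. D (\<rho> n t \<zeta>) \<bullet> ?b2 n \<zeta>"
          and ?W1.0 = "\<lambda>n \<zeta>. dw (\<rho> n t \<zeta>) \<bullet> ?b1 n \<zeta>" and ?W2.0 = "\<lambda>n \<zeta>. dw (\<rho> n t \<zeta>) \<bullet> ?b2 n \<zeta>"])
      show "open (V n t)" "A n t \<in> sets borel" "continuous_on (V n t) (\<rho> n t)" for n by (rule V Ab c\<rho>)+
      show "0 < cg / 3" using \<open>0 < cg\<close> by simp
      show "A n t \<subseteq> V n t" for n by (auto simp: A_def)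
      show "bounded (A n t)" for n
      proof (rule bounded_subset)
        show "bounded ((\<lambda>x. (x $ (i n + 1), x $ (i n + 2))) ` \<Omega>)"
          using \<Omega>(2) by (rule bounded_linear_image) (intro bounded_linear_Pair bounded_linear_vec_nth)
        show "A n t \<subseteq> (\<lambda>x. (x $ (i n + 1), x $ (i n + 2))) ` \<Omega>"
        proof
          fix \<zeta> assume "\<zeta> \<in> A n t"
          then have "\<zeta> \<in> V n t" by (simp add: A_def)
          then show "\<zeta> \<in> (\<lambda>x. (x $ (i n + 1), x $ (i n + 2))) ` \<Omega>"
            using \<rho>(3,4) \<rho>\<Omega> by (intro image_eqI[of _ _ "\<rho> n t \<zeta>"]) (simp_all add: prod_eq_iff)
        qed
      qed
      show "\<rho> n t \<zeta> \<bullet> axis (i n + 1) 1 = fst \<zeta>" "\<rho> n t \<zeta> \<bullet> axis (i n + 2) 1 = snd \<zeta>" if "\<zeta> \<in> V n t" for n \<zeta>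
        using \<rho>(3,4)[OF that] by (simp_all add: inner_axis)
      show "norm (axis (i n + 1) 1 :: real^3) = 1" "norm (axis (i n + 2) 1 :: real^3) = 1" for n
        by (rule norm_axis_1)+
      show "\<rho> m t ` A m t \<inter> \<rho> n t ` A n t = {}" if "m \<noteq> n" for m n
      proof -
        have "\<rho> n t ` A n t \<subseteq> B n" for n by (auto simp: A_def)
        from Int_mono[OF this[of m] this[of n]] that show ?thesis
          using Bd unfolding disjoint_family_on_def by (metis UNIV_I subset_empty)
      qed
      show "(\<Union>n. \<rho> n t ` A n t) = ?S"
      proof (intro set_eqI iffI)
        fix x assume "x \<in> (\<Union>n. \<rho> n t ` A n t)"
        then obtain n \<zeta> where "\<zeta> \<in> A n t" "x = \<rho> n t \<zeta>" by blast
        then show "x \<in> ?S" using \<rho>S[of \<zeta> n] by (simp add: A_def)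
      next
        fix x assume x: "x \<in> ?S"
        then obtain n where n: "x \<in> B n" using Bun by auto
        then have "x \<in> U n" using BU by auto
        from Ux(2,3)[OF this] have "(x $ (i n + 1), x $ (i n + 2)) \<in> A n t" "x = \<rho> n t (x $ (i n + 1), x $ (i n + 2))"
          using x n by (simp_all add: A_def)
        then show "x \<in> (\<Union>n. \<rho> n t ` A n t)" by blast
      qed
      show "((\<lambda>\<zeta>. g t (\<rho> n t \<zeta>)) has_derivative
          (\<lambda>k. (D (\<rho> n t \<zeta>) \<bullet> ?b1 n \<zeta>) * fst k + (D (\<rho> n t \<zeta>) \<bullet> ?b2 n \<zeta>) * snd k)) (at \<zeta>)"
        if z: "\<zeta> \<in> V n t" for n \<zeta>
      proof -
        \<comment> \<open>Since \<open>g t\<close> is differentiable only within the level set, the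
          chain rule needs the chart to take its values there; openness of the parameter domain then
          removes the restriction.\<close>
        have "\<rho> n t ` V n t \<subseteq> ?S" using \<rho>S by blast
        from has_derivative_in_compose2[OF Dx(2) this z has_derivative_at_withinI[OF d\<rho>[OF z]]]
        have "((\<lambda>\<zeta>. g t (\<rho> n t \<zeta>)) has_derivative (\<lambda>k. D (\<rho> n t \<zeta>) \<bullet> (fst k *\<^sub>R ?b1 n \<zeta> + snd k *\<^sub>R ?b2 n \<zeta>))) (at \<zeta> within V n t)"
          by simp
        then show ?thesis using at_within_open[OF z V] by (simp add: inner_add_right mult.commute)
      qed
      show "((\<lambda>\<zeta>. w (\<rho> n t \<zeta>)) has_derivative
          (\<lambda>k. (dw (\<rho> n t \<zeta>) \<bullet> ?b1 n \<zeta>) * fst k + (dw (\<rho> n t \<zeta>) \<bullet> ?b2 n \<zeta>) * snd k)) (at \<zeta>)"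
        if z: "\<zeta> \<in> V n t" for n \<zeta>
        using has_derivative_compose[OF d\<rho>[OF z] w(1)[OF \<rho>\<Omega>[OF z]]] by (simp add: inner_add_right mult.commute)
      show "continuous_on (V n t) (\<lambda>\<zeta>. D (\<rho> n t \<zeta>) \<bullet> ?b1 n \<zeta>)" "continuous_on (V n t) (\<lambda>\<zeta>. D (\<rho> n t \<zeta>) \<bullet> ?b2 n \<zeta>)"
        "continuous_on (V n t) (\<lambda>\<zeta>. dw (\<rho> n t \<zeta>) \<bullet> ?b1 n \<zeta>)" "continuous_on (V n t) (\<lambda>\<zeta>. dw (\<rho> n t \<zeta>) \<bullet> ?b2 n \<zeta>)" for n
        by (intro continuous_on_inner cD' cdw cb)+
      show "cg / 3 < \<bar>D (\<rho> n t \<zeta>) \<bullet> ?b1 n \<zeta>\<bar> \<or> cg / 3 < \<bar>D (\<rho> n t \<zeta>) \<bullet> ?b2 n \<zeta>\<bar>" if z: "\<zeta> \<in> V n t" for n \<zeta>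
        using \<rho>S[OF z] D(2) Dx(1)[OF \<rho>S[OF z]] \<open>0 < cg\<close> by (intro tangent_components_large p0'[OF z]) auto
      show "ennreal \<bar>D (\<rho> n t \<zeta>) \<bullet> ?b1 n \<zeta> * (dw (\<rho> n t \<zeta>) \<bullet> ?b2 n \<zeta>) - D (\<rho> n t \<zeta>) \<bullet> ?b2 n \<zeta> * (dw (\<rho> n t \<zeta>) \<bullet> ?b1 n \<zeta>)\<bar>
          \<le> ennreal ?Cq * q\<Omega> (\<rho> n t \<zeta>)" if "\<zeta> \<in> A n t" for n \<zeta>
      proof -
        have z: "\<zeta> \<in> V n t" using that by (simp add: A_def)
        let ?x = "\<rho> n t \<zeta>"
        obtain \<mu> e where e: "dw ?x = \<mu> *\<^sub>R p ?x + e" "norm e \<le> q ?x" using q(2)[OF \<rho>\<Omega>[OF z]] by blast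
        \<comment> \<open>Tangent vectors annihilate the multiple of \<open>p\<close>, so its
          coefficient \<open>\<mu>\<close> needs no bound.\<close>
        have dwe: "dw ?x \<bullet> tangent_vec (i n) j (p ?x) = e \<bullet> tangent_vec (i n) j (p ?x)" for j
          unfolding e(1) using tangent_vec_orthogonal[OF p0'[OF z]] by (simp add: inner_add_left)
        have nb: "norm (tangent_vec (i n) j (p ?x)) \<le> \<beta>" for j
          unfolding \<beta>_def using \<open>0 < c\<close> p0[OF z] p(3)[OF \<rho>\<Omega>[OF z]] by (intro norm_tangent_vec_le) auto
        have Dn: "norm (D ?x) \<le> Cg" "0 \<le> Cg" using D(2) \<rho>S[OF z] \<open>0 < cg\<close> by force+
        have qn: "0 \<le> q ?x" using e(2) norm_ge_zero[of e] by linarith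
        have \<beta>0: "0 \<le> \<beta>" using nb[of 0] norm_ge_zero[of "tangent_vec (i n) 0 (p ?x)"] by linarith
        have prod: "\<bar>D ?x \<bullet> tangent_vec (i n) j (p ?x) * (e \<bullet> tangent_vec (i n) k (p ?x))\<bar> \<le> (Cg * \<beta>) * (q ?x * \<beta>)" for j k
        proof -
          have "\<bar>D ?x \<bullet> tangent_vec (i n) j (p ?x)\<bar> \<le> Cg * \<beta>"
            by (rule order_trans[OF Cauchy_Schwarz_ineq2]) (intro mult_mono Dn nb norm_ge_zero)
          moreover have "\<bar>e \<bullet> tangent_vec (i n) k (p ?x)\<bar> \<le> q ?x * \<beta>"
            by (rule order_trans[OF Cauchy_Schwarz_ineq2]) (intro mult_mono e(2) nb norm_ge_zero qn)
          ultimately show ?thesis unfolding abs_mult using Dn(2) \<beta>0 by (intro mult_mono) auto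
        qed
        have "\<bar>D ?x \<bullet> ?b1 n \<zeta> * (dw ?x \<bullet> ?b2 n \<zeta>) - D ?x \<bullet> ?b2 n \<zeta> * (dw ?x \<bullet> ?b1 n \<zeta>)\<bar>
          \<le> (Cg * \<beta>) * (q ?x * \<beta>) + (Cg * \<beta>) * (q ?x * \<beta>)"
          unfolding dwe by (rule order_trans[OF abs_triangle_ineq4 add_mono[OF prod prod]])
        also have "\<dots> = ?Cq * q ?x" by (simp add: power2_eq_square)
        finally have le: "\<bar>D ?x \<bullet> ?b1 n \<zeta> * (dw ?x \<bullet> ?b2 n \<zeta>) - D ?x \<bullet> ?b2 n \<zeta> * (dw ?x \<bullet> ?b1 n \<zeta>)\<bar> \<le> ?Cq * q ?x" .
        have "ennreal (?Cq * q ?x) = ennreal ?Cq * q\<Omega> ?x"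
          unfolding q\<Omega>_def using \<rho>\<Omega>[OF z] Dn(2) qn by (subst ennreal_mult) simp_all
        then show ?thesis using ennreal_leI[OF le] by simp
      qed
      show "hausdorff1 {x \<in> ?S. g t x = r} \<le> ennreal K" for r
        using H by (simp add: fol_slice_def conj_assoc)
      have "AE r in lborel. \<forall>\<Gamma>\<in>components (fol_slice \<Omega> v g t r). \<exists>\<gamma> L. C1_param_from_boundary \<Omega> \<Gamma> \<gamma> L"
        using leaves by (subst (asm) AE_completion_iff)
      then show "AE r in lborel. \<forall>x\<in>?S. g t x = r \<longrightarrow>
          (\<forall>\<tau>. 0 < \<tau> \<and> \<tau> < w x \<or> w x < \<tau> \<and> \<tau> < 0 \<longrightarrow> \<tau> \<in> w ` {y \<in> ?S. g t y = r})"
      proof (rule AE_mp, intro AE_I2 impI ballI allI)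
        fix r x \<tau> assume "\<forall>\<Gamma>\<in>components (fol_slice \<Omega> v g t r). \<exists>\<gamma> L. C1_param_from_boundary \<Omega> \<Gamma> \<gamma> L"
          "x \<in> ?S" "g t x = r" "0 < \<tau> \<and> \<tau> < w x \<or> w x < \<tau> \<and> \<tau> < 0"
        then show "\<tau> \<in> w ` {y \<in> ?S. g t y = r}"
          by (intro leaf_values_from_boundary[OF _ w0]) simp_all
      qed
    qed
    have "a n t = (\<integral>\<^sup>+\<zeta>. ennreal \<bar>w (\<rho> n t \<zeta>)\<bar> * indicator (A n t) \<zeta> \<partial>lborel)" for n
      unfolding a_def w\<Omega>_def by (intro nn_integral_cong) (simp add: indicator_def A_def \<rho>\<Omega>)
    moreover have "(\<integral>\<^sup>+\<zeta>. ennreal ?Cq * q\<Omega> (\<rho> n t \<zeta>) * indicator (A n t) \<zeta> \<partial>lborel) = ennreal ?Cq * b n t" for n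
    proof -
      have "(\<lambda>\<zeta>. q\<Omega> (\<rho> n t \<zeta>) * indicator (V n t) \<zeta> * indicator (A n t) \<zeta>) \<in> borel_measurable borel"
        using borel_measurable_comp_open[OF V c\<rho> mq] Ab by measurable
      moreover have "(\<lambda>\<zeta>. q\<Omega> (\<rho> n t \<zeta>) * indicator (V n t) \<zeta> * indicator (A n t) \<zeta>) = (\<lambda>\<zeta>. q\<Omega> (\<rho> n t \<zeta>) * indicator (A n t) \<zeta>)"
        by (auto simp: fun_eq_iff indicator_def A_def)
      ultimately show ?thesis unfolding b_def mult.assoc by (intro nn_integral_cmult) simp
    qed
    ultimately show ?thesis using main by simp
  qed
  have AEt: "AE t in lborel. ennreal (cg / 3) * (\<Sum>n. a n t) \<le> ennreal K * (ennreal ?Cq * (\<Sum>n. b n t))"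
    using fol unfolding foliation_def AE_completion_iff
  proof (rule AE_mp, intro AE_I2 impI)
    fix t assume *: "t \<in> v ` \<Omega> \<longrightarrow>
        (\<exists>D. C1_on_level_set \<Omega> v t (g t) D \<and> (\<forall>x\<in>\<Omega>. v x = t \<longrightarrow> cg \<le> norm (D x) \<and> norm (D x) \<le> Cg)) \<and>
        (AE r in lborel. \<forall>\<Gamma>\<in>components (fol_slice \<Omega> v g t r). \<exists>\<gamma> L. C1_param_from_boundary \<Omega> \<Gamma> \<gamma> L) \<and>
        (\<forall>r. hausdorff1 (fol_slice \<Omega> v g t r) \<le> ennreal K)"
    show "ennreal (cg / 3) * (\<Sum>n. a n t) \<le> ennreal K * (ennreal ?Cq * (\<Sum>n. b n t))"
    proof (cases "t \<in> v ` \<Omega>")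
      case True
      with * obtain D where D: "C1_on_level_set \<Omega> v t (g t) D" "\<forall>x\<in>\<Omega>. v x = t \<longrightarrow> cg \<le> norm (D x) \<and> norm (D x) \<le> Cg"
        and lv: "AE r in lborel. \<forall>\<Gamma>\<in>components (fol_slice \<Omega> v g t r). \<exists>\<gamma> L. C1_param_from_boundary \<Omega> \<Gamma> \<gamma> L"
        and H: "\<forall>r. hausdorff1 (fol_slice \<Omega> v g t r) \<le> ennreal K" by (elim impE conjE exE)
      show ?thesis by (rule good[OF True D _ H]) (simp only: AE_completion_iff lv)
    next
      case False
      \<comment> \<open>For a value \<open>t\<close> that is not taken by \<open>v\<close> every
        chart domain is empty and the left-hand side vanishes.\<close>
      have "V n t = {}" for n using False \<rho>(2) \<rho>\<Omega> by (metis equals0I imageI)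
      then have "a n t = 0" for n by (simp add: a_def A_def)
      then show ?thesis by simp
    qed
  qed
  have split: "(\<integral>\<^sup>+x. \<phi> x * indicator \<Omega> x \<partial>lborel) = (\<Sum>n. \<integral>\<^sup>+x. \<phi> x * indicator (B n) x \<partial>lborel)"
    if "\<phi> \<in> borel_measurable borel" for \<phi>
    unfolding Bun[symmetric] using that Bd by (intro nn_integral_disjoint_family) auto
  have abs: "w\<Omega> x * indicator \<Omega> x = ennreal \<bar>w x\<bar> * indicator \<Omega> x" "q\<Omega> x * indicator \<Omega> x = ennreal (q x) * indicator \<Omega> x" for x
    by (simp_all add: w\<Omega>_def q\<Omega>_def indicator_def)
  have "ennreal (c / 2) * (\<integral>\<^sup>+x. ennreal \<bar>w x\<bar> * indicator \<Omega> x \<partial>lborel) = (\<Sum>n. ennreal (c / 2) * (\<integral>\<^sup>+x. w\<Omega> x * indicator (B n) x \<partial>lborel))"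
    using split[OF mw] unfolding abs by (simp only: ennreal_suminf_cmult)
  also have "\<dots> \<le> (\<Sum>n. \<integral>\<^sup>+t. a n t \<partial>lborel)"
    unfolding a_def by (intro suminf_le int(2)[OF mw]) auto
  also have "\<dots> = (\<integral>\<^sup>+t. (\<Sum>n. a n t) \<partial>lborel)" by (intro nn_integral_suminf[symmetric]) measurable
  finally have "ennreal (cg / 3) * (ennreal (c / 2) * (\<integral>\<^sup>+x. ennreal \<bar>w x\<bar> * indicator \<Omega> x \<partial>lborel))
      \<le> ennreal (cg / 3) * (\<integral>\<^sup>+t. (\<Sum>n. a n t) \<partial>lborel)" by (rule mult_left_mono) simp
  also have "\<dots> = (\<integral>\<^sup>+t. ennreal (cg / 3) * (\<Sum>n. a n t) \<partial>lborel)"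
    by (intro nn_integral_cmult[symmetric]) measurable
  also have "\<dots> \<le> (\<integral>\<^sup>+t. ennreal K * (ennreal ?Cq * (\<Sum>n. b n t)) \<partial>lborel)"
    by (rule nn_integral_mono_AE[OF AEt])
  also have "\<dots> = ennreal K * (ennreal ?Cq * (\<integral>\<^sup>+t. (\<Sum>n. b n t) \<partial>lborel))"
    by (subst nn_integral_cmult, measurable, subst nn_integral_cmult, measurable)
  also have "(\<integral>\<^sup>+t. (\<Sum>n. b n t) \<partial>lborel) = (\<Sum>n. \<integral>\<^sup>+t. b n t \<partial>lborel)" by (intro nn_integral_suminf) measurable
  also have "ennreal K * (ennreal ?Cq * (\<Sum>n. \<integral>\<^sup>+t. b n t \<partial>lborel))
      \<le> ennreal K * (ennreal ?Cq * (\<Sum>n. ennreal C * (\<integral>\<^sup>+x. q\<Omega> x * indicator (B n) x \<partial>lborel)))"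
    unfolding b_def by (intro mult_left_mono suminf_le int(3)[OF mq]) auto
  also have "(\<Sum>n. ennreal C * (\<integral>\<^sup>+x. q\<Omega> x * indicator (B n) x \<partial>lborel)) = ennreal C * (\<integral>\<^sup>+x. ennreal (q x) * indicator \<Omega> x \<partial>lborel)"
    using split[OF mq] unfolding abs by (simp only: ennreal_suminf_cmult)
  finally show ?thesis .
qed

section \<open>Weak equations\<close>

lemma lebesgue_on_open_bounded:
  fixes \<Omega> :: "(real^'n::finite) set"
  assumes "open \<Omega>" "bounded \<Omega>"
  shows "\<Omega> \<in> sets lebesgue" "finite_measure (lebesgue_on \<Omega>)"
  using lmeasurable_open[OF assms(2,1)] by (auto intro: finite_measure_lebesgue_on)

lemma continuous_on_borel_measurable_lebesgue_on:
  fixes \<Omega> :: "(real^'n::finite) set"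
  assumes "open \<Omega>" "continuous_on \<Omega> f"
  shows "f \<in> borel_measurable (lebesgue_on \<Omega>)"
  using assms by (intro continuous_imp_measurable_on_sets_lebesgue) auto

lemma integrable_lebesgue_on_bounded:
  fixes f :: "real^'n::finite \<Rightarrow> 'b::euclidean_space"
  assumes \<Omega>: "open \<Omega>" "bounded \<Omega>" and "f \<in> borel_measurable (lebesgue_on \<Omega>)"
    and B: "AE x in lebesgue_on \<Omega>. norm (f x) \<le> B"
  shows "integrable (lebesgue_on \<Omega>) f"
proof -
  interpret finite_measure "lebesgue_on \<Omega>" by (rule lebesgue_on_open_bounded[OF \<Omega>])
  show ?thesis by (rule integrable_const_bound[OF B]) fact
qed

lemma AE_lebesgue_onI:
  assumes "\<And>x. x \<in> \<Omega> \<Longrightarrow> P x"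
  shows "AE x in lebesgue_on \<Omega>. P x"
  using assms by (intro AE_I2) (simp add: space_restrict_space)

lemma integrable_lebesgue_on_continuous:
  fixes f :: "real^'n::finite \<Rightarrow> 'b::euclidean_space"
  assumes "open \<Omega>" "bounded \<Omega>" "continuous_on \<Omega> f" "\<And>x. x \<in> \<Omega> \<Longrightarrow> norm (f x) \<le> B"
  shows "integrable (lebesgue_on \<Omega>) f"
  using assms
  by (intro integrable_lebesgue_on_bounded continuous_on_borel_measurable_lebesgue_on AE_lebesgue_onI) auto

lemma abs_integral_le_measure:
  fixes f :: "real^'n::finite \<Rightarrow> real"
  assumes \<Omega>: "open \<Omega>" "bounded \<Omega>" and "0 \<le> B" and f: "\<And>x. x \<in> \<Omega> \<Longrightarrow> \<bar>f x\<bar> \<le> B"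
  shows "\<bar>LINT x|lebesgue_on \<Omega>. f x\<bar> \<le> B * measure lebesgue \<Omega>"
proof (cases "integrable (lebesgue_on \<Omega>) f")
  case True
  interpret finite_measure "lebesgue_on \<Omega>" by (rule lebesgue_on_open_bounded[OF \<Omega>])
  have "\<bar>LINT x|lebesgue_on \<Omega>. f x\<bar> \<le> (LINT x|lebesgue_on \<Omega>. \<bar>f x\<bar>)"
    using integral_norm_bound[of "lebesgue_on \<Omega>" f] by simp
  also have "\<dots> \<le> (LINT x|lebesgue_on \<Omega>. B)"
    using True f by (intro integral_mono) (auto simp: space_restrict_space)
  also have "\<dots> = B * measure lebesgue \<Omega>"
    using lebesgue_on_open_bounded(1)[OF \<Omega>] by (simp add: measure_restrict_space space_restrict_space)
  finally show ?thesis .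
next
  case False then show ?thesis using \<open>0 \<le> B\<close> by (simp add: not_integrable_integral_eq)
qed

lemma test_functionD:
  fixes \<phi> :: "real^'n::finite \<Rightarrow> real"
  assumes \<phi>: "test_function \<Omega> \<phi>" and \<Omega>: "bounded \<Omega>"
  obtains B where "continuous_on UNIV \<phi>" "continuous_on UNIV (grad \<phi>)" "\<And>x. (\<phi> has_derivative (\<lambda>k. grad \<phi> x \<bullet> k)) (at x)"
    "0 \<le> B" "\<And>x. x \<in> \<Omega> \<Longrightarrow> \<bar>\<phi> x\<bar> \<le> B" "\<And>x. x \<in> \<Omega> \<Longrightarrow> norm (grad \<phi> x) \<le> B"
proof -
  have Ck: "\<forall>k. Ck_on k UNIV \<phi>" using \<phi> by (simp add: test_function_def)
  note c = Ck_on_all_continuous[OF Ck] Ck_on_all_continuous_grad[OF Ck]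
  have "compact (closure \<Omega>)" using \<Omega> by simp
  then have "bounded (\<phi> ` closure \<Omega>)" "bounded (grad \<phi> ` closure \<Omega>)"
    using c by (auto intro!: compact_imp_bounded compact_continuous_image intro: continuous_on_subset)
  then obtain B1 B2 where B: "\<forall>x\<in>closure \<Omega>. \<bar>\<phi> x\<bar> \<le> B1" "\<forall>x\<in>closure \<Omega>. norm (grad \<phi> x) \<le> B2"
    unfolding bounded_iff by auto
  have "x \<in> closure \<Omega>" if "x \<in> \<Omega>" for x using that closure_subset by blast
  then show ?thesis
    using c grad_inner[OF Ck_on_all_differentiable[OF Ck]] B
    by (intro that[of "max 0 (max B1 B2)"]) (auto simp: le_max_iff_disj)
qed

lemma in_L2_bounded_continuous:
  fixes f :: "real^'n::finite \<Rightarrow> 'b::euclidean_space"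
  assumes "open \<Omega>" "bounded \<Omega>" "continuous_on \<Omega> f" "\<And>x. x \<in> \<Omega> \<Longrightarrow> norm (f x) \<le> B"
  shows "in_L2 \<Omega> f"
  unfolding in_L2_def
proof
  show "f \<in> borel_measurable (lebesgue_on \<Omega>)" by (rule continuous_on_borel_measurable_lebesgue_on[OF assms(1,3)])
  show "integrable (lebesgue_on \<Omega>) (\<lambda>x. (norm (f x))\<^sup>2)"
    using assms by (intro integrable_lebesgue_on_continuous[where B = "B\<^sup>2"] continuous_intros) (auto intro!: power_mono)
qed

lemma in_L2_diff:
  fixes f g :: "real^'n::finite \<Rightarrow> 'b::euclidean_space"
  assumes "in_L2 \<Omega> f" "in_L2 \<Omega> g"
  shows "in_L2 \<Omega> (\<lambda>x. f x - g x)"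
  unfolding in_L2_def
proof
  show m: "(\<lambda>x. f x - g x) \<in> borel_measurable (lebesgue_on \<Omega>)"
    using assms by (intro borel_measurable_diff) (simp_all add: in_L2_def)
  show "integrable (lebesgue_on \<Omega>) (\<lambda>x. (norm (f x - g x))\<^sup>2)"
  proof (rule Bochner_Integration.integrable_bound)
    show "integrable (lebesgue_on \<Omega>) (\<lambda>x. 2 * (norm (f x))\<^sup>2 + 2 * (norm (g x))\<^sup>2)"
      using assms by (simp add: in_L2_def)
    have "(norm (f x - g x))\<^sup>2 \<le> 2 * (norm (f x))\<^sup>2 + 2 * (norm (g x))\<^sup>2" for x
    proof -
      have "(norm (f x - g x))\<^sup>2 \<le> (norm (f x) + norm (g x))\<^sup>2" by (intro power_mono norm_triangle_ineq4) simp
      also have "\<dots> \<le> 2 * (norm (f x))\<^sup>2 + 2 * (norm (g x))\<^sup>2"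
        using sum_squares_bound[of "norm (f x)" "norm (g x)"] by (simp add: power2_sum)
      finally show ?thesis .
    qed
    then show "AE x in lebesgue_on \<Omega>. norm ((norm (f x - g x))\<^sup>2) \<le> norm (2 * (norm (f x))\<^sup>2 + 2 * (norm (g x))\<^sup>2)"
      by simp
  qed (use m in measurable)
qed

text \<open>Everything follows from \<open>t \<le> e + t * t / e\<close>, integrated over a set of
  finite measure. The free parameter \<open>e\<close> stands in for the Cauchy-Schwarz inequality
  and is chosen later to balance both terms.\<close>

lemma integrable_in_L2:
  fixes f :: "real^'n::finite \<Rightarrow> 'b::euclidean_space"
  assumes \<Omega>: "open \<Omega>" "bounded \<Omega>" and f: "in_L2 \<Omega> f"
  shows "integrable (lebesgue_on \<Omega>) (\<lambda>x. norm (f x))" "integrable (lebesgue_on \<Omega>) f"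
    and integral_le_L2: "0 < e \<Longrightarrow> (LINT x|lebesgue_on \<Omega>. norm (f x)) \<le> e * measure lebesgue \<Omega> + (LINT x|lebesgue_on \<Omega>. (norm (f x))\<^sup>2) / e"
proof -
  interpret finite_measure "lebesgue_on \<Omega>" by (rule lebesgue_on_open_bounded[OF \<Omega>])
  have amgm: "t \<le> e + t\<^sup>2 / e" if "0 < e" for t e :: real
  proof -
    have "0 \<le> (t - e)\<^sup>2 + e * t" if "0 \<le> t" using that \<open>0 < e\<close> by simp
    then have "e * t \<le> e\<^sup>2 + t\<^sup>2"
      using \<open>0 < e\<close> by (cases "0 \<le> t") (auto simp: power2_eq_square algebra_simps intro: order_trans[OF mult_nonneg_nonpos])
    then show ?thesis using \<open>0 < e\<close> by (simp add: field_simps power2_eq_square)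
  qed
  have sq: "integrable (lebesgue_on \<Omega>) (\<lambda>x. (norm (f x))\<^sup>2)" and m: "f \<in> borel_measurable (lebesgue_on \<Omega>)"
    using f by (auto simp: in_L2_def)
  have "integrable (lebesgue_on \<Omega>) (\<lambda>x. 1 + (norm (f x))\<^sup>2)" using sq by simp
  then show i: "integrable (lebesgue_on \<Omega>) f"
  proof (rule Bochner_Integration.integrable_bound[OF _ m])
    have "norm (f x) \<le> 1 + (norm (f x))\<^sup>2" for x using amgm[of 1 "norm (f x)"] by simp
    then show "AE x in lebesgue_on \<Omega>. norm (f x) \<le> norm (1 + (norm (f x))\<^sup>2)" by simp
  qed
  then show i': "integrable (lebesgue_on \<Omega>) (\<lambda>x. norm (f x))" by simp
  assume "0 < e"
  have "(LINT x|lebesgue_on \<Omega>. norm (f x)) \<le> (LINT x|lebesgue_on \<Omega>. e + (norm (f x))\<^sup>2 / e)"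
    using i' sq amgm[OF \<open>0 < e\<close>] by (intro integral_mono) auto
  also have "\<dots> = e * measure lebesgue \<Omega> + (LINT x|lebesgue_on \<Omega>. (norm (f x))\<^sup>2) / e"
    using sq lebesgue_on_open_bounded(1)[OF \<Omega>] by (simp add: measure_restrict_space space_restrict_space)
  finally show "(LINT x|lebesgue_on \<Omega>. norm (f x)) \<le> \<dots>" .
qed

lemma H10_test_function:
  fixes \<phi> :: "real^'n::finite \<Rightarrow> real"
  assumes \<Omega>: "open \<Omega>" "bounded \<Omega>" and \<phi>: "test_function \<Omega> \<phi>"
  shows "H10 \<Omega> \<phi> (grad \<phi>)"
proof -
  obtain B where B: "continuous_on UNIV \<phi>" "continuous_on UNIV (grad \<phi>)"
    "\<And>x. x \<in> \<Omega> \<Longrightarrow> \<bar>\<phi> x\<bar> \<le> B" "\<And>x. x \<in> \<Omega> \<Longrightarrow> norm (grad \<phi> x) \<le> B"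
    using test_functionD[OF \<phi> \<Omega>(2)] by metis
  have "in_L2 \<Omega> \<phi>" "in_L2 \<Omega> (grad \<phi>)"
    using B by (auto intro!: in_L2_bounded_continuous[OF \<Omega>] intro: continuous_on_subset)
  then show ?thesis unfolding H10_def using \<phi> by (auto intro!: exI[of _ "\<lambda>_. \<phi>"])
qed

lemma nonpos_if_le_mult_epsilon:
  fixes x c :: real
  assumes "0 \<le> c" and x: "\<And>e. 0 < e \<Longrightarrow> x \<le> c * e"
  shows "x \<le> 0"
proof (rule field_le_epsilon)
  fix e :: real assume "0 < e"
  then have "x \<le> c * (e / (c + 1))" using assms(1) by (intro x divide_pos_pos) auto
  also have "\<dots> = e * (c / (c + 1))" by simp
  also have "\<dots> \<le> e * 1" using \<open>0 < e\<close> assms(1) by (intro mult_left_mono) (auto simp: divide_le_eq_1)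
  finally show "x \<le> 0 + e" by simp
qed

text \<open>Density of test functions: as \<open>X\<close> and \<open>Y\<close> are bounded, the
  defect is at most a multiple of the L1 distances, which \<open>integral_le_L2\<close> bounds by
  the L2 distances up to \<open>e\<close>. First the approximation converges for fixed
  \<open>e\<close>, then \<open>e\<close> tends to zero.\<close>

lemma weak_equation_H10:
  fixes X :: "real^'n::finite \<Rightarrow> real^'n" and Y :: "real^'n \<Rightarrow> real"
  assumes \<Omega>: "open \<Omega>" "bounded \<Omega>"
    and X: "continuous_on \<Omega> X" "\<And>x. x \<in> \<Omega> \<Longrightarrow> norm (X x) \<le> B"
    and Y: "continuous_on \<Omega> Y" "\<And>x. x \<in> \<Omega> \<Longrightarrow> \<bar>Y x\<bar> \<le> B"
    and test: "\<And>\<phi>. test_function \<Omega> \<phi> \<Longrightarrow> (LINT x|lebesgue_on \<Omega>. grad \<phi> x \<bullet> X x + \<phi> x * Y x) = 0"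
    and w: "H10 \<Omega> w G"
  shows "(LINT x|lebesgue_on \<Omega>. G x \<bullet> X x + w x * Y x) = 0"
proof -
  \<comment> \<open>If \<open>\<Omega>\<close> is empty, \<open>B\<close> may be negative.\<close>
  define B' where "B' = \<bar>B\<bar>"
  have XB: "norm (X x) \<le> B'" and YB: "\<bar>Y x\<bar> \<le> B'" if "x \<in> \<Omega>" for x
    using X(2)[OF that] Y(2)[OF that] by (auto simp: B'_def)
  have mX: "X \<in> borel_measurable (lebesgue_on \<Omega>)" and mY: "Y \<in> borel_measurable (lebesgue_on \<Omega>)"
    using X(1) Y(1) \<Omega>(1) by (auto intro: continuous_on_borel_measurable_lebesgue_on)
  have int: "integrable (lebesgue_on \<Omega>) (\<lambda>x. G x \<bullet> X x + w x * Y x)"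
    and bound: "\<bar>LINT x|lebesgue_on \<Omega>. G x \<bullet> X x + w x * Y x\<bar> \<le>
      B' * ((LINT x|lebesgue_on \<Omega>. norm (G x)) + (LINT x|lebesgue_on \<Omega>. norm (w x)))"
    if L2: "in_L2 \<Omega> w" "in_L2 \<Omega> G" for w and G :: "real^'n \<Rightarrow> real^'n"
  proof -
    have i: "integrable (lebesgue_on \<Omega>) (\<lambda>x. B' * norm (G x) + B' * norm (w x))"
      using integrable_in_L2(1)[OF \<Omega> L2(1)] integrable_in_L2(1)[OF \<Omega> L2(2)] by simp
    have le: "\<bar>G x \<bullet> X x + w x * Y x\<bar> \<le> B' * norm (G x) + B' * norm (w x)" if "x \<in> \<Omega>" for x
    proof -
      have "\<bar>G x \<bullet> X x\<bar> \<le> norm (G x) * norm (X x)" by (rule Cauchy_Schwarz_ineq2)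
      also have "\<dots> \<le> B' * norm (G x)" using mult_right_mono[OF XB[OF that] norm_ge_zero[of "G x"]] by (simp add: mult.commute)
      finally have "\<bar>G x \<bullet> X x\<bar> \<le> B' * norm (G x)" .
      moreover have "\<bar>w x * Y x\<bar> \<le> B' * norm (w x)" using mult_right_mono[OF YB[OF that] abs_ge_zero[of "w x"]] by (simp add: abs_mult mult.commute)
      ultimately show ?thesis by linarith
    qed
    have m: "(\<lambda>x. G x \<bullet> X x + w x * Y x) \<in> borel_measurable (lebesgue_on \<Omega>)"
      using L2 mX mY by (intro borel_measurable_add borel_measurable_inner borel_measurable_times) (simp_all add: in_L2_def)
    show int: "integrable (lebesgue_on \<Omega>) (\<lambda>x. G x \<bullet> X x + w x * Y x)"
      by (rule Bochner_Integration.integrable_bound[OF i m])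
         (rule AE_lebesgue_onI, use order_trans[OF le abs_ge_self] in simp)
    have "\<bar>LINT x|lebesgue_on \<Omega>. G x \<bullet> X x + w x * Y x\<bar> \<le> (LINT x|lebesgue_on \<Omega>. \<bar>G x \<bullet> X x + w x * Y x\<bar>)"
      using integral_norm_bound[of "lebesgue_on \<Omega>" "\<lambda>x. G x \<bullet> X x + w x * Y x"] by simp
    also have "\<dots> \<le> (LINT x|lebesgue_on \<Omega>. B' * norm (G x) + B' * norm (w x))"
      using int i le by (intro integral_mono) (auto simp: space_restrict_space)
    also have "\<dots> = B' * ((LINT x|lebesgue_on \<Omega>. norm (G x)) + (LINT x|lebesgue_on \<Omega>. norm (w x)))"
      using integrable_in_L2(1)[OF \<Omega> L2(1)] integrable_in_L2(1)[OF \<Omega> L2(2)] by (simp add: distrib_left)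
    finally show "\<bar>LINT x|lebesgue_on \<Omega>. G x \<bullet> X x + w x * Y x\<bar> \<le> \<dots>" .
  qed
  from w obtain \<phi> where L2: "in_L2 \<Omega> w" "in_L2 \<Omega> G" and \<phi>: "\<And>k. test_function \<Omega> (\<phi> k)"
    and lim1: "(\<lambda>k. LINT x|lebesgue_on \<Omega>. (\<phi> k x - w x)\<^sup>2) \<longlonglongrightarrow> 0"
    and lim2: "(\<lambda>k. LINT x|lebesgue_on \<Omega>. (norm (grad (\<phi> k) x - G x))\<^sup>2) \<longlonglongrightarrow> 0"
    unfolding H10_def by blast
  let ?I = "\<bar>LINT x|lebesgue_on \<Omega>. G x \<bullet> X x + w x * Y x\<bar>" and ?V = "measure lebesgue \<Omega>"
  have step: "?I \<le> B' * ((e * ?V + (LINT x|lebesgue_on \<Omega>. (norm (grad (\<phi> k) x - G x))\<^sup>2) / e)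
      + (e * ?V + (LINT x|lebesgue_on \<Omega>. (\<phi> k x - w x)\<^sup>2) / e))" if "0 < e" for e k
  proof -
    have L2\<phi>: "in_L2 \<Omega> (\<phi> k)" "in_L2 \<Omega> (grad (\<phi> k))" using H10_test_function[OF \<Omega> \<phi>[of k]] by (simp_all add: H10_def)
    note L2d = in_L2_diff[OF L2\<phi>(1) L2(1)] in_L2_diff[OF L2\<phi>(2) L2(2)]
    have "(LINT x|lebesgue_on \<Omega>. (grad (\<phi> k) x - G x) \<bullet> X x + (\<phi> k x - w x) * Y x)
      = (LINT x|lebesgue_on \<Omega>. (grad (\<phi> k) x \<bullet> X x + \<phi> k x * Y x) - (G x \<bullet> X x + w x * Y x))"
      by (intro Bochner_Integration.integral_cong) (auto simp: algebra_simps)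
    also have "\<dots> = - (LINT x|lebesgue_on \<Omega>. G x \<bullet> X x + w x * Y x)"
      using int[OF L2\<phi>] int[OF L2] test[OF \<phi>[of k]] by (subst Bochner_Integration.integral_diff) auto
    finally have "?I = \<bar>LINT x|lebesgue_on \<Omega>. (grad (\<phi> k) x - G x) \<bullet> X x + (\<phi> k x - w x) * Y x\<bar>" by simp
    also have "\<dots> \<le> B' * ((LINT x|lebesgue_on \<Omega>. norm (grad (\<phi> k) x - G x)) + (LINT x|lebesgue_on \<Omega>. norm (\<phi> k x - w x)))"
      by (rule bound[OF L2d])
    also have "\<dots> \<le> B' * ((e * ?V + (LINT x|lebesgue_on \<Omega>. (norm (grad (\<phi> k) x - G x))\<^sup>2) / e)
      + (e * ?V + (LINT x|lebesgue_on \<Omega>. (norm (\<phi> k x - w x))\<^sup>2) / e))"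
      by (intro mult_left_mono add_mono integral_le_L2[OF \<Omega>] L2d \<open>0 < e\<close>) (simp add: B'_def)
    finally show ?thesis by simp
  qed
  have "?I \<le> 2 * B' * ?V * e" if "0 < e" for e
  proof -
    have "(\<lambda>k. B' * ((e * ?V + (LINT x|lebesgue_on \<Omega>. (norm (grad (\<phi> k) x - G x))\<^sup>2) / e)
      + (e * ?V + (LINT x|lebesgue_on \<Omega>. (\<phi> k x - w x)\<^sup>2) / e))) \<longlonglongrightarrow> B' * ((e * ?V + 0 / e) + (e * ?V + 0 / e))"
      using that by (intro tendsto_intros lim1 lim2) auto
    from LIMSEQ_le_const[OF this, of ?I] step[OF that] show ?thesis by (auto simp: algebra_simps)
  qed
  from nonpos_if_le_mult_epsilon[OF _ this] have "?I \<le> 0" by (simp add: B'_def)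
  then show ?thesis by simp
qed

text \<open>The equation is tested with the product of \<open>s\<close> and \<open>\<phi>\<close>,
  and the product rule is applied. That product is only C1 with compact support, so the equation
  reaches it through test functions that approximate it together with its gradient, uniformly on
  \<open>\<Omega>\<close>.\<close>

lemma weak_equation_multiplier:
  fixes J ds :: "real^'n::finite \<Rightarrow> real^'n" and H s :: "real^'n \<Rightarrow> real"
  assumes \<Omega>: "open \<Omega>" "bounded \<Omega>"
    and J: "continuous_on \<Omega> J" "\<And>x. x \<in> \<Omega> \<Longrightarrow> norm (J x) \<le> B"
    and H: "continuous_on \<Omega> H" "\<And>x. x \<in> \<Omega> \<Longrightarrow> \<bar>H x\<bar> \<le> B"
    and test: "\<And>\<phi>. test_function \<Omega> \<phi> \<Longrightarrow> (LINT x|lebesgue_on \<Omega>. grad \<phi> x \<bullet> J x + \<phi> x * H x) = 0"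
    and s: "\<And>x. x \<in> \<Omega> \<Longrightarrow> (s has_derivative (\<lambda>k. ds x \<bullet> k)) (at x)" "continuous_on \<Omega> ds"
    and \<phi>: "test_function \<Omega> \<phi>"
  shows "(LINT x|lebesgue_on \<Omega>. grad \<phi> x \<bullet> (s x *\<^sub>R J x) + \<phi> x * (ds x \<bullet> J x + H x * s x)) = 0"
proof (cases "\<forall>x. \<phi> x = 0")
  case True
  have "grad \<phi> x = 0" for x using True by (intro grad_eqI) (simp add: has_derivative_const fun_eq_iff[of \<phi> "\<lambda>_. 0", THEN iffD2])
  with True show ?thesis by simp
next
  case False
  obtain B\<phi> where cont\<phi>: "continuous_on UNIV \<phi>" "continuous_on UNIV (grad \<phi>)"
    and d\<phi>: "\<And>x. (\<phi> has_derivative (\<lambda>k. grad \<phi> x \<bullet> k)) (at x)" and "0 \<le> B\<phi>"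
    and "\<And>x. x \<in> \<Omega> \<Longrightarrow> \<bar>\<phi> x\<bar> \<le> B\<phi>" "\<And>x. x \<in> \<Omega> \<Longrightarrow> norm (grad \<phi> x) \<le> B\<phi>"
    by (rule test_functionD[OF \<phi> \<Omega>(2)]) (rule that; assumption)
  from \<phi> obtain A where Ck: "\<forall>k. Ck_on k UNIV \<phi>" and A: "compact A" "A \<subseteq> \<Omega>" "\<And>x. x \<notin> A \<Longrightarrow> \<phi> x = 0"
    unfolding test_function_def by blast
  obtain a b :: "real^'n" where ab: "A \<subseteq> cbox a b"
    using bounded_subset_cbox_symmetric[OF compact_imp_bounded[OF A(1)]] by blast
  \<comment> \<open>Normalizing the square of \<open>\<phi>\<close> gives a smooth kernel of compact
    support. The integral is nonzero because a continuous function that is not identically zero is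
    nonzero on an open set of positive measure.\<close>
  define I where "I = (LINT x|lborel. \<phi> x * \<phi> x)"
  have c2: "continuous_on X (\<lambda>x. \<phi> x * \<phi> x)" for X
    by (intro continuous_intros continuous_on_subset[OF cont\<phi>(1)]) auto
  have int2: "integrable lborel (\<lambda>x. \<phi> x * \<phi> x)"
    using A(3) ab by (intro lborel_integral_cbox(1)[OF c2]) auto
  have "I \<noteq> 0"
  proof
    assume "I = 0"
    then have "AE x in lborel. \<phi> x * \<phi> x = 0"
      unfolding I_def using integral_nonneg_eq_0_iff_AE[OF int2] by simp
    then have "AE x in lebesgue. \<not> x \<in> {x. \<phi> x \<noteq> 0}" by (simp add: AE_completion_iff)
    moreover have op: "open {x. \<phi> x \<noteq> 0}" using cont\<phi>(1) by (intro open_Collect_neq continuous_intros) auto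
    ultimately have "{x. \<phi> x \<noteq> 0} \<in> null_sets lebesgue" by (subst AE_iff_null_sets) auto
    then have "negligible {x. \<phi> x \<noteq> 0}" by (simp add: negligible_iff_null_sets)
    with open_not_negligible[OF op] False show False by auto
  qed
  define \<eta> where "\<eta> x = \<phi> x * \<phi> x * (1 / I)" for x
  have \<eta>: "\<forall>k. Ck_on k UNIV \<eta>" "\<And>x. x \<notin> A \<Longrightarrow> \<eta> x = 0" "(LINT x|lborel. \<eta> x) = 1"
  proof -
    show "\<forall>k. Ck_on k UNIV \<eta>" unfolding \<eta>_def using Ck by (intro allI Ck_on_mult Ck_on_const) auto
    show "\<eta> x = 0" if "x \<notin> A" for x using A(3)[OF that] by (simp add: \<eta>_def)
    show "(LINT x|lborel. \<eta> x) = 1" using \<open>I \<noteq> 0\<close> unfolding \<eta>_def by (simp add: I_def[symmetric])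
  qed
  \<comment> \<open>Nothing is known about \<open>s\<close> outside \<open>\<Omega>\<close>;
    extension by zero is harmless because \<open>\<phi>\<close> vanishes off the compact set
    \<open>A\<close> inside \<open>\<Omega>\<close>.\<close>
  define \<psi> where "\<psi> x = (if x \<in> \<Omega> then \<phi> x * s x else 0)" for x
  define d\<psi> where "d\<psi> x = (if x \<in> \<Omega> then s x *\<^sub>R grad \<phi> x + \<phi> x *\<^sub>R ds x else 0)" for x
  have oA: "open (- A)" using A(1) by (simp add: compact_imp_closed open_Compl)
  have grad0: "grad \<phi> x = 0" if "x \<notin> A" for x
  proof (rule grad_eqI)
    have "((\<lambda>_. 0) has_derivative (\<lambda>k. 0 \<bullet> k)) (at x)" by simp
    then show "(\<phi> has_derivative (\<lambda>k. 0 \<bullet> k)) (at x)"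
      by (rule has_derivative_transform_within_open[OF _ oA]) (use that A(3) in auto)
  qed
  have d\<psi>: "(\<psi> has_derivative (\<lambda>k. d\<psi> x \<bullet> k)) (at x)" for x
  proof (cases "x \<in> \<Omega>")
    case True
    have "((\<lambda>x. \<phi> x * s x) has_derivative (\<lambda>k. \<phi> x * (ds x \<bullet> k) + (grad \<phi> x \<bullet> k) * s x)) (at x)"
      by (intro has_derivative_mult d\<phi> s(1) True)
    then have "(\<psi> has_derivative (\<lambda>k. \<phi> x * (ds x \<bullet> k) + (grad \<phi> x \<bullet> k) * s x)) (at x)"
      by (rule has_derivative_transform_within_open[OF _ \<Omega>(1) True]) (simp add: \<psi>_def)
    then show ?thesis using True by (simp add: d\<psi>_def inner_add_left algebra_simps)
  next
    case False
    then have xA: "x \<in> - A" using A(2) by auto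
    have "((\<lambda>_. 0) has_derivative (\<lambda>k. d\<psi> x \<bullet> k)) (at x)" using False by (simp add: d\<psi>_def)
    then show ?thesis
      by (rule has_derivative_transform_within_open[OF _ oA xA]) (use A(3) in \<open>auto simp: \<psi>_def\<close>)
  qed
  have cs: "continuous_on \<Omega> s"
    using s(1) by (meson continuous_at_imp_continuous_on has_derivative_continuous)
  have "continuous_on \<Omega> (\<lambda>x. s x *\<^sub>R grad \<phi> x + \<phi> x *\<^sub>R ds x)"
    by (intro continuous_intros cs s(2) continuous_on_subset[OF cont\<phi>(1)] continuous_on_subset[OF cont\<phi>(2)]) auto
  then have "continuous_on \<Omega> d\<psi>" by (rule continuous_on_eq) (simp add: d\<psi>_def)
  \<comment> \<open>Continuity is glued over two open sets that cover the space:
    \<open>\<Omega>\<close>, and the complement of \<open>A\<close>, where the gradient is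
    zero.\<close>
  moreover have "continuous_on (- A) d\<psi>"
    using continuous_on_const[of "- A" 0] by (rule continuous_on_eq) (use A(3) grad0 in \<open>auto simp: d\<psi>_def\<close>)
  ultimately have "continuous_on (\<Omega> \<union> - A) d\<psi>" using \<Omega>(1) oA by (intro continuous_on_open_Un) auto
  moreover have "\<Omega> \<union> - A = UNIV" using A(2) by auto
  ultimately have cd\<psi>: "continuous_on UNIV d\<psi>" by simp
  have c\<psi>: "continuous_on UNIV \<psi>"
    using d\<psi> by (meson continuous_at_imp_continuous_on has_derivative_continuous)
  have \<psi>0: "\<psi> x = 0" if "x \<notin> A" for x using A(3)[OF that] by (simp add: \<psi>_def)
  have "compact (closure \<Omega>)" using \<Omega>(2) by simp
  then have "bounded (\<psi> ` closure \<Omega>)" "bounded (d\<psi> ` closure \<Omega>)"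
    using c\<psi> cd\<psi> by (auto intro!: compact_imp_bounded compact_continuous_image intro: continuous_on_subset)
  then obtain P1 P2 where P: "\<forall>x\<in>closure \<Omega>. \<bar>\<psi> x\<bar> \<le> P1" "\<forall>x\<in>closure \<Omega>. norm (d\<psi> x) \<le> P2"
    unfolding bounded_iff by auto
  have cl: "x \<in> closure \<Omega>" if "x \<in> \<Omega>" for x using that closure_subset by blast
  define B' where "B' = \<bar>B\<bar>"
  have JB: "norm (J x) \<le> B'" and HB: "\<bar>H x\<bar> \<le> B'" if "x \<in> \<Omega>" for x
    using J(2)[OF that] H(2)[OF that] by (auto simp: B'_def)
  have bd: "\<bar>g \<bullet> J x + t * H x\<bar> \<le> (norm g + \<bar>t\<bar>) * B'" if "x \<in> \<Omega>" for g t x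
  proof -
    have "\<bar>g \<bullet> J x\<bar> \<le> norm g * B'"
      by (rule order_trans[OF Cauchy_Schwarz_ineq2]) (intro mult_left_mono JB that norm_ge_zero)
    moreover have "\<bar>t * H x\<bar> \<le> \<bar>t\<bar> * B'" unfolding abs_mult by (intro mult_left_mono HB that abs_ge_zero)
    ultimately show ?thesis by (simp add: algebra_simps)
  qed
  have B0: "0 \<le> B'" by (simp add: B'_def)
  have i\<psi>: "integrable (lebesgue_on \<Omega>) (\<lambda>x. d\<psi> x \<bullet> J x + \<psi> x * H x)"
  proof (rule integrable_lebesgue_on_continuous[OF \<Omega>])
    show "continuous_on \<Omega> (\<lambda>x. d\<psi> x \<bullet> J x + \<psi> x * H x)"
      by (intro continuous_intros J(1) H(1) continuous_on_subset[OF c\<psi>] continuous_on_subset[OF cd\<psi>]) auto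
    show "norm (d\<psi> x \<bullet> J x + \<psi> x * H x) \<le> (P2 + P1) * B'" if "x \<in> \<Omega>" for x
    proof -
      have "norm (d\<psi> x) + \<bar>\<psi> x\<bar> \<le> P2 + P1" using P cl[OF that] by (intro add_mono) auto
      from order_trans[OF bd[OF that] mult_right_mono[OF this B0]] show ?thesis by simp
    qed
  qed
  let ?\<Lambda> = "\<bar>LINT x|lebesgue_on \<Omega>. d\<psi> x \<bullet> J x + \<psi> x * H x\<bar>" and ?V = "measure lebesgue \<Omega>"
  have step: "?\<Lambda> \<le> 2 * \<delta> * B' * ?V" if \<delta>0: "0 < \<delta>" for \<delta>
  proof -
    obtain m where m: "test_function \<Omega> m" "\<And>x. x \<in> \<Omega> \<Longrightarrow> \<bar>m x - \<psi> x\<bar> \<le> \<delta>"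
      "\<And>x. x \<in> \<Omega> \<Longrightarrow> norm (grad m x - d\<psi> x) \<le> \<delta>"
      using C1_compact_support_approx[OF \<Omega> \<eta>(1) A(1) \<eta>(2,3) d\<psi> cd\<psi> A(1,2) \<psi>0 \<delta>0] by metis
    obtain Bm where Bm: "continuous_on UNIV m" "continuous_on UNIV (grad m)"
      "\<And>x. x \<in> \<Omega> \<Longrightarrow> \<bar>m x\<bar> \<le> Bm" "\<And>x. x \<in> \<Omega> \<Longrightarrow> norm (grad m x) \<le> Bm"
      using test_functionD[OF m(1) \<Omega>(2)] by metis
    have im: "integrable (lebesgue_on \<Omega>) (\<lambda>x. grad m x \<bullet> J x + m x * H x)"
    proof (rule integrable_lebesgue_on_continuous[OF \<Omega>])
      show "continuous_on \<Omega> (\<lambda>x. grad m x \<bullet> J x + m x * H x)"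
        by (intro continuous_intros J(1) H(1) continuous_on_subset[OF Bm(1)] continuous_on_subset[OF Bm(2)]) auto
      show "norm (grad m x \<bullet> J x + m x * H x) \<le> (Bm + Bm) * B'" if "x \<in> \<Omega>" for x
        using bd[OF that, of "grad m x" "m x"] mult_right_mono[OF add_mono[OF Bm(4)[OF that] Bm(3)[OF that]] B0] by simp
    qed
    have "(LINT x|lebesgue_on \<Omega>. (grad m x - d\<psi> x) \<bullet> J x + (m x - \<psi> x) * H x) =
        (LINT x|lebesgue_on \<Omega>. (grad m x \<bullet> J x + m x * H x) - (d\<psi> x \<bullet> J x + \<psi> x * H x))"
      by (intro Bochner_Integration.integral_cong) (auto simp: algebra_simps)
    also have "\<dots> = - (LINT x|lebesgue_on \<Omega>. d\<psi> x \<bullet> J x + \<psi> x * H x)"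
      using im i\<psi> test[OF m(1)] by (subst Bochner_Integration.integral_diff) auto
    finally have "?\<Lambda> = \<bar>LINT x|lebesgue_on \<Omega>. (grad m x - d\<psi> x) \<bullet> J x + (m x - \<psi> x) * H x\<bar>" by simp
    also have "\<dots> \<le> ((\<delta> + \<delta>) * B') * ?V"
    proof (rule abs_integral_le_measure[OF \<Omega>])
      show "0 \<le> (\<delta> + \<delta>) * B'" using \<delta>0 B0 by simp
      show "\<bar>(grad m x - d\<psi> x) \<bullet> J x + (m x - \<psi> x) * H x\<bar> \<le> (\<delta> + \<delta>) * B'" if "x \<in> \<Omega>" for x
        by (rule order_trans[OF bd[OF that]]) (intro mult_right_mono add_mono m that B0)
    qed
    finally show ?thesis by (simp add: algebra_simps)
  qed
  have "?\<Lambda> \<le> 2 * B' * ?V * \<delta>" if "0 < \<delta>" for \<delta> using step[OF that] by (simp add: mult_ac)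
  from nonpos_if_le_mult_epsilon[OF _ this] have "?\<Lambda> \<le> 0" using B0 by simp
  then have "(LINT x|lebesgue_on \<Omega>. d\<psi> x \<bullet> J x + \<psi> x * H x) = 0" by simp
  moreover have "(LINT x|lebesgue_on \<Omega>. d\<psi> x \<bullet> J x + \<psi> x * H x) =
      (LINT x|lebesgue_on \<Omega>. grad \<phi> x \<bullet> (s x *\<^sub>R J x) + \<phi> x * (ds x \<bullet> J x + H x * s x))"
    by (intro Bochner_Integration.integral_cong)
       (auto simp: d\<psi>_def \<psi>_def space_restrict_space inner_add_left algebra_simps)
  ultimately show ?thesis by simp
qed

section \<open>Stability\<close>

lemma bounded_Ck_closure_image:
  assumes "Ck_closure k \<Omega> f" "bounded \<Omega>"
  shows "bounded (f ` \<Omega>)"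
  using assms by (cases k) (auto intro: bounded_uniformly_continuous_image)

lemma abs_le_Ck_norm:
  assumes f: "Ck_closure k \<Omega> f" and \<Omega>: "bounded \<Omega>" and x: "x \<in> \<Omega>"
  shows "\<bar>f x\<bar> \<le> Ck_norm k \<Omega> f"
proof -
  obtain b where "\<forall>x\<in>\<Omega>. \<bar>f x\<bar> \<le> b"
    using bounded_Ck_closure_image[OF f \<Omega>] unfolding bounded_iff by auto
  then have "\<bar>f x\<bar> \<le> (SUP x\<in>\<Omega>. \<bar>f x\<bar>)" using x by (intro cSUP_upper bdd_aboveI[of _ b]) auto
  also have "\<dots> \<le> Ck_norm k \<Omega> f" by (cases k) auto
  finally show ?thesis .
qed

lemma Ck_norm_partial_deriv_le: "Ck_norm k \<Omega> (partial_deriv i f) \<le> Ck_norm (Suc k) \<Omega> f"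
  by (auto simp: le_max_iff_disj intro!: Max_ge)

lemma Ck_norm_component_le: "Ck_norm k \<Omega> (\<lambda>x. F x $ i) \<le> Ck_norm_field k \<Omega> F"
  by (auto simp: Ck_norm_field_def intro!: Max_ge)

lemma Ck_closure_continuous_on: "Ck_closure k \<Omega> f \<Longrightarrow> continuous_on \<Omega> f"
  by (cases k) (auto intro: uniformly_continuous_imp_continuous)

lemma norm_le_3:
  fixes x :: "real^3"
  assumes "\<And>i. \<bar>x $ i\<bar> \<le> b"
  shows "norm x \<le> 3 * b"
proof -
  have "norm x \<le> (\<Sum>i\<in>UNIV. \<bar>x $ i\<bar>)" by (rule norm_le_l1_cart)
  also have "\<dots> \<le> (\<Sum>i\<in>(UNIV::3 set). b)" by (intro sum_mono assms)
  finally show ?thesis by simp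
qed

lemma Ck_closure_field_bounds:
  fixes F :: "real^3 \<Rightarrow> real^3"
  assumes F: "Ck_closure_field k \<Omega> F" "Ck_norm_field k \<Omega> F \<le> b" and \<Omega>: "bounded \<Omega>"
  shows "continuous_on \<Omega> F" "x \<in> \<Omega> \<Longrightarrow> norm (F x) \<le> 3 * b"
proof -
  have C: "Ck_closure k \<Omega> (\<lambda>x. F x $ i)" for i using F(1) by (simp add: Ck_closure_field_def)
  have "continuous_on \<Omega> (\<lambda>x. \<chi> i. F x $ i)"
    by (intro continuous_on_vec_lambda Ck_closure_continuous_on[OF C])
  then show "continuous_on \<Omega> F" by simp
  assume x: "x \<in> \<Omega>"
  show "norm (F x) \<le> 3 * b"
    using abs_le_Ck_norm[OF C \<Omega> x] Ck_norm_component_le[of k \<Omega> F] F(2) by (intro norm_le_3) (meson order_trans)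
qed

lemma Ck_closure_Suc_grad:
  fixes f :: "real^3 \<Rightarrow> real"
  assumes f: "Ck_closure (Suc k) \<Omega> f" and \<Omega>: "bounded \<Omega>"
  shows "\<And>x. x \<in> \<Omega> \<Longrightarrow> (f has_derivative (\<lambda>k. grad f x \<bullet> k)) (at x)" "continuous_on \<Omega> (grad f)"
    "\<And>x. x \<in> \<Omega> \<Longrightarrow> norm (grad f x) \<le> 3 * Ck_norm (Suc k) \<Omega> f"
proof -
  have C: "Ck_closure k \<Omega> (partial_deriv i f)" for i using f by simp
  show "(f has_derivative (\<lambda>k. grad f x \<bullet> k)) (at x)" if "x \<in> \<Omega>" for x using f that by (intro grad_inner) simp
  show "continuous_on \<Omega> (grad f)" by (intro continuous_on_grad Ck_closure_continuous_on[OF C])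
  show "norm (grad f x) \<le> 3 * Ck_norm (Suc k) \<Omega> f" if "x \<in> \<Omega>" for x
  proof (rule norm_le_3)
    show "\<bar>grad f x $ i\<bar> \<le> Ck_norm (Suc k) \<Omega> f" for i
      using order_trans[OF abs_le_Ck_norm[OF C \<Omega> that] Ck_norm_partial_deriv_le] by (simp add: grad_def)
  qed
qed

text \<open>The straight segment from \<open>x\<close> to a nearest boundary point stays in
  \<open>\<Omega>\<close> up to its end, without any convexity. The mean value theorem along it
  gives the bound, its length being at most \<open>2 * R\<close>.\<close>

lemma abs_le_of_zero_on_frontier:
  fixes u :: "real^'n::finite \<Rightarrow> real"
  assumes \<Omega>: "open \<Omega>" "\<And>x. x \<in> \<Omega> \<Longrightarrow> norm x \<le> R"
    and u: "continuous_on (closure \<Omega>) u" "\<And>x. x \<in> frontier \<Omega> \<Longrightarrow> u x = 0"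
      "\<And>x. x \<in> \<Omega> \<Longrightarrow> (u has_derivative (\<lambda>k. du x \<bullet> k)) (at x)" "\<And>x. x \<in> \<Omega> \<Longrightarrow> norm (du x) \<le> L"
    and x: "x \<in> \<Omega>"
  shows "\<bar>u x\<bar> \<le> L * (2 * R)"
proof -
  have bd: "bounded \<Omega>" using \<Omega>(2) by (auto simp: bounded_iff)
  then have "\<Omega> \<noteq> UNIV" using not_bounded_UNIV by blast
  then have "frontier \<Omega> \<noteq> {}" using x frontier_not_empty[of \<Omega>] by auto
  then obtain z where z: "z \<in> frontier \<Omega>" "\<And>y. y \<in> frontier \<Omega> \<Longrightarrow> dist x z \<le> dist x y"
    using distance_attains_inf[of "frontier \<Omega>" x] by (auto simp: frontier_closed)
  have zx: "z \<notin> \<Omega>" using z(1) \<Omega>(1) by (simp add: frontier_def interior_open)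
  \<comment> \<open>A ball that meets both \<open>\<Omega>\<close> and its complement is connected
    and would contain a boundary point nearer than \<open>z\<close>.\<close>
  have ball: "ball x (dist x z) \<subseteq> \<Omega>"
  proof (rule ccontr)
    assume "\<not> ?thesis"
    moreover have "x \<in> ball x (dist x z)" using x zx by auto
    ultimately have "ball x (dist x z) \<inter> \<Omega> \<noteq> {}" "ball x (dist x z) - \<Omega> \<noteq> {}" using x by blast+
    then have "ball x (dist x z) \<inter> frontier \<Omega> \<noteq> {}" by (intro connected_Int_frontier) auto
    then show False using z(2) by force
  qed
  define h where "h s = u (x + s *\<^sub>R (z - x))" for s
  have inO: "x + s *\<^sub>R (z - x) \<in> \<Omega>" if "0 \<le> s" "s < 1" for s
  proof -
    have "x \<noteq> z" using x zx by auto
    then have "dist x (x + s *\<^sub>R (z - x)) < dist x z" using that by (simp add: dist_norm norm_minus_commute)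
    then show ?thesis using ball by auto
  qed
  have cl: "x + s *\<^sub>R (z - x) \<in> closure \<Omega>" if "s \<in> {0..1}" for s
  proof (cases "s = 1")
    case True then show ?thesis using z(1) by (simp add: frontier_def)
  next
    case False then show ?thesis using inO[of s] that closure_subset[of \<Omega>] by auto
  qed
  have ch: "continuous_on {0..1} h"
    unfolding h_def using cl by (intro continuous_on_compose2[OF u(1)] continuous_intros) auto
  have dh: "(h has_real_derivative (du (x + s *\<^sub>R (z - x)) \<bullet> (z - x))) (at s)" if "0 < s" "s < 1" for s
  proof -
    have "((\<lambda>s. x + s *\<^sub>R (z - x)) has_derivative (\<lambda>k. k *\<^sub>R (z - x))) (at s)" by (auto intro!: derivative_eq_intros)
    from has_derivative_compose[OF this u(3)[OF inO]] that show ?thesis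
      unfolding h_def by (simp add: has_field_derivative_def mult_commute_abs)
  qed
  obtain l s where s: "0 < s" "s < 1" "(h has_real_derivative l) (at s)" "h 1 - h 0 = (1 - 0) * l"
    using MVT[OF zero_less_one ch] dh by (meson real_differentiable_def)
  have l: "l = du (x + s *\<^sub>R (z - x)) \<bullet> (z - x)" using DERIV_unique[OF s(3) dh[OF s(1,2)]] .
  have R: "norm z \<le> R"
  proof -
    have "closure \<Omega> \<subseteq> cball 0 R" using \<Omega>(2) by (intro closure_minimal) auto
    then show ?thesis using z(1) by (auto simp: frontier_def)
  qed
  have "\<bar>u x\<bar> = \<bar>l\<bar>" using s(4) u(2)[OF z(1)] by (simp add: h_def)
  also have "\<dots> \<le> norm (du (x + s *\<^sub>R (z - x))) * norm (z - x)" unfolding l by (rule Cauchy_Schwarz_ineq2)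
  also have "\<dots> \<le> L * (2 * R)"
    using u(4)[OF inO[of s]] s(1,2) norm_triangle_ineq4[of z x] R \<Omega>(2)[OF x]
      order_trans[OF norm_ge_zero u(4)[OF x]]
    by (intro mult_mono) auto
  finally show ?thesis .
qed

text \<open>The conversion by \<open>real_of_ereal\<close> is faithful only for a finite essential
  supremum. It is bounded above by \<open>b\<close>, and it is not minus infinity because a nonempty
  open set has positive measure.\<close>

lemma Linf_norm_bound:
  fixes \<Omega> :: "(real^'n::finite) set" and f :: "real^'n \<Rightarrow> real"
  assumes \<Omega>: "open \<Omega>" "\<Omega> \<noteq> {}" and f: "f \<in> borel_measurable (lebesgue_on \<Omega>)" "AE x in lebesgue_on \<Omega>. \<bar>f x\<bar> \<le> b"
  shows "AE x in lebesgue_on \<Omega>. \<bar>f x\<bar> \<le> Linf_norm \<Omega> f" "0 \<le> Linf_norm \<Omega> f"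
proof -
  have "\<not> negligible \<Omega>" by (rule open_not_negligible[OF \<Omega>])
  then have "emeasure lebesgue \<Omega> \<noteq> 0" using \<Omega>(1) by (auto simp: negligible_iff_null_sets null_sets_def)
  then have "emeasure (lebesgue_on \<Omega>) (space (lebesgue_on \<Omega>)) \<noteq> 0"
    using \<Omega>(1) by (simp add: space_restrict_space emeasure_restrict_space)
  then have nF: "\<not> (AE x in lebesgue_on \<Omega>. False)"
    unfolding eventually_False ae_filter_eq_bot_iff .
  let ?e = "esssup (lebesgue_on \<Omega>) (\<lambda>x. ereal \<bar>f x\<bar>)"
  have ae: "AE x in lebesgue_on \<Omega>. ereal \<bar>f x\<bar> \<le> ?e" by (rule esssup_AE)
  have "?e \<le> ereal b" using f by (intro esssup_I) auto
  moreover have "?e \<noteq> -\<infinity>" using ae nF by auto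
  ultimately obtain r where r: "?e = ereal r" by (cases ?e) auto
  then have L: "Linf_norm \<Omega> f = r" by (simp add: Linf_norm_def)
  show 1: "AE x in lebesgue_on \<Omega>. \<bar>f x\<bar> \<le> Linf_norm \<Omega> f" using ae unfolding r L by simp
  show "0 \<le> Linf_norm \<Omega> f"
  proof (rule ccontr)
    assume "\<not> 0 \<le> Linf_norm \<Omega> f"
    with 1 have "AE x in lebesgue_on \<Omega>. False" by (auto elim!: eventually_mono)
    with nF show False by simp
  qed
qed

text \<open>The choice \<open>e = sqrt d\<close> balances the two terms of
  \<open>integral_le_L2\<close>; for \<open>d = 0\<close> the parameter tends to zero instead. Each
  use of this lemma takes one square root of \<open>\<delta>\<close>.\<close>

lemma integral_norm_le_sqrt:
  fixes f :: "real^'n::finite \<Rightarrow> 'b::euclidean_space"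
  assumes \<Omega>: "open \<Omega>" "bounded \<Omega>" and f: "in_L2 \<Omega> f" and "0 \<le> d" "0 \<le> C"
    and le: "(LINT x|lebesgue_on \<Omega>. (norm (f x))\<^sup>2) \<le> C * d"
  shows "(LINT x|lebesgue_on \<Omega>. norm (f x)) \<le> (measure lebesgue \<Omega> + C) * sqrt d"
proof (cases "d = 0")
  case True
  have "(LINT x|lebesgue_on \<Omega>. norm (f x)) \<le> measure lebesgue \<Omega> * e" if "0 < e" for e
  proof -
    have "(LINT x|lebesgue_on \<Omega>. (norm (f x))\<^sup>2) / e \<le> 0" using le True that by (simp add: divide_nonpos_pos)
    with integral_le_L2[OF \<Omega> f that] show ?thesis by (simp add: mult.commute)
  qed
  from nonpos_if_le_mult_epsilon[OF _ this] True show ?thesis by simp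
next
  case False
  then have d: "0 < sqrt d" using \<open>0 \<le> d\<close> by simp
  have "(LINT x|lebesgue_on \<Omega>. norm (f x)) \<le> sqrt d * measure lebesgue \<Omega> + (LINT x|lebesgue_on \<Omega>. (norm (f x))\<^sup>2) / sqrt d"
    by (rule integral_le_L2[OF \<Omega> f d])
  also have "(LINT x|lebesgue_on \<Omega>. (norm (f x))\<^sup>2) / sqrt d \<le> (C * d) / sqrt d"
    using le d by (intro divide_right_mono) auto
  also have "(C * d) / sqrt d = C * sqrt d" using \<open>0 \<le> d\<close> d by (simp add: field_simps)
  finally show ?thesis by (simp add: algebra_simps)
qed

lemma sqrt_sqrt_add3_le:
  assumes "0 \<le> a" "0 \<le> b" "0 \<le> c"
  shows "sqrt (sqrt (a + b + c)) \<le> a powr (1/4) + b powr (1/4) + c powr (1/4)"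
proof -
  have p: "sqrt (sqrt x) = x powr (1/4)" if "0 \<le> x" for x :: real
    using that by (simp add: powr_half_sqrt[symmetric] powr_powr)
  have s: "sqrt (sqrt (x + y)) \<le> sqrt (sqrt x) + sqrt (sqrt y)" if "0 \<le> x" "0 \<le> y" for x y :: real
  proof -
    have "sqrt (sqrt (x + y)) \<le> sqrt (sqrt x + sqrt y)" using that by (simp add: sqrt_add_le_add_sqrt)
    also have "\<dots> \<le> sqrt (sqrt x) + sqrt (sqrt y)" using that by (intro sqrt_add_le_add_sqrt) auto
    finally show ?thesis .
  qed
  show ?thesis using s[of "a + b" c] s[of a b] assms by (simp add: p[symmetric])
qed

lemma nn_integral_indicator_eq_LINT:
  fixes f :: "real^'n::finite \<Rightarrow> real"
  assumes "open \<Omega>" "integrable (lebesgue_on \<Omega>) f" "\<And>x. x \<in> \<Omega> \<Longrightarrow> 0 \<le> f x"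
  shows "(\<integral>\<^sup>+x. ennreal (f x) * indicator \<Omega> x \<partial>lborel) = ennreal (LINT x|lebesgue_on \<Omega>. f x)"
proof -
  have "(\<integral>\<^sup>+x. ennreal (f x) * indicator \<Omega> x \<partial>lborel) = (\<integral>\<^sup>+x. ennreal (f x) * indicator \<Omega> x \<partial>lebesgue)"
    by (rule nn_integral_completion[symmetric])
  also have "\<dots> = (\<integral>\<^sup>+x. ennreal (f x) \<partial>lebesgue_on \<Omega>)"
    using assms(1) by (subst nn_integral_restrict_space) auto
  also have "\<dots> = ennreal (LINT x|lebesgue_on \<Omega>. f x)"
    using assms by (intro nn_integral_eq_integral AE_lebesgue_onI) auto
  finally show ?thesis .
qed

text \<open>Dividing \<open>m \<le> \<sigma> x * norm (grad u x + F x) \<le> M\<close> by the bounds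
  on \<open>\<sigma>\<close> gives the two-sided gradient bounds. The lower one excludes critical
  points of \<open>u + f\<close>, so its level sets have charts everywhere.\<close>

lemma admissible_data:
  fixes \<Omega> :: "(real^3) set"
  assumes \<Omega>: "open \<Omega>" "bounded \<Omega>" and pos: "0 < m" "0 < \<sigma>0" "0 < \<sigma>1"
    and adm: "admissible \<sigma>0 \<sigma>1 m M \<Omega> a F H u \<sigma>"
    and F: "Ck_closure_field 2 \<Omega> F" "Ck_norm_field 2 \<Omega> F \<le> k2"
  shows admissible_deriv: "\<And>x. x \<in> \<Omega> \<Longrightarrow> (u has_derivative (\<lambda>k. grad u x \<bullet> k)) (at x)"
    and admissible_grad_cont: "continuous_on \<Omega> (grad u)"
    and admissible_field_cont: "continuous_on \<Omega> (\<lambda>x. grad u x + F x)"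
    and admissible_field_lower: "\<And>x. x \<in> \<Omega> \<Longrightarrow> m / \<sigma>1 \<le> norm (grad u x + F x)"
    and admissible_field_upper: "\<And>x. x \<in> \<Omega> \<Longrightarrow> norm (grad u x + F x) \<le> M / \<sigma>0"
    and admissible_grad_upper: "\<And>x. x \<in> \<Omega> \<Longrightarrow> norm (grad u x) \<le> M / \<sigma>0 + 3 * k2"
    and admissible_flux_cont: "continuous_on \<Omega> (flux \<sigma> u F)"
    and admissible_flux_bounds: "\<And>x. x \<in> \<Omega> \<Longrightarrow> m \<le> norm (flux \<sigma> u F x) \<and> norm (flux \<sigma> u F x) \<le> M"
    and admissible_flux_AE: "AE x in lebesgue_on \<Omega>. norm (flux \<sigma> u F x) = a x"
    and admissible_weak: "\<And>w G. H10 \<Omega> w G \<Longrightarrow> (LINT x|lebesgue_on \<Omega>. G x \<bullet> flux \<sigma> u F x + H x * w x) = 0"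
    and admissible_H10: "H10 \<Omega> u (grad u)"
proof -
  from adm have u: "Ck_closure 1 \<Omega> u" and \<sigma>: "continuous_on \<Omega> \<sigma>" "\<forall>x\<in>\<Omega>. \<sigma>0 \<le> \<sigma> x \<and> \<sigma> x \<le> \<sigma>1"
    and J: "\<forall>x\<in>\<Omega>. m \<le> norm (flux \<sigma> u F x) \<and> norm (flux \<sigma> u F x) \<le> M"
    and ds: "dual_solution \<Omega> a F H (flux \<sigma> u F)"
    and ae: "AE x in lebesgue_on \<Omega>. norm (flux \<sigma> u F x) = a x" and mini: "minimizer \<Omega> a F H u"
    by (simp_all add: admissible_def)
  show "\<And>x. x \<in> \<Omega> \<Longrightarrow> (u has_derivative (\<lambda>k. grad u x \<bullet> k)) (at x)"
    and c: "continuous_on \<Omega> (grad u)"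
    using Ck_closure_Suc_grad[of 0 \<Omega> u] u \<Omega>(2) by simp_all
  show cf: "continuous_on \<Omega> (\<lambda>x. grad u x + F x)"
    by (intro continuous_intros c Ck_closure_field_bounds[OF F \<Omega>(2)])
  show "continuous_on \<Omega> (flux \<sigma> u F)" unfolding flux_def by (intro continuous_intros \<sigma>(1) cf)
  have nf: "norm (flux \<sigma> u F x) = \<sigma> x * norm (grad u x + F x)" if "x \<in> \<Omega>" for x
    using \<sigma>(2) that pos(2) by (force simp: flux_def)
  show lo: "m / \<sigma>1 \<le> norm (grad u x + F x)" if "x \<in> \<Omega>" for x
  proof -
    have "m \<le> \<sigma> x * norm (grad u x + F x)" using J that nf[OF that] by auto
    also have "\<dots> \<le> \<sigma>1 * norm (grad u x + F x)" using \<sigma>(2) that by (intro mult_right_mono) auto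
    finally show ?thesis using pos by (simp add: divide_le_eq mult.commute)
  qed
  show up: "norm (grad u x + F x) \<le> M / \<sigma>0" if "x \<in> \<Omega>" for x
  proof -
    have "\<sigma>0 * norm (grad u x + F x) \<le> \<sigma> x * norm (grad u x + F x)" using \<sigma>(2) that by (intro mult_right_mono) auto
    also have "\<dots> \<le> M" using J that nf[OF that] by auto
    finally show ?thesis using pos by (simp add: le_divide_eq mult.commute)
  qed
  show "norm (grad u x) \<le> M / \<sigma>0 + 3 * k2" if "x \<in> \<Omega>" for x
    using norm_triangle_ineq4[of "grad u x + F x" "F x"] up[OF that] Ck_closure_field_bounds(2)[OF F \<Omega>(2) that] by simp
  show "\<And>x. x \<in> \<Omega> \<Longrightarrow> m \<le> norm (flux \<sigma> u F x) \<and> norm (flux \<sigma> u F x) \<le> M" using J by blast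
  show "AE x in lebesgue_on \<Omega>. norm (flux \<sigma> u F x) = a x" by (rule ae)
  show "\<And>w G. H10 \<Omega> w G \<Longrightarrow> (LINT x|lebesgue_on \<Omega>. G x \<bullet> flux \<sigma> u F x + H x * w x) = 0"
    using ds unfolding dual_solution_def dual_feasible_def by blast
  show "H10 \<Omega> u (grad u)" using mini by (simp add: minimizer_def)
qed

text \<open>The flux equation, tested with multiples of \<open>1 / \<sigma>\<close>, is a Poisson equation with bounded
  right-hand side.\<close>
lemma admissible_poisson:
  fixes \<Omega> :: "(real^3) set"
  assumes \<Omega>: "open \<Omega>" "bounded \<Omega>" and pos: "0 < m" "0 < \<sigma>0" "0 < \<sigma>1"
    and adm: "admissible \<sigma>0 \<sigma>1 m M \<Omega> a F H u \<sigma>"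
    and F: "Ck_closure_field 2 \<Omega> F" "Ck_norm_field 2 \<Omega> F \<le> k2"
    and H: "Ck_closure 1 \<Omega> H" "Ck_norm 1 \<Omega> H \<le> k2"
    and \<sigma>: "Ck_closure 2 \<Omega> \<sigma>" "Ck_norm 2 \<Omega> \<sigma> \<le> \<sigma>2"
  obtains Y where "continuous_on \<Omega> Y" "\<And>x. x \<in> \<Omega> \<Longrightarrow> \<bar>Y x\<bar> \<le> 3 * \<sigma>2 / \<sigma>0\<^sup>2 * M + k2 / \<sigma>0"
    "\<And>w G. H10 \<Omega> w G \<Longrightarrow> (LINT x|lebesgue_on \<Omega>. G x \<bullet> (grad u x + F x) + w x * Y x) = 0"
proof -
  note data = \<Omega> pos adm F
  let ?J = "flux \<sigma> u F"
  have \<sigma>0: "\<sigma>0 \<le> \<sigma> x" if "x \<in> \<Omega>" for x using adm that by (simp add: admissible_def)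
  have \<sigma>pos: "0 < \<sigma> x" if "x \<in> \<Omega>" for x using \<sigma>0[OF that] pos(2) by simp
  have \<sigma>ne: "\<sigma> x \<noteq> 0" if "x \<in> \<Omega>" for x using \<sigma>pos[OF that] by simp
  have \<sigma>': "Ck_closure (Suc 1) \<Omega> \<sigma>" using \<sigma>(1) by (simp only: Suc_1)
  have c\<sigma>: "continuous_on \<Omega> \<sigma>" by (rule Ck_closure_continuous_on[OF \<sigma>(1)])
  note g\<sigma> = Ck_closure_Suc_grad[OF \<sigma>' \<Omega>(2), unfolded Suc_1]
  have g\<sigma>_le: "norm (grad \<sigma> x) \<le> 3 * \<sigma>2" if "x \<in> \<Omega>" for x using g\<sigma>(3)[OF that] \<sigma>(2) by simp
  have H_le: "\<bar>H x\<bar> \<le> k2" if "x \<in> \<Omega>" for x by (rule order_trans[OF abs_le_Ck_norm[OF H(1) \<Omega>(2) that] H(2)])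
  have cH: "continuous_on \<Omega> H" by (rule Ck_closure_continuous_on[OF H(1)])
  define s where "s x = 1 / \<sigma> x" for x
  define ds where "ds x = (- 1 / (\<sigma> x)\<^sup>2) *\<^sub>R grad \<sigma> x" for x
  have cds: "continuous_on \<Omega> ds"
    unfolding ds_def using \<sigma>ne by (intro continuous_intros c\<sigma> g\<sigma>(2)) auto
  have ds: "(s has_derivative (\<lambda>k. ds x \<bullet> k)) (at x)" if "x \<in> \<Omega>" for x
  proof -
    have "((\<lambda>x. inverse (\<sigma> x)) has_derivative (\<lambda>k. - (inverse (\<sigma> x) * (grad \<sigma> x \<bullet> k) * inverse (\<sigma> x)))) (at x)"
      using \<sigma>pos[OF that] by (intro Deriv.has_derivative_inverse g\<sigma>(1)[OF that]) auto
    then show ?thesis by (simp add: s_def[abs_def] ds_def power2_eq_square field_simps)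
  qed
  \<comment> \<open>With \<open>s = 1 / \<sigma>\<close> the product
    \<open>s x *\<^sub>R ?J x\<close> is \<open>grad u x + F x\<close>; what the product rule leaves
    behind is this lower-order term.\<close>
  define Y where "Y x = ds x \<bullet> ?J x + H x * s x" for x
  have cs: "continuous_on \<Omega> s" unfolding s_def using \<sigma>ne by (intro continuous_intros c\<sigma>) auto
  have cJ: "continuous_on \<Omega> ?J" by (rule admissible_flux_cont[OF data])
  have J: "norm (?J x) \<le> M" if "x \<in> \<Omega>" for x using admissible_flux_bounds[OF data that] by simp
  \<comment> \<open>The gradient of \<open>s\<close> is at most that of \<open>\<sigma>\<close>
    divided by the square of \<open>\<sigma>0\<close>, and the flux is at most \<open>M\<close>; the
    second summand bounds \<open>H\<close> times \<open>s\<close>. The 3 comes from bounding a norm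
    by its three components.\<close>
  let ?CY = "3 * \<sigma>2 / \<sigma>0\<^sup>2 * M + k2 / \<sigma>0"
  have cY: "continuous_on \<Omega> Y" unfolding Y_def by (intro continuous_intros cds cs cJ cH)
  have Y: "\<bar>Y x\<bar> \<le> ?CY" if x: "x \<in> \<Omega>" for x
  proof -
    have "norm (ds x) = norm (grad \<sigma> x) / (\<sigma> x)\<^sup>2" by (simp add: ds_def)
    also have "\<dots> \<le> 3 * \<sigma>2 / \<sigma>0\<^sup>2"
      using g\<sigma>_le[OF x] \<sigma>0[OF x] pos(2) order_trans[OF norm_ge_zero g\<sigma>_le[OF x]] by (intro frac_le power_mono) auto
    finally have "norm (ds x) \<le> 3 * \<sigma>2 / \<sigma>0\<^sup>2" .
    then have "\<bar>ds x \<bullet> ?J x\<bar> \<le> 3 * \<sigma>2 / \<sigma>0\<^sup>2 * M"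
      by (intro order_trans[OF Cauchy_Schwarz_ineq2] mult_mono J x) (auto intro: order_trans[OF norm_ge_zero])
    moreover have "\<bar>H x * s x\<bar> \<le> k2 / \<sigma>0"
    proof -
      have "\<bar>H x * s x\<bar> = \<bar>H x\<bar> / \<sigma> x" using \<sigma>pos[OF x] by (simp add: s_def abs_mult)
      also have "\<dots> \<le> k2 / \<sigma>0"
        using H_le[OF x] \<sigma>0[OF x] pos(2) order_trans[OF abs_ge_zero H_le[OF x]] by (intro frac_le) auto
      finally show ?thesis .
    qed
    ultimately show ?thesis unfolding Y_def by linarith
  qed
  have sJ: "s x *\<^sub>R ?J x = grad u x + F x" if "x \<in> \<Omega>" for x using \<sigma>pos[OF that] by (simp add: s_def flux_def)
  have test: "(LINT x|lebesgue_on \<Omega>. grad \<phi> x \<bullet> (grad u x + F x) + \<phi> x * Y x) = 0" if \<phi>: "test_function \<Omega> \<phi>" for \<phi>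
  proof -
    have t: "(LINT x|lebesgue_on \<Omega>. grad \<psi> x \<bullet> ?J x + \<psi> x * H x) = 0" if "test_function \<Omega> \<psi>" for \<psi>
      using admissible_weak[OF data H10_test_function[OF \<Omega> that]] by (simp add: mult.commute)
    have "(LINT x|lebesgue_on \<Omega>. grad \<phi> x \<bullet> (s x *\<^sub>R ?J x) + \<phi> x * (ds x \<bullet> ?J x + H x * s x)) = 0"
    proof (rule weak_equation_multiplier[where B = "max M k2", OF \<Omega> cJ _ cH _ t ds cds \<phi>])
      show "norm (?J x) \<le> max M k2" "\<bar>H x\<bar> \<le> max M k2" if "x \<in> \<Omega>" for x
        using J[OF that] H_le[OF that] by auto
    qed
    moreover have "(LINT x|lebesgue_on \<Omega>. grad \<phi> x \<bullet> (s x *\<^sub>R ?J x) + \<phi> x * (ds x \<bullet> ?J x + H x * s x)) =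
      (LINT x|lebesgue_on \<Omega>. grad \<phi> x \<bullet> (grad u x + F x) + \<phi> x * Y x)"
      by (intro Bochner_Integration.integral_cong) (auto simp: space_restrict_space sJ Y_def)
    ultimately show ?thesis by simp
  qed
  show ?thesis
  proof (rule that[OF cY Y])
    fix w G assume w: "H10 \<Omega> w G"
    show "(LINT x|lebesgue_on \<Omega>. G x \<bullet> (grad u x + F x) + w x * Y x) = 0"
    proof (rule weak_equation_H10[where B = "max (M / \<sigma>0) ?CY", OF \<Omega> admissible_field_cont[OF data] _ cY _ test w])
      show "norm (grad u x + F x) \<le> max (M / \<sigma>0) ?CY" "\<bar>Y x\<bar> \<le> max (M / \<sigma>0) ?CY" if "x \<in> \<Omega>" for x
        using admissible_field_upper[OF data that] Y[OF that] by auto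
    qed
  qed
qed

text \<open>Writing vectors as length times direction, with \<open>t\<close> the inner product of
  the directions, the pairing \<open>(J - J') \<bullet> (p - p')\<close> splits into
  \<open>(\<alpha> - \<alpha>') * (P - P')\<close> and
  \<open>(\<alpha> * P' + \<alpha>' * P) * (1 - t)\<close>. The second part is at least
  \<open>m * c\<close> times the squared distance of the directions, which equals
  \<open>2 - 2 * t\<close>. The first has no sign and is paid for by the difference of the flux
  lengths, that is by \<open>|a - a'|\<close> almost everywhere.\<close>

lemma direction_monotonicity:
  fixes p p' :: "'a::real_inner"
  assumes "0 < c" "c \<le> norm p" "c \<le> norm p'" "norm p \<le> C" "norm p' \<le> C" "0 < m" "m \<le> norm J" "m \<le> norm J'"
    and J: "J = s *\<^sub>R p" "J' = s' *\<^sub>R p'" "0 < s" "0 < s'"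
  shows "m * c * (norm (sgn p - sgn p'))\<^sup>2 \<le> (J - J') \<bullet> (p - p') + C * \<bar>norm J - norm J'\<bar>"
proof -
  define P where "P = norm p"
  define P' where "P' = norm p'"
  define \<alpha> where "\<alpha> = norm J"
  define \<alpha>' where "\<alpha>' = norm J'"
  define n where "n = sgn p"
  define n' where "n' = sgn p'"
  have pos: "0 < P" "0 < P'" using assms(1-3) by (auto simp: P_def P'_def)
  have p: "p = P *\<^sub>R n" "p' = P' *\<^sub>R n'" using pos by (simp_all add: P_def P'_def n_def n'_def sgn_div_norm)
  have \<alpha>: "\<alpha> = s * P" "\<alpha>' = s' * P'" using J by (simp_all add: \<alpha>_def \<alpha>'_def P_def P'_def)
  have n: "n \<bullet> n = 1" "n' \<bullet> n' = 1"
    using pos by (simp_all add: n_def n'_def P_def P'_def sgn_div_norm dot_square_norm power2_eq_square)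
  have Jn: "J = \<alpha> *\<^sub>R n" "J' = \<alpha>' *\<^sub>R n'" using J(1,2) p \<alpha> by simp_all
  define t where "t = n \<bullet> n'"
  have sq: "(norm (n - n'))\<^sup>2 = 2 - 2 * t"
    by (simp add: power2_norm_eq_inner inner_diff_left inner_diff_right n t_def inner_commute)
  have dot: "(J - J') \<bullet> (p - p') = (\<alpha> - \<alpha>') * (P - P') + (\<alpha> * P' + \<alpha>' * P) * (1 - t)"
    unfolding Jn p by (simp add: inner_diff_left inner_diff_right n t_def inner_commute algebra_simps)
  have "m * c + m * c \<le> \<alpha> * P' + \<alpha>' * P"
    using assms(1-3,6-8) by (intro add_mono mult_mono) (auto simp: P_def P'_def \<alpha>_def \<alpha>'_def)
  moreover have "0 \<le> 1 - t" using sq zero_le_power2[of "norm (n - n')"] by linarith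
  ultimately have "(m * c + m * c) * (1 - t) \<le> (\<alpha> * P' + \<alpha>' * P) * (1 - t)" by (rule mult_right_mono)
  moreover have "- ((\<alpha> - \<alpha>') * (P - P')) \<le> C * \<bar>\<alpha> - \<alpha>'\<bar>"
  proof -
    have "\<bar>P - P'\<bar> \<le> C" using assms(4,5) norm_ge_zero[of p] norm_ge_zero[of p'] unfolding P_def P'_def by linarith
    then have "\<bar>\<alpha> - \<alpha>'\<bar> * \<bar>P - P'\<bar> \<le> \<bar>\<alpha> - \<alpha>'\<bar> * C" by (intro mult_left_mono) auto
    then show ?thesis using abs_ge_minus_self[of "(\<alpha> - \<alpha>') * (P - P')"] by (simp add: abs_mult mult.commute)
  qed
  ultimately show ?thesis
    unfolding n_def[symmetric] n'_def[symmetric] sq dot \<alpha>_def[symmetric] \<alpha>'_def[symmetric] by (simp add: algebra_simps)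
qed

text \<open>A vector of length \<open>norm p'\<close> in the direction of \<open>p\<close> is a
  multiple of \<open>p\<close>. Subtracting it leaves only the difference of directions and
  \<open>f\<close>. With \<open>p\<close> the gradient of \<open>v\<close>, the multiple is normal
  to the level set.\<close>

lemma gradient_difference_split:
  fixes p p' :: "'a::real_inner"
  assumes "0 < norm p" "norm p' \<le> C"
  shows "\<exists>\<mu> e. p - p' - f = \<mu> *\<^sub>R p + e \<and> norm e \<le> C * norm (sgn p - sgn p') + norm f"
proof (intro exI conjI)
  let ?e = "norm p' *\<^sub>R (sgn p - sgn p') - f"
  have "norm p' *\<^sub>R sgn p' = p'" by (cases "p' = 0") (simp_all add: sgn_div_norm)
  then show "p - p' - f = (1 - norm p' / norm p) *\<^sub>R p + ?e"
    using assms(1) by (simp add: sgn_div_norm scaleR_diff_left scaleR_diff_right divide_inverse)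
  have "norm ?e \<le> norm p' * norm (sgn p - sgn p') + norm f"
    using norm_triangle_ineq4[of "norm p' *\<^sub>R (sgn p - sgn p')" f] by simp
  also have "\<dots> \<le> C * norm (sgn p - sgn p') + norm f" using assms(2) by (intro add_right_mono mult_right_mono) auto
  finally show "norm ?e \<le> \<dots>" .
qed

text \<open>Here \<open>c\<close>, \<open>C\<close> and \<open>L\<close> bound gradients,
  \<open>CY\<close> the Poisson right-hand sides, \<open>CP\<close> is the factor of
  \<open>foliated_poincare\<close>, \<open>C2\<close> that of the direction estimate,
  \<open>\<Phi>\<close> that of the field difference and \<open>C3\<close> that of the L1 norm of
  \<open>w\<close>. The bracket added to \<open>V\<close> is the factor for the squared L2 norm of
  the gradient difference. \<open>R\<close> is the radius of a ball around \<open>\<Omega>\<close>.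
  The truncations \<open>max 0\<close> match the conversion of possibly negative reals to
  \<open>ennreal\<close>.\<close>

definition stability_constant :: "(real^3) set \<Rightarrow> real \<Rightarrow> real \<Rightarrow> real \<Rightarrow> real \<Rightarrow> real \<Rightarrow> real \<Rightarrow> real \<Rightarrow> real \<Rightarrow> real \<Rightarrow> real \<Rightarrow> real" where
  "stability_constant \<Omega> m M k2 K \<sigma>0 \<sigma>1 \<sigma>2 cg Cg R =
    (let V = measure lebesgue \<Omega>; c = m / \<sigma>1; C = M / \<sigma>0; L = C + 3 * k2;
       CY = 3 * \<sigma>2 / \<sigma>0\<^sup>2 * M + k2 / \<sigma>0; \<beta> = 1 + C / (c / 2);
       CP = max 0 K * max 0 (2 * Cg * \<beta>\<^sup>2) * C / (cg / 3 * (c / 2));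
       C2 = (4 * L * R * V + 2 * M + C * V) / (m * c); \<Phi> = sqrt (6 * k2 * V);
       C3 = CP * (C * (V + C2) + \<Phi>)
     in V + (2 * CY * C3 + 2 * L * \<Phi>))"

lemma stability_estimate:
  fixes \<Omega> :: "(real^3) set" and m M k2 K \<sigma>0 \<sigma>1 \<sigma>2 cg Cg R :: real
  assumes \<Omega>: "open \<Omega>" "bounded \<Omega>" "\<Omega> \<noteq> {}" and R: "\<And>x. x \<in> \<Omega> \<Longrightarrow> norm x \<le> R"
    and pos: "0 < m" "0 < \<sigma>0" "0 < \<sigma>1" and "0 < cg"
    and a: "a \<in> borel_measurable (lebesgue_on \<Omega>)" "AE x in lebesgue_on \<Omega>. m \<le> a x \<and> a x \<le> M"
    and a': "a' \<in> borel_measurable (lebesgue_on \<Omega>)" "AE x in lebesgue_on \<Omega>. m \<le> a' x \<and> a' x \<le> M"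
    and f: "Ck_on 1 \<Omega> f" "\<And>x. x \<in> \<Omega> \<Longrightarrow> F x = grad f x"
    and adm: "admissible \<sigma>0 \<sigma>1 m M \<Omega> a F H u \<sigma>" and adm': "admissible \<sigma>0 \<sigma>1 m M \<Omega> a' F' H' u' \<sigma>'"
    and bdry: "\<And>x. x \<in> frontier \<Omega> \<Longrightarrow> u x = 0 \<and> u' x = 0"
    and F: "Ck_closure_field 2 \<Omega> F" "Ck_norm_field 2 \<Omega> F \<le> k2"
    and F': "Ck_closure_field 2 \<Omega> F'" "Ck_norm_field 2 \<Omega> F' \<le> k2"
    and H: "Ck_closure 1 \<Omega> H" "Ck_norm 1 \<Omega> H \<le> k2" and H': "Ck_closure 1 \<Omega> H'" "Ck_norm 1 \<Omega> H' \<le> k2"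
    and \<sigma>: "Ck_closure 2 \<Omega> \<sigma>" "Ck_norm 2 \<Omega> \<sigma> \<le> \<sigma>2" and \<sigma>': "Ck_closure 2 \<Omega> \<sigma>'" "Ck_norm 2 \<Omega> \<sigma>' \<le> \<sigma>2"
    and fol: "foliation \<Omega> (\<lambda>x. u x + f x) g cg Cg K"
  shows "L1_norm \<Omega> (\<lambda>x. grad u x - grad u' x)
    \<le> stability_constant \<Omega> m M k2 K \<sigma>0 \<sigma>1 \<sigma>2 cg Cg R * (Linf_norm \<Omega> (\<lambda>x. H x - H' x) powr (1/4) + Linf_norm \<Omega> (\<lambda>x. a x - a' x) powr (1/4)
      + L1_norm \<Omega> (\<lambda>x. F x - F' x) powr (1/4))"
proof -
  define V where "V = measure lebesgue \<Omega>"
  define c where "c = m / \<sigma>1"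
  define C where "C = M / \<sigma>0"
  define L where "L = C + 3 * k2"
  define CY where "CY = 3 * \<sigma>2 / \<sigma>0\<^sup>2 * M + k2 / \<sigma>0"
  define \<beta> where "\<beta> = 1 + C / (c / 2)"
  define CP where "CP = max 0 K * max 0 (2 * Cg * \<beta>\<^sup>2) * C / (cg / 3 * (c / 2))"
  define C2 where "C2 = (4 * L * R * V + 2 * M + C * V) / (m * c)"
  define \<Phi> where "\<Phi> = sqrt (6 * k2 * V)"
  define C3 where "C3 = CP * (C * (V + C2) + \<Phi>)"
  define C4 where "C4 = 2 * CY * C3 + 2 * L * \<Phi>"
  have const_eq: "stability_constant \<Omega> m M k2 K \<sigma>0 \<sigma>1 \<sigma>2 cg Cg R = V + C4"
    by (simp only: stability_constant_def Let_def V_def c_def C_def L_def CY_def \<beta>_def CP_def C2_def \<Phi>_def C3_def C4_def)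
  note dat = \<Omega>(1,2) pos adm F and dat' = \<Omega>(1,2) pos adm' F'
  define p where "p x = grad u x + F x" for x
  define p' where "p' x = grad u' x + F' x" for x
  define J where "J = flux \<sigma> u F"
  define J' where "J' = flux \<sigma>' u' F'"
  define w where "w x = u x - u' x" for x
  define dw where "dw x = grad u x - grad u' x" for x
  define n where "n x = sgn (p x) - sgn (p' x)" for x
  define dF where "dF x = F x - F' x" for x
  define h where "h = Linf_norm \<Omega> (\<lambda>x. H x - H' x)"
  define A where "A = Linf_norm \<Omega> (\<lambda>x. a x - a' x)"
  define \<phi> where "\<phi> = L1_norm \<Omega> dF"
  define \<delta> where "\<delta> = h + A + \<phi>"
  obtain x0 where x0: "x0 \<in> \<Omega>" using \<Omega>(3) by auto
  have c0: "0 < c" using pos by (simp add: c_def)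
  have M: "m \<le> M" using admissible_flux_bounds[OF dat x0] by linarith
  have C0: "0 < C" using M pos by (simp add: C_def)
  have V0: "0 \<le> V" by (simp add: V_def)
  have k2: "0 \<le> k2" using order_trans[OF norm_ge_zero Ck_closure_field_bounds(2)[OF F \<Omega>(2) x0]] by simp
  have L0: "0 \<le> L" using C0 k2 by (simp add: L_def)
  have R0: "0 \<le> R" using order_trans[OF norm_ge_zero R[OF x0]] .
  have \<sigma>2: "0 \<le> \<sigma>2" using order_trans[OF abs_ge_zero order_trans[OF abs_le_Ck_norm[OF \<sigma>(1) \<Omega>(2) x0] \<sigma>(2)]] .
  have CY0: "0 \<le> CY" using \<sigma>2 M pos k2 by (simp add: CY_def)
  have \<beta>0: "0 \<le> \<beta>" using C0 c0 by (simp add: \<beta>_def)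
  have CP0: "0 \<le> CP" using C0 c0 \<open>0 < cg\<close> by (simp add: CP_def)
  have C20: "0 \<le> C2" using L0 R0 V0 M pos C0 c0 by (simp add: C2_def)
  have \<Phi>0: "0 \<le> \<Phi>" using k2 V0 by (simp add: \<Phi>_def)
  have C30: "0 \<le> C3" using CP0 C0 V0 C20 \<Phi>0 by (simp add: C3_def)
  have C40: "0 \<le> C4" using CY0 C30 L0 \<Phi>0 by (simp add: C4_def)
  interpret finite_measure "lebesgue_on \<Omega>" by (rule lebesgue_on_open_bounded[OF \<Omega>(1,2)])
  have const: "(LINT x|lebesgue_on \<Omega>. b) = b * V" for b :: real
    using lebesgue_on_open_bounded(1)[OF \<Omega>(1,2)] by (simp add: V_def measure_restrict_space space_restrict_space)

  \<comment> \<open>Pointwise bounds for both solutions\<close>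
  have cp: "continuous_on \<Omega> p" "continuous_on \<Omega> p'"
    unfolding p_def p'_def using admissible_field_cont[OF dat] admissible_field_cont[OF dat'] by auto
  have plo: "c \<le> norm (p x)" "c \<le> norm (p' x)" and pup: "norm (p x) \<le> C" "norm (p' x) \<le> C" if "x \<in> \<Omega>" for x
    unfolding p_def p'_def c_def C_def
    using admissible_field_lower[OF dat that] admissible_field_lower[OF dat' that]
      admissible_field_upper[OF dat that] admissible_field_upper[OF dat' that] by auto
  have pne: "p x \<noteq> 0" "p' x \<noteq> 0" if "x \<in> \<Omega>" for x using plo[OF that] c0 by auto
  have cJ: "continuous_on \<Omega> J" "continuous_on \<Omega> J'"
    unfolding J_def J'_def using admissible_flux_cont[OF dat] admissible_flux_cont[OF dat'] by auto
  have Jlo: "m \<le> norm (J x)" "m \<le> norm (J' x)" and Jup: "norm (J x) \<le> M" "norm (J' x) \<le> M" if "x \<in> \<Omega>" for x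
    unfolding J_def J'_def using admissible_flux_bounds[OF dat that] admissible_flux_bounds[OF dat' that] by auto
  have cF: "continuous_on \<Omega> F" "continuous_on \<Omega> F'"
    using Ck_closure_field_bounds(1)[OF F \<Omega>(2)] Ck_closure_field_bounds(1)[OF F' \<Omega>(2)] by auto
  have Fle: "norm (F x) \<le> 3 * k2" "norm (F' x) \<le> 3 * k2" if "x \<in> \<Omega>" for x
    using Ck_closure_field_bounds(2)[OF F \<Omega>(2) that] Ck_closure_field_bounds(2)[OF F' \<Omega>(2) that] by auto
  have cdF: "continuous_on \<Omega> dF" unfolding dF_def by (intro continuous_intros cF)
  have dF_le: "norm (dF x) \<le> 6 * k2" if "x \<in> \<Omega>" for x
    using norm_triangle_ineq4[of "F x" "F' x"] Fle[OF that] by (simp add: dF_def)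
  have du: "(u has_derivative (\<lambda>k. grad u x \<bullet> k)) (at x)" "(u' has_derivative (\<lambda>k. grad u' x \<bullet> k)) (at x)"
    and gle: "norm (grad u x) \<le> L" "norm (grad u' x) \<le> L" if "x \<in> \<Omega>" for x
    using admissible_deriv[OF dat that] admissible_deriv[OF dat' that]
      admissible_grad_upper[OF dat that] admissible_grad_upper[OF dat' that] by (auto simp: L_def C_def)
  have cg: "continuous_on \<Omega> (grad u)" "continuous_on \<Omega> (grad u')"
    using admissible_grad_cont[OF dat] admissible_grad_cont[OF dat'] by auto
  have cu: "continuous_on (closure \<Omega>) u" "continuous_on (closure \<Omega>) u'"
    using adm adm' by (simp_all add: admissible_def)
  have ule: "\<bar>u x\<bar> \<le> L * (2 * R)" "\<bar>u' x\<bar> \<le> L * (2 * R)" if "x \<in> \<Omega>" for x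
    using abs_le_of_zero_on_frontier[OF \<Omega>(1) R cu(1) _ du(1) gle(1) that]
      abs_le_of_zero_on_frontier[OF \<Omega>(1) R cu(2) _ du(2) gle(2) that] bdry by auto
  have w_le: "\<bar>w x\<bar> \<le> 4 * L * R" if "x \<in> \<Omega>" for x using ule[OF that] by (auto simp: w_def)
  have cwc: "continuous_on (closure \<Omega>) w" unfolding w_def by (intro continuous_intros cu)
  have cw: "continuous_on \<Omega> w" using cwc closure_subset by (rule continuous_on_subset)
  have ddw: "(w has_derivative (\<lambda>k. dw x \<bullet> k)) (at x)" if "x \<in> \<Omega>" for x
    unfolding w_def dw_def inner_diff_left using du[OF that] by (rule has_derivative_diff)
  have cdw: "continuous_on \<Omega> dw" unfolding dw_def by (intro continuous_intros cg)
  have dw_le: "norm (dw x) \<le> 2 * L" if "x \<in> \<Omega>" for x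
    using norm_triangle_ineq4[of "grad u x" "grad u' x"] gle[OF that] by (simp add: dw_def)
  have dwp: "dw x = p x - p' x - dF x" for x by (simp add: dw_def p_def p'_def dF_def)
  have cn: "continuous_on \<Omega> n"
    unfolding n_def sgn_div_norm using pne by (intro continuous_intros cp) auto
  have n_le: "norm (n x) \<le> 2" for x
    using norm_triangle_ineq4[of "sgn (p x)" "sgn (p' x)"] by (simp add: n_def norm_sgn split: if_splits)
  have cH: "continuous_on \<Omega> H" "continuous_on \<Omega> H'"
    using Ck_closure_continuous_on[OF H(1)] Ck_closure_continuous_on[OF H'(1)] by auto
  have H_le: "\<bar>H x\<bar> \<le> k2" "\<bar>H' x\<bar> \<le> k2" if "x \<in> \<Omega>" for x
    using order_trans[OF abs_le_Ck_norm[OF H(1) \<Omega>(2) that] H(2)] order_trans[OF abs_le_Ck_norm[OF H'(1) \<Omega>(2) that] H'(2)] .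
  note ic = integrable_lebesgue_on_continuous[OF \<Omega>(1,2)]
  have id: "integrable (lebesgue_on \<Omega>) (\<lambda>x. norm (dF x))"
    by (rule ic[where B = "6 * k2"]) (auto intro!: continuous_intros cdF dF_le)
  have iw: "integrable (lebesgue_on \<Omega>) (\<lambda>x. \<bar>w x\<bar>)"
    by (rule ic[where B = "4 * L * R"]) (auto intro!: continuous_intros cw w_le)
  have \<phi>_eq: "\<phi> = (LINT x|lebesgue_on \<Omega>. norm (dF x))" by (simp add: \<phi>_def L1_norm_def)
  have \<phi>0: "0 \<le> \<phi>" unfolding \<phi>_eq by (rule integral_nonneg_AE) simp
  have h: "AE x in lebesgue_on \<Omega>. \<bar>H x - H' x\<bar> \<le> h" "0 \<le> h"
  proof -
    have mH: "(\<lambda>x. H x - H' x) \<in> borel_measurable (lebesgue_on \<Omega>)"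
      by (intro continuous_on_borel_measurable_lebesgue_on \<Omega>(1) continuous_intros cH)
    have bH: "AE x in lebesgue_on \<Omega>. \<bar>H x - H' x\<bar> \<le> 2 * k2"
      by (rule AE_lebesgue_onI) (use H_le in fastforce)
    show "AE x in lebesgue_on \<Omega>. \<bar>H x - H' x\<bar> \<le> h" "0 \<le> h"
      unfolding h_def by (rule Linf_norm_bound[OF \<Omega>(1,3) mH bH])+
  qed
  have A: "AE x in lebesgue_on \<Omega>. \<bar>norm (J x) - norm (J' x)\<bar> \<le> A" "0 \<le> A"
  proof -
    have mA: "(\<lambda>x. a x - a' x) \<in> borel_measurable (lebesgue_on \<Omega>)" using a(1) a'(1) by simp
    have bA: "AE x in lebesgue_on \<Omega>. \<bar>a x - a' x\<bar> \<le> M"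
      using a(2) a'(2) by eventually_elim (use pos in auto)
    have "AE x in lebesgue_on \<Omega>. \<bar>a x - a' x\<bar> \<le> A" unfolding A_def by (rule Linf_norm_bound[OF \<Omega>(1,3) mA bA])
    with admissible_flux_AE[OF dat] admissible_flux_AE[OF dat']
    show "AE x in lebesgue_on \<Omega>. \<bar>norm (J x) - norm (J' x)\<bar> \<le> A"
      unfolding J_def J'_def by eventually_elim simp
    show "0 \<le> A" unfolding A_def by (rule Linf_norm_bound[OF \<Omega>(1,3) mA bA])
  qed
  have \<delta>0: "0 \<le> \<delta>" using h A \<phi>0 by (simp add: \<delta>_def)
  have iGJ: "integrable (lebesgue_on \<Omega>) (\<lambda>x. G x \<bullet> X x + Y x * v x)"
    if "continuous_on \<Omega> G" "continuous_on \<Omega> X" "continuous_on \<Omega> Y" "continuous_on \<Omega> v"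
      and bnd: "\<And>x. x \<in> \<Omega> \<Longrightarrow> norm (G x) \<le> b1" "\<And>x. x \<in> \<Omega> \<Longrightarrow> norm (X x) \<le> b2"
        "\<And>x. x \<in> \<Omega> \<Longrightarrow> \<bar>Y x\<bar> \<le> b3" "\<And>x. x \<in> \<Omega> \<Longrightarrow> \<bar>v x\<bar> \<le> b4"
    for G X :: "real^3 \<Rightarrow> real^3" and Y v :: "real^3 \<Rightarrow> real" and b1 b2 b3 b4
  proof (rule ic[where B = "b1 * b2 + b3 * b4"])
    show "continuous_on \<Omega> (\<lambda>x. G x \<bullet> X x + Y x * v x)" by (intro continuous_intros that)
    fix x assume x: "x \<in> \<Omega>"
    have "\<bar>G x \<bullet> X x\<bar> \<le> b1 * b2"
      by (rule order_trans[OF Cauchy_Schwarz_ineq2 mult_mono[OF bnd(1,2)[OF x] order_trans[OF norm_ge_zero bnd(1)[OF x]] norm_ge_zero]])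
    moreover have "\<bar>Y x * v x\<bar> \<le> b3 * b4" unfolding abs_mult
      by (rule mult_mono[OF bnd(3,4)[OF x] order_trans[OF abs_ge_zero bnd(3)[OF x]] abs_ge_zero])
    ultimately show "norm (G x \<bullet> X x + Y x * v x) \<le> b1 * b2 + b3 * b4" by simp
  qed
  have cu': "continuous_on \<Omega> u" "continuous_on \<Omega> u'"
    using cu closure_subset by (auto intro: continuous_on_subset)
  note Hu = admissible_H10[OF dat] admissible_H10[OF dat']

  \<comment> \<open>Directions in L2\<close>
  have n2: "(LINT x|lebesgue_on \<Omega>. (norm (n x))\<^sup>2) \<le> C2 * \<delta>"
  proof -
    have i1: "integrable (lebesgue_on \<Omega>) (\<lambda>x. G x \<bullet> J x + H x * v x)"
      "integrable (lebesgue_on \<Omega>) (\<lambda>x. G x \<bullet> J' x + H' x * v x)"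
      if "continuous_on \<Omega> G" "continuous_on \<Omega> v" "\<And>x. x \<in> \<Omega> \<Longrightarrow> norm (G x) \<le> L" "\<And>x. x \<in> \<Omega> \<Longrightarrow> \<bar>v x\<bar> \<le> L * (2 * R)" for G v
      by (rule iGJ[OF that(1) cJ(1) cH(1) that(2) that(3) Jup(1) H_le(1) that(4)], assumption+)
         (rule iGJ[OF that(1) cJ(2) cH(2) that(2) that(3) Jup(2) H_le(2) that(4)], assumption+)
    note iu = i1[OF cg(1) cu'(1) gle(1) ule(1)] i1[OF cg(2) cu'(2) gle(2) ule(2)]
    have z: "(LINT x|lebesgue_on \<Omega>. grad u x \<bullet> J x + H x * u x) = 0" "(LINT x|lebesgue_on \<Omega>. grad u' x \<bullet> J x + H x * u' x) = 0"
      "(LINT x|lebesgue_on \<Omega>. grad u x \<bullet> J' x + H' x * u x) = 0" "(LINT x|lebesgue_on \<Omega>. grad u' x \<bullet> J' x + H' x * u' x) = 0"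
      unfolding J_def J'_def using admissible_weak[OF dat] admissible_weak[OF dat'] Hu by blast+
    \<comment> \<open>The integrand of the difference of the two equations tested with the
      difference of the solutions. It is assembled from four separate tests with \<open>u\<close>
      and \<open>u'\<close>, so membership of \<open>w\<close> in \<open>H10\<close> never has to be
      shown.\<close>
    define E where "E x = ((grad u x \<bullet> J x + H x * u x) - (grad u' x \<bullet> J x + H x * u' x))
        - ((grad u x \<bullet> J' x + H' x * u x) - (grad u' x \<bullet> J' x + H' x * u' x))" for x
    have iE: "integrable (lebesgue_on \<Omega>) E" and E0: "(LINT x|lebesgue_on \<Omega>. E x) = 0"
      unfolding E_def using iu z by simp_all
    have E: "E x = (J x - J' x) \<bullet> dw x + (H x - H' x) * w x" for x
      by (simp add: E_def dw_def w_def inner_diff_left inner_diff_right inner_commute algebra_simps)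
    have in2: "integrable (lebesgue_on \<Omega>) (\<lambda>x. (norm (n x))\<^sup>2)"
      by (rule ic[where B = 4]) (use n_le in \<open>auto intro!: continuous_intros cn power_mono[of _ 2 2, simplified]\<close>)
    \<comment> \<open>Replacing \<open>dw\<close> by \<open>p - p'\<close> costs
      \<open>(J - J') \<bullet> dF\<close>, at most \<open>2 * M * norm (dF x)\<close>; the
      difference of the right-hand sides is paid with the sup bound \<open>4 * L * R\<close> of
      \<open>w\<close>, and \<open>C * A\<close> comes from the flux lengths.\<close>
    have "(LINT x|lebesgue_on \<Omega>. m * c * (norm (n x))\<^sup>2) \<le>
        (LINT x|lebesgue_on \<Omega>. E x + (2 * M * norm (dF x) + (h * (4 * L * R) + C * A)))"
    proof (rule integral_mono_AE)
      show "integrable (lebesgue_on \<Omega>) (\<lambda>x. m * c * (norm (n x))\<^sup>2)" using in2 by simp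
      show "integrable (lebesgue_on \<Omega>) (\<lambda>x. E x + (2 * M * norm (dF x) + (h * (4 * L * R) + C * A)))"
        using iE id by simp
      have "AE x in lebesgue_on \<Omega>. x \<in> \<Omega>" by (rule AE_lebesgue_onI)
      then show "AE x in lebesgue_on \<Omega>. m * c * (norm (n x))\<^sup>2 \<le> E x + (2 * M * norm (dF x) + (h * (4 * L * R) + C * A))"
        using h(1) A(1)
      proof eventually_elim
        fix x assume x: "x \<in> \<Omega>" and hx: "\<bar>H x - H' x\<bar> \<le> h" and Ax: "\<bar>norm (J x) - norm (J' x)\<bar> \<le> A"
        have s: "0 < \<sigma> x" "0 < \<sigma>' x" using adm adm' x pos by (force simp: admissible_def)+
        have "m * c * (norm (n x))\<^sup>2 \<le> (J x - J' x) \<bullet> (p x - p' x) + C * \<bar>norm (J x) - norm (J' x)\<bar>"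
          unfolding n_def
          by (rule direction_monotonicity[OF c0 plo[OF x] pup[OF x] pos(1) Jlo[OF x] _ _ s])
             (simp_all add: J_def J'_def flux_def p_def p'_def)
        moreover have "(J x - J' x) \<bullet> (p x - p' x) = E x - (H x - H' x) * w x + (J x - J' x) \<bullet> dF x"
          unfolding E by (simp add: dwp inner_diff_right)
        moreover have "- ((H x - H' x) * w x) \<le> h * (4 * L * R)"
        proof -
          have "\<bar>(H x - H' x) * w x\<bar> \<le> h * (4 * L * R)" unfolding abs_mult
            by (rule mult_mono[OF hx w_le[OF x] h(2) abs_ge_zero])
          then show ?thesis by linarith
        qed
        moreover have "(J x - J' x) \<bullet> dF x \<le> 2 * M * norm (dF x)"
        proof -
          have "norm (J x - J' x) \<le> 2 * M" using norm_triangle_ineq4[of "J x" "J' x"] Jup[OF x] by linarith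
          then have "norm (J x - J' x) * norm (dF x) \<le> 2 * M * norm (dF x)" by (rule mult_right_mono) simp
          then show ?thesis using norm_cauchy_schwarz[of "J x - J' x" "dF x"] by linarith
        qed
        moreover have "C * \<bar>norm (J x) - norm (J' x)\<bar> \<le> C * A" using Ax C0 by (intro mult_left_mono) auto
        ultimately show "m * c * (norm (n x))\<^sup>2 \<le> E x + (2 * M * norm (dF x) + (h * (4 * L * R) + C * A))" by linarith
      qed
    qed
    also have "\<dots> = 2 * M * \<phi> + (h * (4 * L * R) + C * A) * V"
      using iE id E0 unfolding \<phi>_eq by (simp add: const[simplified])
    also have "\<dots> \<le> (4 * L * R * V + 2 * M + C * V) * \<delta>"
    proof -
      have "2 * M * \<phi> \<le> 2 * M * \<delta>" "(4 * L * R * V) * h \<le> (4 * L * R * V) * \<delta>" "(C * V) * A \<le> (C * V) * \<delta>"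
        using h(2) A(2) \<phi>0 M pos L0 R0 V0 C0 by (auto intro!: mult_left_mono simp: \<delta>_def)
      then show ?thesis by (simp add: algebra_simps)
    qed
    finally have "m * c * (LINT x|lebesgue_on \<Omega>. (norm (n x))\<^sup>2) \<le> (4 * L * R * V + 2 * M + C * V) * \<delta>" by simp
    then show ?thesis using pos(1) c0 by (simp add: C2_def le_divide_eq mult_ac)
  qed
  have L2: "in_L2 \<Omega> n" "in_L2 \<Omega> dw"
    using in_L2_bounded_continuous[OF \<Omega>(1,2) cn n_le] in_L2_bounded_continuous[OF \<Omega>(1,2) cdw dw_le] by auto
  have n1: "(LINT x|lebesgue_on \<Omega>. norm (n x)) \<le> (V + C2) * sqrt \<delta>"
    unfolding V_def by (rule integral_norm_le_sqrt[OF \<Omega>(1,2) L2(1) \<delta>0 C20 n2])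
  \<comment> \<open>Since \<open>\<phi>\<close> is at most \<open>\<delta>\<close> and also at most
    the a priori bound \<open>6 * k2 * V\<close>, its square is at most their product. This puts the
    field difference on the same scale as the other terms.\<close>
  have \<phi>_sqrt: "\<phi> \<le> \<Phi> * sqrt \<delta>"
  proof -
    have "\<phi> \<le> (LINT x|lebesgue_on \<Omega>. 6 * k2)" unfolding \<phi>_eq
      using id dF_le by (intro integral_mono) (auto simp: space_restrict_space)
    then have "\<phi> \<le> 6 * k2 * V" by (simp only: const)
    then have "\<phi> * \<phi> \<le> (6 * k2 * V) * \<delta>" using \<phi>0 h(2) A(2) k2 V0 by (intro mult_mono) (auto simp: \<delta>_def)
    then have "sqrt (\<phi> * \<phi>) \<le> sqrt ((6 * k2 * V) * \<delta>)" by (rule real_sqrt_le_mono)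
    then show ?thesis using \<phi>0 by (simp add: \<Phi>_def real_sqrt_mult)
  qed
  \<comment> \<open>The bound from \<open>gradient_difference_split\<close> for the part of
    \<open>dw\<close> that is tangential to the level sets of \<open>u + f\<close>.\<close>
  define q where "q x = C * norm (n x) + norm (dF x)" for x
  have cq: "continuous_on \<Omega> q" unfolding q_def by (intro continuous_intros cn cdF)
  have i_n: "integrable (lebesgue_on \<Omega>) (\<lambda>x. norm (n x))" by (rule integrable_in_L2(1)[OF \<Omega>(1,2) L2(1)])
  have iq: "integrable (lebesgue_on \<Omega>) q" unfolding q_def using i_n id by simp
  have q0: "0 \<le> q x" for x using C0 by (simp add: q_def)
  have q_int: "(LINT x|lebesgue_on \<Omega>. q x) \<le> (C * (V + C2) + \<Phi>) * sqrt \<delta>"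
  proof -
    have "(LINT x|lebesgue_on \<Omega>. q x) = C * (LINT x|lebesgue_on \<Omega>. norm (n x)) + \<phi>"
      unfolding q_def \<phi>_eq using i_n id by simp
    also have "\<dots> \<le> C * ((V + C2) * sqrt \<delta>) + \<Phi> * sqrt \<delta>"
      using n1 \<phi>_sqrt C0 by (intro add_mono mult_left_mono) auto
    finally show ?thesis by (simp add: algebra_simps)
  qed
  have w1: "(LINT x|lebesgue_on \<Omega>. \<bar>w x\<bar>) \<le> C3 * sqrt \<delta>"
  proof -
    have dv: "((\<lambda>x. u x + f x) has_derivative (\<lambda>k. p x \<bullet> k)) (at x)" if "x \<in> \<Omega>" for x
    proof -
      have "(f has_derivative (\<lambda>k. F x \<bullet> k)) (at x)" using f that by (simp add: grad_inner)
      from has_derivative_add[OF du(1)[OF that] this] show ?thesis by (simp add: p_def inner_add_left)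
    qed
    have qs: "\<exists>\<mu> e. dw x = \<mu> *\<^sub>R p x + e \<and> norm e \<le> q x" if "x \<in> \<Omega>" for x
      unfolding dwp q_def n_def using gradient_difference_split[of "p x" "p' x" C "dF x"] pne[OF that] pup[OF that] by simp
    have w0: "w x = 0" if "x \<in> frontier \<Omega>" for x using bdry[OF that] by (simp add: w_def)
    let ?W = "LINT x|lebesgue_on \<Omega>. \<bar>w x\<bar>" and ?Q = "LINT x|lebesgue_on \<Omega>. q x"
    have W0: "0 \<le> ?W" and Q0: "0 \<le> ?Q" using q0 by (auto intro!: integral_nonneg_AE)
    have "ennreal (cg / 3) * (ennreal (c / 2) * ennreal ?W) \<le> ennreal K * (ennreal (2 * Cg * \<beta>\<^sup>2) * (ennreal C * ennreal ?Q))"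
      using foliated_poincare[OF \<Omega>(1,2) c0 \<open>0 < cg\<close> dv cp(1) plo(1) pup(1) ddw cdw cwc w0 cq qs fol]
      unfolding nn_integral_indicator_eq_LINT[OF \<Omega>(1) iw abs_ge_zero] nn_integral_indicator_eq_LINT[OF \<Omega>(1) iq q0] \<beta>_def .
    \<comment> \<open>The conversion to \<open>ennreal\<close> sends negative reals to zero; making
      this explicit allows a return to real arithmetic.\<close>
    also have "ennreal K = ennreal (max 0 K)" by (simp add: max_def ennreal_neg)
    also have "ennreal (2 * Cg * \<beta>\<^sup>2) = ennreal (max 0 (2 * Cg * \<beta>\<^sup>2))" by (simp add: max_def ennreal_neg)
    finally have "ennreal (cg / 3 * (c / 2 * ?W)) \<le> ennreal (max 0 K * (max 0 (2 * Cg * \<beta>\<^sup>2) * (C * ?Q)))"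
      using \<open>0 < cg\<close> c0 C0 W0 Q0 by (simp add: ennreal_mult[symmetric])
    then have "cg / 3 * (c / 2 * ?W) \<le> max 0 K * (max 0 (2 * Cg * \<beta>\<^sup>2) * (C * ?Q))"
      using C0 Q0 by (subst (asm) ennreal_le_iff) auto
    then have "(cg / 3 * (c / 2)) * ?W \<le> (max 0 K * max 0 (2 * Cg * \<beta>\<^sup>2) * C) * ?Q" by (simp only: mult_ac)
    then have "?W \<le> CP * ?Q" unfolding CP_def using \<open>0 < cg\<close> c0 by (simp add: le_divide_eq mult_ac)
    also have "\<dots> \<le> CP * ((C * (V + C2) + \<Phi>) * sqrt \<delta>)" by (intro mult_left_mono q_int CP0)
    finally show ?thesis by (simp add: C3_def mult_ac)
  qed

  \<comment> \<open>Gradients in L2\<close>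
  have dw2: "(LINT x|lebesgue_on \<Omega>. (norm (dw x))\<^sup>2) \<le> C4 * sqrt \<delta>"
  proof -
    obtain Y where Y: "continuous_on \<Omega> Y" "\<And>x. x \<in> \<Omega> \<Longrightarrow> \<bar>Y x\<bar> \<le> CY"
      "\<And>w G. H10 \<Omega> w G \<Longrightarrow> (LINT x|lebesgue_on \<Omega>. G x \<bullet> p x + w x * Y x) = 0"
      by (rule admissible_poisson[OF dat H \<sigma>, folded CY_def p_def]) (rule that; assumption)
    obtain Y' where Y': "continuous_on \<Omega> Y'" "\<And>x. x \<in> \<Omega> \<Longrightarrow> \<bar>Y' x\<bar> \<le> CY"
      "\<And>w G. H10 \<Omega> w G \<Longrightarrow> (LINT x|lebesgue_on \<Omega>. G x \<bullet> p' x + w x * Y' x) = 0"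
      by (rule admissible_poisson[OF dat' H' \<sigma>', folded CY_def p'_def]) (rule that; assumption)
    have i1: "integrable (lebesgue_on \<Omega>) (\<lambda>x. G x \<bullet> p x + v x * Y x)"
      "integrable (lebesgue_on \<Omega>) (\<lambda>x. G x \<bullet> p' x + v x * Y' x)"
      if "continuous_on \<Omega> G" "continuous_on \<Omega> v" "\<And>x. x \<in> \<Omega> \<Longrightarrow> norm (G x) \<le> L" "\<And>x. x \<in> \<Omega> \<Longrightarrow> \<bar>v x\<bar> \<le> L * (2 * R)" for G v
      by (rule iGJ[OF that(1) cp(1) that(2) Y(1) that(3) pup(1) that(4) Y(2)], assumption+)
         (rule iGJ[OF that(1) cp(2) that(2) Y'(1) that(3) pup(2) that(4) Y'(2)], assumption+)
    note iu = i1[OF cg(1) cu'(1) gle(1) ule(1)] i1[OF cg(2) cu'(2) gle(2) ule(2)]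
    \<comment> \<open>The same four tests, now in the Poisson equations. There the pairing is with
      \<open>p - p' = dw + dF\<close>, so the square of the norm of \<open>dw\<close> appears
      directly, and \<open>w\<close> enters multiplied by the bounded \<open>Y - Y'\<close>.\<close>
    define E where "E x = ((grad u x \<bullet> p x + u x * Y x) - (grad u' x \<bullet> p x + u' x * Y x))
        - ((grad u x \<bullet> p' x + u x * Y' x) - (grad u' x \<bullet> p' x + u' x * Y' x))" for x
    have iE: "integrable (lebesgue_on \<Omega>) E" and E0: "(LINT x|lebesgue_on \<Omega>. E x) = 0"
      unfolding E_def using iu Y(3)[OF Hu(1)] Y(3)[OF Hu(2)] Y'(3)[OF Hu(1)] Y'(3)[OF Hu(2)] by simp_all
    have E: "E x = (norm (dw x))\<^sup>2 + dw x \<bullet> dF x + w x * (Y x - Y' x)" for x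
    proof -
      have "E x = dw x \<bullet> (p x - p' x) + w x * (Y x - Y' x)"
        by (simp add: E_def dw_def w_def inner_diff_left inner_diff_right algebra_simps)
      moreover have "p x - p' x = dw x + dF x" by (simp add: dwp)
      ultimately show ?thesis by (simp add: inner_add_right dot_square_norm)
    qed
    have "(LINT x|lebesgue_on \<Omega>. (norm (dw x))\<^sup>2) \<le> (LINT x|lebesgue_on \<Omega>. E x + (2 * L * norm (dF x) + 2 * CY * \<bar>w x\<bar>))"
    proof (rule integral_mono)
      show "integrable (lebesgue_on \<Omega>) (\<lambda>x. (norm (dw x))\<^sup>2)" using L2(2) by (simp add: in_L2_def)
      show "integrable (lebesgue_on \<Omega>) (\<lambda>x. E x + (2 * L * norm (dF x) + 2 * CY * \<bar>w x\<bar>))" using iE id iw by simp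
      fix x assume "x \<in> space (lebesgue_on \<Omega>)"
      then have x: "x \<in> \<Omega>" by (simp add: space_restrict_space)
      have "\<bar>dw x \<bullet> dF x\<bar> \<le> 2 * L * norm (dF x)"
        by (rule order_trans[OF Cauchy_Schwarz_ineq2 mult_right_mono[OF dw_le[OF x] norm_ge_zero]])
      moreover have "\<bar>w x * (Y x - Y' x)\<bar> \<le> 2 * CY * \<bar>w x\<bar>"
      proof -
        have "\<bar>Y x - Y' x\<bar> \<le> 2 * CY" using Y(2)[OF x] Y'(2)[OF x] by linarith
        then show ?thesis by (simp add: abs_mult mult.commute mult_left_mono)
      qed
      ultimately show "(norm (dw x))\<^sup>2 \<le> E x + (2 * L * norm (dF x) + 2 * CY * \<bar>w x\<bar>)" unfolding E by linarith
    qed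
    also have "\<dots> = 2 * L * \<phi> + 2 * CY * (LINT x|lebesgue_on \<Omega>. \<bar>w x\<bar>)"
      using iE id iw E0 unfolding \<phi>_eq by simp
    also have "\<dots> \<le> 2 * L * (\<Phi> * sqrt \<delta>) + 2 * CY * (C3 * sqrt \<delta>)"
      using \<phi>_sqrt w1 L0 CY0 by (intro add_mono mult_left_mono) auto
    finally show ?thesis by (simp add: C4_def algebra_simps)
  qed
  \<comment> \<open>The second square root: the squared L2 norm is already of order
    \<open>sqrt \<delta>\<close>.\<close>
  have "(LINT x|lebesgue_on \<Omega>. norm (dw x)) \<le> (V + C4) * sqrt (sqrt \<delta>)"
    unfolding V_def using \<delta>0 by (intro integral_norm_le_sqrt[OF \<Omega>(1,2) L2(2) _ C40 dw2]) simp
  also have "\<dots> \<le> (V + C4) * (h powr (1/4) + A powr (1/4) + \<phi> powr (1/4))"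
    unfolding \<delta>_def using V0 C40 by (intro mult_left_mono sqrt_sqrt_add3_le h A \<phi>0) auto
  finally show ?thesis unfolding const_eq h_def A_def \<phi>_def dF_def L1_norm_def dw_def .
qed

theorem theorem4p4:
  fixes \<Omega> :: "(real^3) set"
    and m M k1 k2 K Kt \<sigma>0 \<sigma>1 \<sigma>2 cg Cg :: real
  assumes "open \<Omega>" "connected \<Omega>" "bounded \<Omega>" "lipschitz_boundary \<Omega>"
    and "0 < m" "0 < \<sigma>0" "0 < \<sigma>1" "0 < cg"
  shows "\<exists>C. \<forall>(a :: real^3 \<Rightarrow> real) a' F F' f f' H H' u u1 u2 u' \<sigma> s1 s2 \<sigma>'.
    a \<in> borel_measurable (lebesgue_on \<Omega>) \<and> a' \<in> borel_measurable (lebesgue_on \<Omega>) \<and>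
    (AE x in lebesgue_on \<Omega>. m \<le> a x \<and> a x \<le> M) \<and>
    (AE x in lebesgue_on \<Omega>. m \<le> a' x \<and> a' x \<le> M) \<and>
    Ck_on 1 \<Omega> f \<and> continuous_on (closure \<Omega>) f \<and> (\<forall>x\<in>\<Omega>. F x = grad f x) \<and>
    Ck_on 1 \<Omega> f' \<and> continuous_on (closure \<Omega>) f' \<and> (\<forall>x\<in>\<Omega>. F' x = grad f' x) \<and>
    L1_norm \<Omega> F \<le> k1 \<and>
    admissible \<sigma>0 \<sigma>1 m M \<Omega> a F H u \<sigma> \<and>
    admissible \<sigma>0 \<sigma>1 m M \<Omega> a F H' u1 s1 \<and>
    admissible \<sigma>0 \<sigma>1 m M \<Omega> a' F H' u2 s2 \<and>
    admissible \<sigma>0 \<sigma>1 m M \<Omega> a' F' H' u' \<sigma>' \<and>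
    (\<forall>x\<in>frontier \<Omega>. u x = 0 \<and> u1 x = 0 \<and> u2 x = 0 \<and> u' x = 0) \<and>
    Ck_closure_field 2 \<Omega> F \<and> Ck_norm_field 2 \<Omega> F \<le> k2 \<and>
    Ck_closure_field 2 \<Omega> F' \<and> Ck_norm_field 2 \<Omega> F' \<le> k2 \<and>
    Ck_closure 1 \<Omega> H \<and> Ck_norm 1 \<Omega> H \<le> k2 \<and>
    Ck_closure 1 \<Omega> H' \<and> Ck_norm 1 \<Omega> H' \<le> k2 \<and>
    (\<forall>s\<in>{\<sigma>, s1, s2, \<sigma>'}. Ck_closure 2 \<Omega> s \<and> Ck_norm 2 \<Omega> s \<le> \<sigma>2) \<and>
    (\<forall>v\<in>{\<lambda>x. u x + f x, \<lambda>x. u1 x + f x, \<lambda>x. u2 x + f x}.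
       \<exists>g. foliation \<Omega> v g cg Cg K \<and> well_structured \<Omega> v g Kt)
    \<longrightarrow>
    L1_norm \<Omega> (\<lambda>x. grad u x - grad u' x)
      \<le> C * (Linf_norm \<Omega> (\<lambda>x. H x - H' x) powr (1/4)
            + Linf_norm \<Omega> (\<lambda>x. a x - a' x) powr (1/4)
            + L1_norm \<Omega> (\<lambda>x. F x - F' x) powr (1/4))"
proof -
  obtain R where R: "\<And>x. x \<in> \<Omega> \<Longrightarrow> norm x \<le> R" using \<open>bounded \<Omega>\<close> unfolding bounded_iff by auto
  show ?thesis
  \<comment> \<open>For an empty \<open>\<Omega>\<close> the left-hand side is zero, but the sign of
    \<open>stability_constant\<close> is then unknown; the absolute value covers this case.\<close>
  proof (intro exI[of _ "\<bar>stability_constant \<Omega> m M k2 K \<sigma>0 \<sigma>1 \<sigma>2 cg Cg R\<bar>"] allI impI, elim conjE)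
    fix a a' F F' f f' H H' u u1 u2 u' \<sigma> s1 s2 \<sigma>'
    assume h: "a \<in> borel_measurable (lebesgue_on \<Omega>)" "AE x in lebesgue_on \<Omega>. m \<le> a x \<and> a x \<le> M"
      "a' \<in> borel_measurable (lebesgue_on \<Omega>)" "AE x in lebesgue_on \<Omega>. m \<le> a' x \<and> a' x \<le> M"
      and f: "Ck_on 1 \<Omega> f" "\<forall>x\<in>\<Omega>. F x = grad f x"
      and adm: "admissible \<sigma>0 \<sigma>1 m M \<Omega> a F H u \<sigma>" "admissible \<sigma>0 \<sigma>1 m M \<Omega> a' F' H' u' \<sigma>'"
      and bdry: "\<forall>x\<in>frontier \<Omega>. u x = 0 \<and> u1 x = 0 \<and> u2 x = 0 \<and> u' x = 0"
      and reg: "Ck_closure_field 2 \<Omega> F" "Ck_norm_field 2 \<Omega> F \<le> k2" "Ck_closure_field 2 \<Omega> F'" "Ck_norm_field 2 \<Omega> F' \<le> k2"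
        "Ck_closure 1 \<Omega> H" "Ck_norm 1 \<Omega> H \<le> k2" "Ck_closure 1 \<Omega> H'" "Ck_norm 1 \<Omega> H' \<le> k2"
      and \<sigma>: "\<forall>s\<in>{\<sigma>, s1, s2, \<sigma>'}. Ck_closure 2 \<Omega> s \<and> Ck_norm 2 \<Omega> s \<le> \<sigma>2"
      and fol: "\<forall>v\<in>{\<lambda>x. u x + f x, \<lambda>x. u1 x + f x, \<lambda>x. u2 x + f x}.
        \<exists>g. foliation \<Omega> v g cg Cg K \<and> well_structured \<Omega> v g Kt"
    let ?S = "Linf_norm \<Omega> (\<lambda>x. H x - H' x) powr (1/4) + Linf_norm \<Omega> (\<lambda>x. a x - a' x) powr (1/4)
      + L1_norm \<Omega> (\<lambda>x. F x - F' x) powr (1/4)"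
    have S: "0 \<le> ?S" by (intro add_nonneg_nonneg powr_ge_zero)
    show "L1_norm \<Omega> (\<lambda>x. grad u x - grad u' x) \<le> \<bar>stability_constant \<Omega> m M k2 K \<sigma>0 \<sigma>1 \<sigma>2 cg Cg R\<bar> * ?S"
    proof (cases "\<Omega> = {}")
      case True
      then have "L1_norm \<Omega> (\<lambda>x. grad u x - grad u' x) = 0" by (simp add: L1_norm_def)
      with S show ?thesis by simp
    next
      case False
      obtain g where g: "foliation \<Omega> (\<lambda>x. u x + f x) g cg Cg K" using fol by auto
      have "L1_norm \<Omega> (\<lambda>x. grad u x - grad u' x) \<le> stability_constant \<Omega> m M k2 K \<sigma>0 \<sigma>1 \<sigma>2 cg Cg R * ?S"
        using assms(5-8) f bdry \<sigma> False
        by (intro stability_estimate[OF \<open>open \<Omega>\<close> \<open>bounded \<Omega>\<close> _ R _ _ _ _ h _ _ adm _ reg _ _ _ _ g]) auto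
      also have "\<dots> \<le> \<bar>stability_constant \<Omega> m M k2 K \<sigma>0 \<sigma>1 \<sigma>2 cg Cg R\<bar> * ?S"
        by (rule mult_right_mono[OF abs_ge_self S])
      finally show ?thesis .
    qed
  qed
qed

end
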